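(* Let $m$ be an odd positive integer. (I) If $m\equiv 0\pmod 3$, then $3$ divides the class number of the quadratic field $\mathbb{Q}\left(\sqrt{-3(4m^3+1)}\right)$. (II) If $m\equiv 4\pmod{15}$, then for every odd integer $n\geq 3$, $3$ divides the class number of the quadratic field $\mathbb{Q}\left(\sqrt{3(2m^{3n}-1)}\right)$. *)

theory Defs
  imports
    Complex_Main
    "HOL-Computational_Algebra.Polynomial"
    "HOL-Number_Theory.Cong"
    "HOL-Algebra.Coset"
    "HOL-Algebra.Ideal_Product"
    "HOL-Algebra.Algebraic_Closure_Type"
begin

text \<open>Number fields are represented by their carriers, as subsets of the complex numbers.\<close>

definition quadratic_field :: "int \<Rightarrow> complex set" where
  "quadratic_field d = {of_rat a + of_rat b * csqrt (of_int d) | a b. True}"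

definition ring_of_integers :: "complex set \<Rightarrow> complex set" where
  "ring_of_integers K = {x \<in> K. algebraic_int x}"

definition fractional_ideal :: "complex set \<Rightarrow> complex set \<Rightarrow> bool" where
  "fractional_ideal K M \<longleftrightarrow>
     M \<subseteq> K \<and> M \<noteq> {0} \<and>
     additive_subgroup M ring_of_type_algebra \<and>
     (\<forall>r \<in> ring_of_integers K. \<forall>x \<in> M. r * x \<in> M) \<and>
     (\<exists>c \<in> ring_of_integers K. c \<noteq> 0 \<and> (\<forall>x \<in> M. c * x \<in> ring_of_integers K))"

text \<open>
  The product of two fractional ideals consists of the finite sums of products of their elements.
  The operation \<^const>\<open>ideal_prod\<close> refers to the ring only through its addition and
  multiplication, so it may be taken in the ring of all complex numbers.
\<close>

definition fractional_ideal_group :: "complex set \<Rightarrow> complex set monoid" where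
  "fractional_ideal_group K =
     \<lparr> carrier = {M. fractional_ideal K M},
       monoid.mult = ideal_prod ring_of_type_algebra,
       one = ring_of_integers K \<rparr>"

definition principal_fractional_ideals :: "complex set \<Rightarrow> complex set set" where
  "principal_fractional_ideals K = {(\<lambda>r. x * r) ` ring_of_integers K | x. x \<in> K \<and> x \<noteq> 0}"

definition class_group :: "complex set \<Rightarrow> complex set set monoid" where
  "class_group K = fractional_ideal_group K Mod principal_fractional_ideals K"

definition class_number :: "complex set \<Rightarrow> nat" where
  "class_number K = Coset.order (class_group K)"

end

theory Submission
  imports
    Defs
    "Jordan_Normal_Form.Char_Poly"
    "HOL-Number_Theory.Residues"
begin

text \<open>
  Let \<open>K\<close> be the quadratic field in question, and let \<open>P\<close> be a prime ideal above
  \<open>q = 2\<close> in the first case and above \<open>q = 5\<close> in the second, where \<open>q\<close> splits in \<open>K\<close>. The claim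
  is that \<open>P\<^sup>n\<close> can only be principal if \<open>3\<close> divides \<open>n\<close>; then \<open>3\<close> divides the order of the class
  of \<open>P\<close>, hence the class number.

  If \<open>P\<^sup>n\<close> is generated by \<open>\<gamma>\<close>, then the norm equation for \<open>\<gamma>\<close> is rewritten as an equation for the
  norm \<open>N\<close> of an Eisenstein integer \<open>\<delta>\<close>: up to the square of an integer \<open>f\<close>, it reads
  \<open>N = 2\<^sup>n f\<^sup>2 - 3 m\<^sup>3 Y\<^sup>2\<close> or \<open>N = \<plusminus> 5\<^sup>n f\<^sup>2 + 6 M\<^sup>3 Y\<^sup>2\<close>. Modulo \<open>\<delta>\<close> this determines the \<open>n\<close>-th power
  of the cubic residue symbol of \<open>q\<close>. By cubic reciprocity between \<open>\<delta>\<close> and rational integers, all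
  remaining symbols cancel, whereas the symbol of \<open>q\<close> itself is not trivial, so \<open>3\<close> divides \<open>n\<close>.

  The form of cubic reciprocity needed here follows from the identity \<open>g\<^sup>3 = p J\<close> for the Gauss sum \<open>g\<close>
  and the Jacobi sum \<open>J\<close> of a cubic character modulo \<open>p\<close>, and the congruence obtained by applying
  the Frobenius map of a rational prime twice to \<open>g\<close>. Dividing \<open>\<delta>\<close> by Jacobi sums one after another replaces
  unique factorisation of Eisenstein integers.
\<close>

hide_const (open) Divisibility.prime

section \<open>Algebraic integers\<close>

text \<open>The terms +1 and -1 in the radicands make the method possible: they cancel the 3 Y^2 in
  the norm of \<delta> = (f x + Y sqrt(-3)) / 2 or \<delta> = f x + Y sqrt(-3). What remains says
  that modulo \<delta> a power of q times f^2 is a small constant times a cube times Y^2. The cube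
  has trivial symbol, but f and Y are unknown. The symbol of f is computable because \<delta> is a
  multiple of sqrt(-3) modulo f. The combination 3 b^2 is computable because (a + b)^2 = N + 3 a b,
  and \<delta> is a multiple of \<omega> - 1 modulo every prime factor of a + b. All symbols are
  thus expressed by a, b, the exponent i in \<delta> = +-\<omega>^i modulo 3, and squares modulo 9;
  the congruences for m make these terms cancel modulo 3. The integer f is a denominator that occurs
  because the radicand need not be squarefree.\<close>

definition int_span :: "'i set \<Rightarrow> ('i \<Rightarrow> complex) \<Rightarrow> complex set" where
  "int_span I v = {\<Sum>j\<in>I. of_int (c j) * v j | c. True}"

lemma int_span_base:
  assumes "finite I" "i \<in> I"
  shows "v i \<in> int_span I v"
proof -
  have "(\<Sum>j\<in>I. of_int (if j = i then 1 else 0) * v j) = (\<Sum>j\<in>I. if j = i then v j else 0)"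
    by (intro sum.cong) auto
  also have "\<dots> = v i"
    using assms by (simp add: sum.delta)
  finally show ?thesis
    unfolding int_span_def by (intro CollectI exI[of _ "\<lambda>j. if j = i then 1 else 0"]) simp
qed

lemma int_span_add:
  assumes "x \<in> int_span I v" "y \<in> int_span I v"
  shows "x + y \<in> int_span I v"
proof -
  from assms obtain c d where "x = (\<Sum>j\<in>I. of_int (c j) * v j)" "y = (\<Sum>j\<in>I. of_int (d j) * v j)"
    unfolding int_span_def by blast
  hence "x + y = (\<Sum>j\<in>I. of_int (c j + d j) * v j)"
    by (simp add: sum.distrib algebra_simps)
  thus ?thesis unfolding int_span_def by (intro CollectI exI[of _ "\<lambda>j. c j + d j"]) simp
qed

lemma int_span_scale:
  assumes "x \<in> int_span I v"
  shows "of_int k * x \<in> int_span I v"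
proof -
  from assms obtain c where "x = (\<Sum>j\<in>I. of_int (c j) * v j)"
    unfolding int_span_def by blast
  hence "of_int k * x = (\<Sum>j\<in>I. of_int (k * c j) * v j)"
    by (simp add: sum_distrib_left algebra_simps)
  thus ?thesis unfolding int_span_def by (intro CollectI exI[of _ "\<lambda>j. k * c j"]) simp
qed

lemma int_span_sum:
  assumes "\<And>a. a \<in> S \<Longrightarrow> f a \<in> int_span I v"
  shows "(\<Sum>a\<in>S. of_int (c a) * f a) \<in> int_span I v"
proof -
  have 0: "0 \<in> int_span I v"
    unfolding int_span_def by (intro CollectI exI[of _ "\<lambda>_. 0"]) simp
  show ?thesis using assms
    by (induction S rule: infinite_finite_induct) (auto intro: 0 int_span_add int_span_scale)
qed

lemma int_span_mult_closed:
  assumes "\<And>i. i \<in> I \<Longrightarrow> z * v i \<in> int_span I v" "x \<in> int_span I v"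
  shows "z * x \<in> int_span I v"
proof -
  from assms(2) obtain c where "x = (\<Sum>j\<in>I. of_int (c j) * v j)"
    unfolding int_span_def by blast
  hence "z * x = (\<Sum>j\<in>I. of_int (c j) * (z * v j))"
    by (simp add: sum_distrib_left algebra_simps)
  thus ?thesis using int_span_sum[of I "\<lambda>j. z * v j" I v c] assms(1) by simp
qed

text \<open>The numbers \<open>v i\<close> form a nonzero eigenvector of the integer matrix
  \<open>A\<close>, so \<open>z\<close> is a root of its characteristic polynomial, which is monic
  with integer coefficients.\<close>

lemma algebraic_int_if_int_matrix_eigenvalue:
  fixes z :: complex and v :: "nat \<Rightarrow> complex" and A :: "nat \<Rightarrow> nat \<Rightarrow> int"
  assumes ev: "\<And>i. i < n \<Longrightarrow> z * v i = (\<Sum>j<n. of_int (A i j) * v j)"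
    and nz: "k < n" "v k \<noteq> 0"
  shows "algebraic_int z"
proof -
  define M :: "int mat" where "M = Matrix.mat n n (\<lambda>(i, j). A i j)"
  define C :: "complex mat" where "C = map_mat of_int M"
  have M: "M \<in> carrier_mat n n" and C: "C \<in> carrier_mat n n"
    by (auto simp: M_def C_def)
  have "eigenvector C (Matrix.vec n v) z"
    unfolding eigenvector_def
  proof (intro conjI)
    show "Matrix.vec n v \<in> carrier_vec (dim_row C)" using C by auto
    show "Matrix.vec n v \<noteq> 0\<^sub>v (dim_row C)"
    proof
      assume "Matrix.vec n v = 0\<^sub>v (dim_row C)"
      hence "vec_index (Matrix.vec n v) k = vec_index (0\<^sub>v (dim_row C)) k" by simp
      thus False using nz C by simp
    qed
    show "C *\<^sub>v Matrix.vec n v = z \<cdot>\<^sub>v Matrix.vec n v"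
      by (rule eq_vecI)
        (use ev in \<open>auto simp: C_def M_def scalar_prod_def mult_mat_vec_def atLeast0LessThan\<close>)
  qed
  hence "eigenvalue C z" unfolding eigenvalue_def by blast
  hence "poly (char_poly C) z = 0" using eigenvalue_root_char_poly[OF C] by simp
  moreover have "char_poly C = map_poly of_int (char_poly M)"
    unfolding C_def by (rule of_int_hom.char_poly_hom[OF M])
  moreover have "monic (char_poly M)" using degree_monic_char_poly[OF M] by simp
  ultimately show ?thesis unfolding algebraic_int_altdef_ipoly by auto
qed

text \<open>Integrality criterion by the determinant trick: multiplication by \<open>z\<close>
  preserves a finitely generated subgroup of the complex numbers that has a nonzero
  generator.\<close>

lemma algebraic_int_if_int_span_closed:
  fixes v :: "'i \<Rightarrow> complex"
  assumes fin: "finite I" and cl: "\<And>i. i \<in> I \<Longrightarrow> z * v i \<in> int_span I v"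
    and nz: "k \<in> I" "v k \<noteq> 0"
  shows "algebraic_int z"
proof -
  obtain h where h: "bij_betw h {0..<card I} I" using ex_bij_betw_nat_finite[OF fin] by blast
  have "\<exists>c. \<forall>i\<in>I. z * v i = (\<Sum>j\<in>I. of_int (c i j) * v j)"
    using cl unfolding int_span_def by (intro bchoice) auto
  then obtain c where c: "\<And>i. i \<in> I \<Longrightarrow> z * v i = (\<Sum>j\<in>I. of_int (c i j) * v j)" by blast
  from nz h obtain k' where k': "k' < card I" "h k' = k"
    by (metis atLeastLessThan_iff bij_betw_iff_bijections)
  show ?thesis
  proof (rule algebraic_int_if_int_matrix_eigenvalue[where v = "v \<circ> h" and n = "card I" and k = k'
        and A = "\<lambda>i j. c (h i) (h j)"])
    fix i assume "i < card I"
    hence "h i \<in> I" using h by (auto simp: bij_betw_def)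
    from c[OF this] have "z * v (h i) = (\<Sum>j\<in>I. of_int (c (h i) j) * v j)" .
    also have "\<dots> = (\<Sum>j\<in>{0..<card I}. of_int (c (h i) (h j)) * v (h j))"
      using sum.reindex_bij_betw[OF h, of "\<lambda>j. of_int (c (h i) j) * v j"] by simp
    finally show "z * (v \<circ> h) i = (\<Sum>j<card I. of_int (c (h i) (h j)) * (v \<circ> h) j)"
      by (simp add: atLeast0LessThan)
  qed (use k' nz in auto)
qed

lemma algebraic_int_power_reduce:
  fixes x :: complex
  assumes "algebraic_int x"
  obtains n c where "n > 0" "x ^ n = (\<Sum>i<n. of_int (c i) * x ^ i)"
proof -
  from assms obtain p :: "int poly" where p: "poly (map_poly of_int p) x = 0" "lead_coeff p = 1"
    unfolding algebraic_int_altdef_ipoly by blast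
  have deg: "degree p > 0"
  proof (rule ccontr)
    assume "\<not> degree p > 0"
    then obtain a where "p = [:a:]" by (auto elim: degree_eq_zeroE)
    with p show False by simp
  qed
  have "0 = (\<Sum>i\<le>degree p. of_int (coeff p i) * x ^ i)"
    using p(1) by (simp add: poly_altdef degree_map_poly coeff_map_poly)
  also have "\<dots> = (\<Sum>i<degree p. of_int (coeff p i) * x ^ i) + x ^ degree p"
    using p(2) by (simp add: lessThan_Suc_atMost[symmetric])
  finally have "x ^ degree p = (\<Sum>i<degree p. of_int (- coeff p i) * x ^ i)"
    by (simp add: sum_negf eq_neg_iff_add_eq_0 add.commute)
  thus thesis using that[OF deg, of "\<lambda>i. - coeff p i"] by blast
qed

text \<open>The products x^i y^j with i < n and j < m span Z[x, y] over the integers, since x^n and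
  y^m can be replaced by lower powers. Both \<open>x\<close> and \<open>y\<close> preserve this
  span, hence so do their sum and their product.\<close>

lemma algebraic_int_add_mult:
  fixes x y :: complex
  assumes "algebraic_int x" "algebraic_int y"
  shows "algebraic_int (x + y)" "algebraic_int (x * y)"
proof -
  obtain n c where n: "n > 0" "x ^ n = (\<Sum>i<n. of_int (c i) * x ^ i)"
    by (rule algebraic_int_power_reduce[OF assms(1)])
  obtain m d where m: "m > 0" "y ^ m = (\<Sum>i<m. of_int (d i) * y ^ i)"
    by (rule algebraic_int_power_reduce[OF assms(2)])
  define I where "I = {..<n} \<times> {..<m}"
  define v where "v = (\<lambda>(i, j). x ^ i * y ^ j)"
  have fin: "finite I" unfolding I_def by simp
  have x: "x * v k \<in> int_span I v" if kI: "k \<in> I" for k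
  proof -
    obtain i j where k: "k = (i, j)" "i < n" "j < m" using kI unfolding I_def by (cases k) auto
    show ?thesis
    proof (cases "Suc i < n")
      case True
      have "v (Suc i, j) \<in> int_span I v"
        by (rule int_span_base) (use True k in \<open>auto simp: I_def\<close>)
      thus ?thesis by (simp add: k v_def mult_ac)
    next
      case False
      hence "Suc i = n" using k by simp
      hence "x * v k = x ^ n * y ^ j" by (auto simp: k v_def mult_ac)
      also have "\<dots> = (\<Sum>l<n. of_int (c l) * v (l, j))"
        unfolding n(2) by (simp add: sum_distrib_right sum_distrib_left v_def mult_ac)
      also have "\<dots> \<in> int_span I v"
        by (rule int_span_sum, rule int_span_base) (use k in \<open>auto simp: I_def\<close>)
      finally show ?thesis .
    qed
  qed
  have y: "y * v k \<in> int_span I v" if kI: "k \<in> I" for k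
  proof -
    obtain i j where k: "k = (i, j)" "i < n" "j < m" using kI unfolding I_def by (cases k) auto
    show ?thesis
    proof (cases "Suc j < m")
      case True
      have "v (i, Suc j) \<in> int_span I v"
        by (rule int_span_base) (use True k in \<open>auto simp: I_def\<close>)
      thus ?thesis by (simp add: k v_def mult_ac)
    next
      case False
      hence "Suc j = m" using k by simp
      hence "y * v k = x ^ i * y ^ m" by (auto simp: k v_def mult_ac)
      also have "\<dots> = (\<Sum>l<m. of_int (d l) * v (i, l))"
        unfolding m(2) by (simp add: sum_distrib_left v_def mult_ac)
      also have "\<dots> \<in> int_span I v"
        by (rule int_span_sum, rule int_span_base) (use k in \<open>auto simp: I_def\<close>)
      finally show ?thesis .
    qed
  qed
  have one: "(0, 0) \<in> I" "v (0, 0) \<noteq> 0" using n m by (auto simp: I_def v_def)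
  show "algebraic_int (x + y)"
    by (rule algebraic_int_if_int_span_closed[where v = v, OF fin _ one])
      (simp add: distrib_right int_span_add x y)
  show "algebraic_int (x * y)"
    by (rule algebraic_int_if_int_span_closed[where v = v, OF fin _ one])
      (simp add: mult.assoc int_span_mult_closed x y)
qed

lemma algebraic_int_diff:
  fixes x y :: complex
  shows "algebraic_int x \<Longrightarrow> algebraic_int y \<Longrightarrow> algebraic_int (x - y)"
  using algebraic_int_add_mult(1)[of x "- y"] by simp

lemma algebraic_int_sum:
  fixes f :: "'i \<Rightarrow> complex"
  shows "(\<And>i. i \<in> S \<Longrightarrow> algebraic_int (f i)) \<Longrightarrow> algebraic_int (\<Sum>i\<in>S. f i)"
  by (induction S rule: infinite_finite_induct) (auto intro: algebraic_int_add_mult)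

lemma algebraic_int_power:
  fixes x :: complex
  shows "algebraic_int x \<Longrightarrow> algebraic_int (x ^ n)"
  by (induction n) (auto intro: algebraic_int_add_mult)

section \<open>Roots of unity and Eisenstein integers\<close>

text \<open>The integer argument \<open>k\<close> is an exponent that matters only modulo
  \<open>n\<close>. Cubic symbols are later recorded as such exponents of \<open>zeta 3\<close>, so
  that negative values and congruences modulo 3 can be used directly.\<close>

definition zeta :: "int \<Rightarrow> int \<Rightarrow> complex" where
  "zeta n k = cis (2 * pi * of_int k / of_int n)"

lemma zeta_add: "zeta n (k + l) = zeta n k * zeta n l"
  by (simp add: zeta_def cis_mult ring_distribs add_divide_distrib)

lemma zeta_0 [simp]: "zeta n 0 = 1"
  by (simp add: zeta_def)

lemma zeta_power: "zeta n k ^ j = zeta n (of_nat j * k)"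
  by (simp add: zeta_def Complex.DeMoivre mult_ac)

lemma zeta_nonzero [simp]: "zeta n k \<noteq> 0"
  by (simp add: zeta_def)

lemma cnj_zeta: "cnj (zeta n k) = zeta n (- k)"
  by (simp add: zeta_def cis_cnj)

lemma zeta_eq_1_iff:
  assumes "n > 0"
  shows "zeta n k = 1 \<longleftrightarrow> n dvd k"
proof
  assume "zeta n k = 1"
  hence "cos (2 * pi * of_int k / of_int n) = 1"
    by (simp add: zeta_def complex_eq_iff)
  then obtain j :: int where "2 * pi * of_int k / of_int n = of_int j * 2 * pi"
    using cos_one_2pi_int by blast
  hence "(of_int k :: real) = of_int (j * n)"
    using assms by (simp add: field_simps)
  hence "k = j * n" by linarith
  thus "n dvd k" by simp
next
  assume "n dvd k"
  then obtain j where "k = n * j" by blast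
  hence "2 * pi * of_int k / of_int n = 2 * pi * of_int j" using assms by simp
  hence "zeta n k = cis (2 * pi * of_int j)" unfolding zeta_def by (simp only:)
  thus "zeta n k = 1" using cis_multiple_2pi[of "of_int j"] by (simp only: Ints_of_int)
qed

lemma zeta_eq_iff:
  assumes "n > 0"
  shows "zeta n k = zeta n l \<longleftrightarrow> n dvd k - l"
proof -
  have "zeta n k = zeta n (k - l) * zeta n l" by (simp flip: zeta_add)
  thus ?thesis using zeta_eq_1_iff[OF assms, of "k - l"] by auto
qed

lemma algebraic_int_root_of_unity:
  fixes z :: complex
  assumes "z ^ n = 1" "n > 0"
  shows "algebraic_int z"
  by (rule algebraic_int_root[of 1 "Polynomial.monom 1 n"])
    (use assms in \<open>auto simp: poly_monom degree_monom_eq\<close>)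

lemma algebraic_int_zeta [simp]:
  assumes "n > 0"
  shows "algebraic_int (zeta n k)"
proof (rule algebraic_int_root_of_unity)
  show "zeta n k ^ nat n = 1"
    using assms by (simp add: zeta_power zeta_eq_1_iff)
qed (use assms in auto)

text \<open>For algebraic integers this is congruence modulo \<open>q\<close> in the ring of all
  algebraic integers. That ring contains Gauss sums, roots of unity of every order and Eisenstein
  integers at once, so no cyclotomic field has to be fixed.\<close>

definition acong :: "int \<Rightarrow> complex \<Rightarrow> complex \<Rightarrow> bool" where
  "acong q x y \<longleftrightarrow> algebraic_int ((x - y) / of_int q)"

lemma acong_refl [simp]: "acong q x x"
  by (simp add: acong_def)

lemma acong_sym: "acong q x y \<Longrightarrow> acong q y x"
  unfolding acong_def using algebraic_int_minus[of "(x - y) / of_int q"]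
  by (metis minus_diff_eq minus_divide_left)

lemma acong_add: "acong q x x' \<Longrightarrow> acong q y y' \<Longrightarrow> acong q (x + y) (x' + y')"
  unfolding acong_def
  using algebraic_int_add_mult(1)[of "(x - x') / of_int q" "(y - y') / of_int q"]
  by (simp add: add_divide_distrib diff_divide_distrib algebra_simps)

lemma acong_trans [trans]: "acong q x y \<Longrightarrow> acong q y z \<Longrightarrow> acong q x z"
  using acong_add[of q x y y z] unfolding acong_def by (simp add: algebra_simps)

lemma acong_sum:
  "(\<And>i. i \<in> S \<Longrightarrow> acong q (f i) (g i)) \<Longrightarrow> acong q (\<Sum>i\<in>S. f i) (\<Sum>i\<in>S. g i)"
  by (induction S rule: infinite_finite_induct) (auto intro: acong_add)

lemma acong_scale:
  assumes "acong q x y" "algebraic_int z"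
  shows "acong q (z * x) (z * y)"
  using algebraic_int_add_mult(2)[of z "(x - y) / of_int q"] assms
  unfolding acong_def by (simp add: algebra_simps)

lemma acong_mult:
  assumes "acong q x x'" "acong q y y'" "algebraic_int x" "algebraic_int y'"
  shows "acong q (x * y) (x' * y')"
proof -
  have "acong q (x * y) (x * y')" using assms by (intro acong_scale)
  also have "acong q (x * y') (x' * y')"
    using acong_scale[OF assms(1,4)] by (simp add: mult_ac)
  finally show ?thesis .
qed

lemma acong_power:
  assumes "acong q x y" "algebraic_int x" "algebraic_int y"
  shows "acong q (x ^ n) (y ^ n)"
  by (induction n) (auto intro!: acong_mult algebraic_int_power assms)

lemma acong_multiple: "algebraic_int x \<Longrightarrow> acong q (of_int q * x) 0"
  by (cases "q = 0") (auto simp: acong_def)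

lemma acong_of_int: "[a = b] (mod q) \<Longrightarrow> acong q (of_int a) (of_int b)"
proof -
  assume "[a = b] (mod q)"
  then obtain k where "a = b + q * k" by (metis cong_iff_lin cong_sym)
  thus ?thesis using acong_add[OF acong_refl acong_multiple[of "of_int k" q], of "of_int b"]
    by simp
qed

lemma acong_cancel_int:
  assumes "acong q (of_int a * x) (of_int a * y)" "coprime a q"
    "algebraic_int x" "algebraic_int y"
  shows "acong q x y"
proof -
  obtain b where b: "[b * a = 1] (mod q)"
    using cong_solve_coprime_int[OF assms(2)] by (auto simp: mult.commute)
  have *: "acong q (of_int (b * a) * z) z" if "algebraic_int z" for z
    using acong_scale[OF acong_of_int[OF b] that] by (simp add: mult_ac)
  have "acong q x (of_int (b * a) * x)" by (rule acong_sym, rule *, fact)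
  also have "acong q \<dots> (of_int (b * a) * y)"
    using acong_scale[OF assms(1), of "of_int b"] by (simp add: mult_ac)
  also have "acong q \<dots> y" by (rule *, fact)
  finally show ?thesis .
qed

lemma acong_frobenius:
  assumes q: "prime q" and x: "algebraic_int x" and y: "algebraic_int y"
  shows "acong (int q) ((x + y) ^ q) (x ^ q + y ^ q)"
proof -
  have q0: "q > 0" using q by (simp add: prime_gt_0_nat)
  define f where "f k = of_nat (q choose k) * x ^ k * y ^ (q - k)" for k
  have "(x + y) ^ q = (\<Sum>k\<le>q. f k)"
    unfolding f_def by (rule binomial_ring)
  also have "{..q} = insert 0 (insert q {0<..<q})" using q0 by auto
  also have "(\<Sum>k\<in>\<dots>. f k) = (x ^ q + y ^ q) + (\<Sum>k\<in>{0<..<q}. f k)"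
    using q0 by (simp add: f_def)
  also have "acong (int q) \<dots> ((x ^ q + y ^ q) + (\<Sum>k\<in>{0<..<q}. 0))"
  proof (intro acong_add acong_refl acong_sum)
    fix k assume "k \<in> {0<..<q}"
    hence "q dvd q choose k" using q by (intro dvd_choose_prime) auto
    then obtain j where "q choose k = q * j" by blast
    hence "f k = of_int (int q) * (of_nat j * x ^ k * y ^ (q - k))" by (simp add: f_def mult_ac)
    thus "acong (int q) (f k) 0"
      by (metis acong_multiple algebraic_int_add_mult(2) algebraic_int_of_nat algebraic_int_power x y)
  qed
  finally show ?thesis by simp
qed

lemma acong_frobenius_sum:
  assumes q: "prime q" and "\<And>i. i \<in> S \<Longrightarrow> algebraic_int (f i)"
  shows "acong (int q) ((\<Sum>i\<in>S. f i) ^ q) (\<Sum>i\<in>S. f i ^ q)"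
  using assms(2)
proof (induction S rule: infinite_finite_induct)
  case (insert a S)
  have "acong (int q) ((f a + (\<Sum>i\<in>S. f i)) ^ q) (f a ^ q + (\<Sum>i\<in>S. f i) ^ q)"
    by (rule acong_frobenius[OF q]) (use insert in \<open>auto intro: algebraic_int_sum\<close>)
  also have "acong (int q) \<dots> (f a ^ q + (\<Sum>i\<in>S. f i ^ q))"
    by (intro acong_add acong_refl insert) (use insert in auto)
  finally show ?case using insert by simp
qed (use prime_gt_0_nat[OF q] in \<open>simp_all add: zero_power\<close>)

section \<open>Eisenstein integers and cube roots of unity modulo rational primes\<close>

abbreviation om :: "int \<Rightarrow> complex" where "om \<equiv> zeta 3"

lemma om_values: "om 1 = Complex (- 1 / 2) (sqrt 3 / 2)" "om 2 = Complex (- 1 / 2) (- sqrt 3 / 2)"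
proof -
  show "om 1 = Complex (- 1 / 2) (sqrt 3 / 2)"
    by (simp add: zeta_def complex_eq_iff cos_120 sin_120)
  have "om 2 = om 1 * om 1" by (simp flip: zeta_add)
  thus "om 2 = Complex (- 1 / 2) (- sqrt 3 / 2)"
    unfolding \<open>om 1 = _\<close> by (simp add: complex_eq_iff field_simps)
qed

lemma om_2: "om 2 = - 1 - om 1"
  by (simp add: om_values complex_eq_iff)

lemma om_1_square: "om 1 * om 1 = - 1 - om 1"
  using om_2 by (simp flip: zeta_add)

lemma om_eq_iff: "om k = om l \<longleftrightarrow> [k = l] (mod 3)"
  by (simp add: zeta_eq_iff cong_iff_dvd_diff)

lemma om_cases:
  obtains "om k = 1" | "om k = om 1" | "om k = om 2"
proof -
  have "[k = 0] (mod 3) \<or> [k = 1] (mod 3) \<or> [k = 2] (mod 3)"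
    unfolding cong_def by auto
  thus ?thesis using that zeta_0[of 3] unfolding om_eq_iff[symmetric] by metis
qed

definition eis :: "int \<Rightarrow> int \<Rightarrow> complex" where
  "eis a b = of_int a + of_int b * om 1"

lemma algebraic_int_eis [simp]: "algebraic_int (eis a b)"
  unfolding eis_def by (intro algebraic_int_add_mult) auto

lemma eis_mult: "eis a b * eis c d = eis (a * c - b * d) (a * d + b * c - b * d)"
proof -
  have "eis a b * eis c d = of_int (a * c) + of_int (a * d + b * c) * om 1 + of_int (b * d) * (om 1 * om 1)"
    by (simp add: eis_def algebra_simps)
  also have "\<dots> = eis (a * c - b * d) (a * d + b * c - b * d)"
    by (simp add: om_1_square eis_def algebra_simps)
  finally show ?thesis .
qed

lemma eis_add: "eis a b + eis c d = eis (a + c) (b + d)"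
  by (simp add: eis_def algebra_simps)

lemma eis_eq_iff: "eis a b = eis c d \<longleftrightarrow> a = c \<and> b = d"
proof
  assume "eis a b = eis c d"
  hence "Re (eis a b) = Re (eis c d)" "Im (eis a b) = Im (eis c d)" by simp_all
  thus "a = c \<and> b = d" by (auto simp: eis_def om_values)
qed auto

lemma cnj_eis: "cnj (eis a b) = eis (a - b) (- b)"
  by (simp add: eis_def om_values complex_eq_iff)

text \<open>The larger ring creates no new congruences between Eisenstein integers: if z = (u + v
  \<omega>) / q is an algebraic integer, then (z - cnj z)^2 = -3 v^2 / q^2 is a rational integer, so
  q divides v, and then u / q is a rational integer too.\<close>

lemma acong_eis_iff:
  assumes q: "prime (q::int)"
  shows "acong q (eis a b) (eis c d) \<longleftrightarrow> [a = c] (mod q) \<and> [b = d] (mod q)"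
proof
  assume "[a = c] (mod q) \<and> [b = d] (mod q)"
  thus "acong q (eis a b) (eis c d)"
    unfolding eis_def
    by (intro acong_add acong_of_int acong_mult) auto
next
  assume *: "acong q (eis a b) (eis c d)"
  have q0: "q > 0" using q by (simp add: prime_gt_0_int)
  define u v where "u = a - c" and "v = b - d"
  define z where "z = eis u v / of_int q"
  have z: "algebraic_int z"
    using * by (simp add: z_def acong_def u_def v_def eis_def algebra_simps)
  have "algebraic_int ((z - cnj z) * (z - cnj z))"
    using z by (intro algebraic_int_add_mult algebraic_int_diff) auto
  moreover have "(z - cnj z) * (z - cnj z) = of_int (- 3 * v\<^sup>2) / of_int (q\<^sup>2)"
    using q0 by (simp add: z_def eis_def om_values complex_eq_iff power2_eq_square field_simps Re_divide Im_divide)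
  ultimately have "(of_int (- 3 * v\<^sup>2) / of_int (q\<^sup>2) :: complex) \<in> \<int>"
    by (intro rational_algebraic_int_is_int) auto
  then obtain k where "(of_int (- 3 * v\<^sup>2) / of_int (q\<^sup>2) :: complex) = of_int k"
    by (rule Ints_cases)
  hence "(of_int (- 3 * v\<^sup>2) :: complex) = of_int (k * q\<^sup>2)"
    using q0 by (simp add: field_simps)
  hence k: "- 3 * v\<^sup>2 = k * q\<^sup>2" using of_int_eq_iff by blast
  have qv: "q dvd v"
  proof (rule ccontr)
    assume "\<not> q dvd v"
    hence "coprime (q\<^sup>2) (v\<^sup>2)" using q by (simp add: prime_imp_coprime)
    moreover have "q\<^sup>2 dvd (- 3) * v\<^sup>2" unfolding k by simp
    \<comment> \<open>This is impossible for every prime, including q = 3, because 3 has no square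
      divisor greater than 1.\<close>
    ultimately have "q\<^sup>2 dvd - 3" using coprime_dvd_mult_left_iff by blast
    hence "q\<^sup>2 dvd 3" by simp
    hence "q\<^sup>2 \<le> 3" by (intro zdvd_imp_le) auto
    moreover have "q\<^sup>2 \<ge> 2\<^sup>2" using prime_ge_2_int[OF q] by (intro power_mono) auto
    ultimately show False by simp
  qed
  then obtain j where j: "v = q * j" by blast
  have "algebraic_int (z - of_int j * om 1)"
    using z by (intro algebraic_int_diff algebraic_int_add_mult) auto
  moreover have "z - of_int j * om 1 = of_int u / of_int q"
    using q0 by (simp add: z_def eis_def j field_simps)
  ultimately have "algebraic_int (of_int u / of_int q :: complex)" by simp
  hence "(of_int u / of_int q :: complex) \<in> \<int>"
    by (intro rational_algebraic_int_is_int) auto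
  then obtain i where "(of_int u / of_int q :: complex) = of_int i" by (auto elim: Ints_cases)
  hence "(of_int u :: complex) = of_int (i * q)" using q0 by (simp add: field_simps)
  hence "u = i * q" using of_int_eq_iff by blast
  thus "[a = c] (mod q) \<and> [b = d] (mod q)"
    using qv by (simp add: cong_iff_dvd_diff u_def v_def)
qed

lemma om_eis: "om 0 = eis 1 0" "om 1 = eis 0 1" "om 2 = eis (- 1) (- 1)"
  by (simp_all add: eis_def om_2)

text \<open>Cube roots of unity stay distinct modulo every rational prime, even modulo 3, since they
  only merge modulo the prime above 3. This is what turns congruences between powers of \<omega>
  into statements about exponents modulo 3.\<close>

lemma acong_om_iff:
  assumes q: "prime (q::int)"
  shows "acong q (om k) (om l) \<longleftrightarrow> [k = l] (mod 3)"
proof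
  assume *: "acong q (om k) (om l)"
  have "\<bar>q\<bar> \<noteq> 1" using prime_ge_2_int[OF q] by simp
  have one: "1 = eis 1 0" by (simp add: eis_def)
  have "om k = om l"
    by (rule om_cases[of k]; rule om_cases[of l])
      (use * \<open>\<bar>q\<bar> \<noteq> 1\<close> in \<open>auto simp: om_eis(2,3) one acong_eis_iff[OF q] cong_iff_dvd_diff\<close>)
  thus "[k = l] (mod 3)" by (simp add: om_eq_iff)
next
  assume "[k = l] (mod 3)"
  hence "om k = om l" by (simp add: om_eq_iff)
  thus "acong q (om k) (om l)" by simp
qed

section \<open>Gauss sums of cubic characters\<close>

lemma fermat_int:
  assumes p: "prime (p::int)" and "\<not> p dvd a"
  shows "[a ^ nat (p - 1) = 1] (mod p)"
proof -
  have p0: "p > 0" using p by (simp add: prime_gt_0_int)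
  define b where "b = nat (a mod p)"
  have b: "int b = a mod p" using p0 by (simp add: b_def)
  have "prime (nat p)" using p prime_int_nat_transfer[of p] by blast
  moreover have "\<not> nat p dvd b"
  proof
    assume "nat p dvd b"
    hence "int (nat p) dvd int b" by (simp only: int_dvd_int_iff)
    hence "p dvd a mod p" using p0 b by simp
    thus False using assms(2) by (simp add: dvd_mod_iff)
  qed
  ultimately have "[b ^ (nat p - 1) = 1] (mod nat p)" by (rule fermat_theorem)
  hence "[int (b ^ (nat p - 1)) = int 1] (mod int (nat p))" by (simp only: cong_int_iff)
  hence *: "[(a mod p) ^ (nat p - 1) = 1] (mod p)" using p0 b by simp
  have "[a ^ (nat p - 1) = (a mod p) ^ (nat p - 1)] (mod p)"
    by (intro cong_pow) (simp add: cong_def)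
  moreover have "nat (p - 1) = nat p - 1" by linarith
  ultimately show ?thesis using * cong_trans by metis
qed

lemma sum_mod_reindex:
  fixes p :: int and F :: "int \<Rightarrow> 'b::comm_monoid_add"
  assumes p: "p > 0" and per: "\<And>s t. [s = t] (mod p) \<Longrightarrow> F s = F t"
    and inj: "\<And>s t. s \<in> {0..<p} \<Longrightarrow> t \<in> {0..<p} \<Longrightarrow> [h s = h t] (mod p) \<Longrightarrow> s = t"
  shows "(\<Sum>t\<in>{0..<p}. F (h t)) = (\<Sum>t\<in>{0..<p}. F t)"
proof -
  define g where "g t = h t mod p" for t
  have "inj_on g {0..<p}"
    by (rule inj_onI, rule inj) (auto simp: g_def cong_def)
  moreover have "g ` {0..<p} \<subseteq> {0..<p}" using p by (auto simp: g_def)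
  ultimately have "bij_betw g {0..<p} {0..<p}"
    by (simp add: bij_betw_def endo_inj_surj)
  hence "(\<Sum>t\<in>{0..<p}. F (g t)) = (\<Sum>t\<in>{0..<p}. F t)" by (rule sum.reindex_bij_betw)
  moreover have "F (g t) = F (h t)" for t
    by (rule per) (simp add: g_def)
  ultimately show ?thesis by simp
qed

lemma eq_if_cong_range: "s \<in> {0..<p} \<Longrightarrow> t \<in> {0..<p} \<Longrightarrow> [s = t] (mod p) \<Longrightarrow> s = (t::int)"
  by (simp add: cong_def)

lemma sum_mod_shift:
  fixes p :: int and F :: "int \<Rightarrow> 'b::comm_monoid_add"
  assumes "p > 0" "\<And>s t. [s = t] (mod p) \<Longrightarrow> F s = F t"
  shows "(\<Sum>t\<in>{0..<p}. F (t + c)) = (\<Sum>t\<in>{0..<p}. F t)"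
  by (rule sum_mod_reindex[OF assms]) (auto simp: cong_add_rcancel intro: eq_if_cong_range)

lemma sum_mod_scale:
  fixes p :: int and F :: "int \<Rightarrow> 'b::comm_monoid_add"
  assumes "p > 0" "\<And>s t. [s = t] (mod p) \<Longrightarrow> F s = F t" "coprime u p"
  shows "(\<Sum>t\<in>{0..<p}. F (u * t)) = (\<Sum>t\<in>{0..<p}. F t)"
  by (rule sum_mod_reindex[OF assms(1,2)])
    (use assms(3) in \<open>auto simp: cong_mult_lcancel intro: eq_if_cong_range\<close>)

lemma zeta_cong: "n > 0 \<Longrightarrow> [k = l] (mod n) \<Longrightarrow> zeta n k = zeta n l"
  by (simp add: zeta_eq_iff cong_iff_dvd_diff)

lemma sum_zeta:
  assumes "p > 0"
  shows "(\<Sum>t\<in>{0..<p}. zeta p (u * t)) = (if p dvd u then of_int p else 0)"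
proof (cases "p dvd u")
  case True
  hence "zeta p (u * t) = 1" for t using assms by (simp add: zeta_eq_1_iff)
  thus ?thesis using True assms by simp
next
  case False
  define S where "S = (\<Sum>t\<in>{0..<p}. zeta p (u * t))"
  have "(\<Sum>t\<in>{0..<p}. zeta p (u * (t + 1))) = S"
    unfolding S_def
    by (rule sum_mod_shift[OF assms]) (intro zeta_cong assms cong_scalar_left)
  moreover have "(\<Sum>t\<in>{0..<p}. zeta p (u * (t + 1))) = zeta p u * S"
    by (simp add: S_def sum_distrib_left distrib_left zeta_add mult_ac)
  ultimately have "(zeta p u - 1) * S = 0" by (simp add: algebra_simps)
  moreover have "zeta p u \<noteq> 1" using False assms by (simp add: zeta_eq_1_iff)
  ultimately show ?thesis using False by (simp add: S_def)
qed

text \<open>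
  Power sums over a full residue system vanish below degree \<open>p - 1\<close>. Working with the mixed
  sums of \<open>t\<^sup>i (t choose j)\<close> allows an induction that starts from the hockey-stick identity.
\<close>

lemma sum_power_choose_cong_0:
  assumes p: "prime (p::nat)" and "i + j + 1 < p"
  shows "[(\<Sum>t<p. t ^ i * (t choose j)) = 0] (mod p)"
  using assms(2)
proof (induction i arbitrary: j)
  case 0
  have "(\<Sum>t<p. t choose j) = p choose Suc j"
  proof -
    have "{..<p} = {..p - 1}" "Suc (p - 1) = p" using prime_gt_0_nat[OF p] by auto
    thus ?thesis using sum_choose_upper[of j "p - 1"] by simp
  qed
  moreover have "p dvd p choose Suc j"
    using 0 p by (intro dvd_choose_prime) auto
  ultimately show ?case by (simp add: cong_0_iff)
next
  case (Suc i)
  \<comment> \<open>One factor t is absorbed into the binomial coefficient. The exponent drops by 1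
    and the lower index rises by at most 1, so the bound by p is kept.\<close>
  have id: "t * (t choose j) = Suc j * (t choose Suc j) + j * (t choose j)" for t
  proof (cases "j \<le> t")
    case True
    have "Suc j * (t choose Suc j) + j * (t choose j) = (t - j) * (t choose j) + j * (t choose j)"
      by (simp only: binomial_absorption binomial_absorb_comp)
    also have "\<dots> = ((t - j) + j) * (t choose j)" by (simp only: distrib_right)
    finally show ?thesis using True by simp
  next
    case False
    thus ?thesis by (simp add: binomial_eq_0)
  qed
  have "(\<Sum>t<p. t ^ Suc i * (t choose j)) = (\<Sum>t<p. t ^ i * (t * (t choose j)))"
    by (simp add: mult_ac)
  also have "\<dots> = Suc j * (\<Sum>t<p. t ^ i * (t choose Suc j)) + j * (\<Sum>t<p. t ^ i * (t choose j))"
    unfolding id by (simp only: sum_distrib_left sum.distrib distrib_left mult_ac)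
  also have "[\<dots> = Suc j * 0 + j * 0] (mod p)"
    by (intro cong_add cong_scalar_left Suc.IH) (use Suc.prems in auto)
  finally show ?case by simp
qed

text \<open>Splitting off one factor 1 - t at a time leads back to pure power sums. With i = l = (p
  - 1) / 3 this puts the Jacobi sum into a prime above p; with l = 0 it shows that the cubic
  character is not trivial.\<close>

lemma sum_power_one_minus_cong_0:
  fixes p :: int
  assumes p: "prime p" and "int (i + l) + 1 < p"
  shows "[(\<Sum>t\<in>{0..<p}. t ^ i * (1 - t) ^ l) = 0] (mod p)"
  using assms(2)
proof (induction l arbitrary: i)
  case 0
  have p0: "p > 0" using p by (simp add: prime_gt_0_int)
  have pn: "prime (nat p)" using p prime_int_nat_transfer[of p] by blast
  have "[(\<Sum>t<nat p. t ^ i * (t choose 0)) = 0] (mod nat p)"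
    by (rule sum_power_choose_cong_0[OF pn]) (use 0 in linarith)
  hence "[int (\<Sum>t<nat p. t ^ i) = 0] (mod p)"
    using p0 cong_int_iff[of "\<Sum>t<nat p. t ^ i" 0 "nat p"] by simp
  moreover have "int (\<Sum>t<nat p. t ^ i) = (\<Sum>t\<in>{0..<p}. t ^ i)"
  proof -
    have "bij_betw int {..<nat p} {0..<p}"
      by (rule bij_betwI[of _ _ _ nat]) auto
    from sum.reindex_bij_betw[OF this, of "\<lambda>t. t ^ i"] show ?thesis by simp
  qed
  ultimately show ?case by simp
next
  case (Suc l)
  have "(\<Sum>t\<in>{0..<p}. t ^ i * (1 - t) ^ Suc l) =
      (\<Sum>t\<in>{0..<p}. t ^ i * (1 - t) ^ l) - (\<Sum>t\<in>{0..<p}. t ^ Suc i * (1 - t) ^ l)"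
    by (simp add: sum_subtractf[symmetric] algebra_simps)
  also have "[\<dots> = 0 - 0] (mod p)"
    by (intro cong_diff Suc.IH) (use Suc.prems in auto)
  finally show ?case by simp
qed

text \<open>The root \<open>w\<close> is the image of \<omega> under a homomorphism from the
  Eisenstein integers to the integers modulo \<open>p\<close>. Fixing \<open>w\<close> amounts to
  choosing one of the two primes above \<open>p\<close>, and its existence forces \<open>p\<close>
  to be 1 modulo 3.\<close>

locale cubic_character =
  fixes p w :: int
  assumes p: "prime p" and p3: "p \<noteq> 3" and w: "[w\<^sup>2 + w + 1 = 0] (mod p)"
begin

lemma p_pos: "p > 0" using p by (simp add: prime_gt_0_int)

lemma w_cube: "[w ^ 3 = 1] (mod p)"
proof -
  have "w ^ 3 - 1 = (w - 1) * (w\<^sup>2 + w + 1)" by (simp add: algebra_simps power2_eq_square power3_eq_cube)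
  also have "[\<dots> = (w - 1) * 0] (mod p)" by (intro cong_scalar_left w)
  finally show ?thesis by (simp add: cong_iff_dvd_diff)
qed

lemma w_not_1: "\<not> [w = 1] (mod p)"
proof
  assume "[w = 1] (mod p)"
  hence "[w\<^sup>2 + w + 1 = 1\<^sup>2 + 1 + 1] (mod p)" by (intro cong_add cong_pow) auto
  with w have "[3 = 0] (mod p)" by (auto simp: cong_def)
  hence "p dvd 3" by (simp add: cong_0_iff)
  moreover have "prime (3::int)" by simp
  ultimately show False using p p3 primes_dvd_imp_eq by blast
qed

lemma not_dvd_w: "\<not> p dvd w"
proof
  assume "p dvd w"
  hence "p dvd w ^ 3" by (rule dvd_trans) (simp add: dvd_power)
  with w_cube have "p dvd 1" by (meson cong_dvd_iff)
  thus False using p not_prime_unit by blast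
qed

lemma w_power_mod: "[w ^ (n mod 3) = w ^ n] (mod p)"
proof -
  have "[w ^ n = w ^ (3 * (n div 3) + n mod 3)] (mod p)" by simp
  also have "w ^ (3 * (n div 3) + n mod 3) = (w ^ 3) ^ (n div 3) * w ^ (n mod 3)"
    by (simp only: power_add power_mult)
  also have "[\<dots> = 1 ^ (n div 3) * w ^ (n mod 3)] (mod p)"
    by (intro cong_mult cong_pow w_cube) auto
  finally show ?thesis by (simp add: cong_sym)
qed

lemma p_mod_3: "p mod 3 = 1"
proof -
  have "p mod 3 \<noteq> 0"
  proof -
    have "\<not> 3 dvd p" using p p3 primes_dvd_imp_eq[of 3 p] by auto
    thus ?thesis by presburger
  qed
  moreover have "p mod 3 \<noteq> 2"
  proof
    assume "p mod 3 = 2"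
    hence "(p - 1) mod 3 = 1" by presburger
    hence "nat (p - 1) mod 3 = 1" using p_pos nat_mod_distrib[of "p - 1" 3] by simp
    hence "[w ^ 1 = w ^ nat (p - 1)] (mod p)" using w_power_mod[of "nat (p - 1)"] by simp
    also have "[w ^ nat (p - 1) = 1] (mod p)" by (rule fermat_int[OF p not_dvd_w])
    finally show False using w_not_1 by simp
  qed
  moreover have "p mod 3 \<in> {0, 1, 2}" by auto
  ultimately show ?thesis by auto
qed

definition k :: nat where "k = nat ((p - 1) div 3)"

lemma k: "int k * 3 = p - 1" "3 * k = nat (p - 1)" "k > 0"
proof -
  have "p > 1" using p by (simp add: prime_gt_1_int)
  hence k': "int k = (p - 1) div 3" by (simp add: k_def)
  show k3: "int k * 3 = p - 1" using p_mod_3 unfolding k' by presburger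
  thus "3 * k = nat (p - 1)" by linarith
  show "k > 0" using k3 \<open>p > 1\<close> by linarith
qed

lemma w_power_eq_iff: "[w ^ i = w ^ j] (mod p) \<longleftrightarrow> [i = j] (mod 3)"
proof
  assume "[i = j] (mod 3)"
  thus "[w ^ i = w ^ j] (mod p)"
    using w_power_mod[of i] w_power_mod[of j] unfolding cong_def by metis
next
  assume "[w ^ i = w ^ j] (mod p)"
  hence *: "[w ^ (i mod 3) = w ^ (j mod 3)] (mod p)"
    using w_power_mod[of i] w_power_mod[of j] cong_trans cong_sym by blast
  have cw: "coprime w p" using not_dvd_w p by (metis coprime_commute prime_imp_coprime)
  have 1: "\<not> [w = w\<^sup>2] (mod p)"
  proof
    assume "[w = w\<^sup>2] (mod p)"
    hence "[w * 1 = w * w] (mod p)" by (simp add: power2_eq_square)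
    hence "[1 = w] (mod p)" using cw cong_mult_lcancel by blast
    thus False using w_not_1 cong_sym by blast
  qed
  have 2: "\<not> [1 = w\<^sup>2] (mod p)"
  proof
    assume "[1 = w\<^sup>2] (mod p)"
    hence "[1 * w = w\<^sup>2 * w] (mod p)" by (intro cong_mult) auto
    hence "[w = w ^ 3] (mod p)" by (simp add: power2_eq_square power3_eq_cube)
    thus False using w_not_1 w_cube cong_trans by blast
  qed
  have "i mod 3 = 0 \<or> i mod 3 = 1 \<or> i mod 3 = 2" "j mod 3 = 0 \<or> j mod 3 = 1 \<or> j mod 3 = 2"
    by presburger+
  thus "[i = j] (mod 3)"
    using * 1 2 w_not_1 cong_sym[OF *] unfolding cong_def[of i] by (elim disjE) simp_all
qed

text \<open>A discrete logarithm: t^k is a cube root of unity modulo \<open>p\<close>, hence a power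
  of \<open>w\<close>. The exponent is determined only modulo 3, so everything about
  \<open>ell\<close> is stated as a congruence modulo 3.\<close>

definition ell :: "int \<Rightarrow> nat" where
  "ell t = (SOME j. [t ^ k = w ^ j] (mod p))"

lemma ell:
  assumes "\<not> p dvd t"
  shows "[t ^ k = w ^ ell t] (mod p)"
proof -
  define z where "z = t ^ k"
  have "[z ^ 3 = 1] (mod p)"
    using fermat_int[OF p assms] k(2) unfolding z_def
    by (metis mult.commute power_mult)
  hence 3: "p dvd z ^ 3 - 1" by (simp add: cong_iff_dvd_diff)
  have 1: "p dvd w\<^sup>2 + w + 1" using w by (simp add: cong_0_iff)
  have "(z - w ^ 0) * (z - w ^ 1) * (z - w ^ 2) =
      (z ^ 3 - 1) + (w\<^sup>2 + w + 1) * (- z\<^sup>2 + w * z + 1 - w)"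
    by (simp add: algebra_simps power2_eq_square power3_eq_cube)
  also have "p dvd \<dots>" using 3 1 by auto
  finally have "p dvd z - w ^ 0 \<or> p dvd z - w ^ 1 \<or> p dvd z - w ^ 2"
    using p by (simp add: prime_dvd_mult_iff)
  hence "\<exists>j. [z = w ^ j] (mod p)" unfolding cong_iff_dvd_diff by blast
  from someI_ex[OF this] show ?thesis unfolding ell_def z_def .
qed

lemma ell_eqI:
  assumes "\<not> p dvd t" "[t ^ k = w ^ j] (mod p)"
  shows "[int (ell t) = int j] (mod 3)"
proof -
  have "[w ^ ell t = w ^ j] (mod p)" using ell[OF assms(1)] assms(2) cong_trans cong_sym by blast
  hence "[ell t = j] (mod 3)" by (simp add: w_power_eq_iff)
  thus ?thesis using cong_int_iff[of "ell t" j 3] by simp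
qed

lemma ell_mult:
  assumes "\<not> p dvd s" "\<not> p dvd t"
  shows "[int (ell (s * t)) = int (ell s) + int (ell t)] (mod 3)"
proof -
  have "[(s * t) ^ k = w ^ (ell s + ell t)] (mod p)"
    unfolding power_mult_distrib power_add by (intro cong_mult ell assms)
  from ell_eqI[OF _ this] show ?thesis using assms p by (simp add: prime_dvd_mult_iff)
qed

lemma ell_cong:
  assumes "[s = t] (mod p)" "\<not> p dvd s"
  shows "[int (ell s) = int (ell t)] (mod 3)"
proof -
  have "\<not> p dvd t" using assms cong_dvd_iff by blast
  hence "[s ^ k = w ^ ell t] (mod p)" using cong_pow[OF assms(1)] ell cong_trans by blast
  from ell_eqI[OF assms(2) this] show ?thesis .
qed

definition chi :: "int \<Rightarrow> complex" where
  "chi t = (if p dvd t then 0 else om (int (ell t)))"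

lemma chi_mult: "chi (s * t) = chi s * chi t"
proof (cases "p dvd s \<or> p dvd t")
  case False
  hence "\<not> p dvd s * t" using p by (simp add: prime_dvd_mult_iff)
  moreover have "om (int (ell (s * t))) = om (int (ell s) + int (ell t))"
    using ell_mult False by (simp add: om_eq_iff)
  ultimately show ?thesis using False by (simp add: chi_def zeta_add)
qed (auto simp: chi_def)

lemma chi_cong: "[s = t] (mod p) \<Longrightarrow> chi s = chi t"
  using ell_cong[of s t] cong_dvd_iff[of s t p] by (auto simp: chi_def om_eq_iff)

lemma chi_cube: "\<not> p dvd t \<Longrightarrow> chi t ^ 3 = 1"
  by (simp add: chi_def zeta_power zeta_eq_1_iff)

lemma cnj_chi: "cnj (chi t) = chi t ^ 2"
  by (auto simp: chi_def cnj_zeta zeta_power om_eq_iff cong_iff_dvd_diff)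

lemma algebraic_int_chi [simp]: "algebraic_int (chi t)"
  by (auto simp: chi_def)

lemma chi_1: "chi 1 = 1" and chi_minus_1: "chi (- 1) = 1"
proof -
  have n: "\<not> p dvd 1" "\<not> p dvd - 1" using p by (auto dest: prime_gt_1_int)
  have "chi 1 * chi 1 = chi 1" using chi_mult[of 1 1] by simp
  moreover have "chi 1 \<noteq> 0" using n by (simp add: chi_def)
  ultimately show 1: "chi 1 = 1" by simp
  have "chi (- 1) ^ 2 = 1" using chi_mult[of "- 1" "- 1"] 1 by (simp add: power2_eq_square)
  moreover have "chi (- 1) ^ 3 = chi (- 1) ^ 2 * chi (- 1)" by (simp add: power2_eq_square power3_eq_cube)
  ultimately show "chi (- 1) = 1" using chi_cube[OF n(2)] by simp
qed

text \<open>Otherwise t^k = 1 modulo p for every t prime to p, and the sum of the t^k over a residue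
  system would be p - 1. But that sum vanishes modulo p because 0 < k < p - 1. This takes the place
  of a primitive root.\<close>

lemma chi_nontrivial: "\<exists>u. \<not> p dvd u \<and> chi u \<noteq> 1"
proof (rule ccontr)
  assume "\<not> ?thesis"
  hence triv: "chi u = 1" if "\<not> p dvd u" for u using that by blast
  have one: "[t ^ k = 1] (mod p)" if "\<not> p dvd t" for t
  proof -
    have "om (int (ell t)) = om 0" using triv[OF that] that by (simp add: chi_def)
    hence "[int (ell t) = int 0] (mod 3)" unfolding om_eq_iff by simp
    hence "[ell t = 0] (mod 3)" by (metis cong_int_iff of_nat_numeral)
    hence "[w ^ ell t = w ^ 0] (mod p)" by (simp only: w_power_eq_iff)
    thus ?thesis using ell[OF that] cong_trans by fastforce
  qed
  have "[(\<Sum>t\<in>{0..<p}. t ^ k * (1 - t) ^ 0) = 0] (mod p)"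
    by (rule sum_power_one_minus_cong_0[OF p]) (use k in auto)
  moreover have "{0..<p} = insert 0 {1..<p}" using p_pos by auto
  ultimately have "[(\<Sum>t\<in>{1..<p}. t ^ k) = 0] (mod p)" using k(3) by (simp add: zero_power)
  moreover have "[(\<Sum>t\<in>{1..<p}. t ^ k) = (\<Sum>t\<in>{1..<p}. 1)] (mod p)"
    by (intro cong_sum one) (auto dest: zdvd_imp_le)
  moreover have "(\<Sum>t\<in>{1..<p}. 1) = p - 1" using p_pos by simp
  ultimately have "[p - 1 = 0] (mod p)" using cong_trans cong_sym by metis
  hence "p dvd p - (p - 1)" by (simp only: cong_0_iff dvd_diff dvd_refl)
  hence "p dvd 1" by simp
  thus False using p not_prime_unit by blast
qed

lemma coprime_p: "\<not> p dvd u \<Longrightarrow> coprime u p"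
  using p by (metis coprime_commute prime_imp_coprime)

lemma sum_chi: "(\<Sum>t\<in>{0..<p}. chi t) = 0"
proof -
  obtain u where u: "\<not> p dvd u" "chi u \<noteq> 1" using chi_nontrivial by blast
  have "(\<Sum>t\<in>{0..<p}. chi (u * t)) = (\<Sum>t\<in>{0..<p}. chi t)"
    by (rule sum_mod_scale[OF p_pos chi_cong coprime_p[OF u(1)]])
  hence "chi u * (\<Sum>t\<in>{0..<p}. chi t) = (\<Sum>t\<in>{0..<p}. chi t)"
    by (simp add: chi_mult flip: sum_distrib_left)
  hence "(chi u - 1) * (\<Sum>t\<in>{0..<p}. chi t) = 0"
    by (simp only: left_diff_distrib mult_1_left diff_self)
  thus ?thesis using u by simp
qed

section \<open>Gauss and Jacobi sums\<close>

definition gauss :: complex where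
  "gauss = (\<Sum>t\<in>{0..<p}. chi t * zeta p t)"

definition jacobi :: complex where
  "jacobi = (\<Sum>t\<in>{0..<p}. chi t * chi (1 - t))"

lemma chi_0 [simp]: "chi 0 = 0" by (simp add: chi_def)

text \<open>Substituting s = t v turns the double sum into a sum over v with weight
  \<open>chi v\<close>. The inner sum of zeta p (t (v - 1)) over nonzero t is p - 1 for v = 1 and -1
  otherwise, and the contributions of -1 cancel since the values of \<open>chi\<close> sum to
  0.\<close>

lemma gauss_cnj: "gauss * cnj gauss = of_int p"
proof -
  have term_eq: "(\<Sum>s\<in>{0..<p}. chi s * zeta p s) * cnj (chi t * zeta p t)
      = (\<Sum>v\<in>{0..<p}. chi v * (zeta p (t * (v - 1)) * (if p dvd t then 0 else 1)))" for t
  proof (cases "p dvd t")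
    case False
    have "(\<Sum>s\<in>{0..<p}. chi s * zeta p s) = (\<Sum>v\<in>{0..<p}. chi (t * v) * zeta p (t * v))"
      by (rule sum_mod_scale[symmetric, OF p_pos _ coprime_p[OF False]])
        (simp add: chi_cong zeta_cong[OF p_pos])
    hence "(\<Sum>s\<in>{0..<p}. chi s * zeta p s) * cnj (chi t * zeta p t)
        = (\<Sum>v\<in>{0..<p}. chi (t * v) * zeta p (t * v) * (chi t ^ 2 * zeta p (- t)))"
      by (simp add: cnj_chi cnj_zeta sum_distrib_right)
    also have "\<dots> = (\<Sum>v\<in>{0..<p}. chi t ^ 3 * chi v * zeta p (t * (v - 1)))"
      by (intro sum.cong refl)
        (simp add: chi_mult power2_eq_square power3_eq_cube right_diff_distrib zeta_add[of p "t * _" "- t", simplified])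
    finally show ?thesis using False by (simp add: chi_cube)
  qed (simp add: chi_def)
  have inner: "(\<Sum>t\<in>{0..<p}. zeta p (t * (v - 1)) * (if p dvd t then 0 else 1)) =
      (if v = 1 then of_int p else 0) - 1" if vp: "v \<in> {0..<p}" for v
  proof -
    have eq: "{0..<p} = insert 0 {1..<p}" using p_pos by auto
    have "(\<Sum>t\<in>{0..<p}. zeta p (t * (v - 1)) * (if p dvd t then 0 else 1)) =
        (\<Sum>t\<in>{1..<p}. zeta p (t * (v - 1)) * (if p dvd t then 0 else 1))"
      unfolding eq by simp
    also have "\<dots> = (\<Sum>t\<in>{1..<p}. zeta p ((v - 1) * t))"
      by (intro sum.cong) (auto simp: mult_ac dest: zdvd_imp_le)
    also have "\<dots> = (\<Sum>t\<in>{0..<p}. zeta p ((v - 1) * t)) - 1"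
      unfolding eq by simp
    also have "p dvd v - 1 \<longleftrightarrow> v = 1"
      using vp prime_gt_1_int[OF p] eq_if_cong_range[of v p 1] by (auto simp: cong_iff_dvd_diff)
    hence "(\<Sum>t\<in>{0..<p}. zeta p ((v - 1) * t)) = (if v = 1 then of_int p else 0)"
      by (simp add: sum_zeta[OF p_pos])
    finally show ?thesis .
  qed
  have "gauss * cnj gauss = (\<Sum>t\<in>{0..<p}. (\<Sum>s\<in>{0..<p}. chi s * zeta p s) * cnj (chi t * zeta p t))"
    unfolding gauss_def by (simp add: sum_distrib_left)
  also have "\<dots> = (\<Sum>t\<in>{0..<p}. \<Sum>v\<in>{0..<p}. chi v * (zeta p (t * (v - 1)) * (if p dvd t then 0 else 1)))"
    by (simp only: term_eq)
  also have "\<dots> = (\<Sum>v\<in>{0..<p}. \<Sum>t\<in>{0..<p}. chi v * (zeta p (t * (v - 1)) * (if p dvd t then 0 else 1)))"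
    by (rule sum.swap)
  also have "\<dots> = (\<Sum>v\<in>{0..<p}. chi v * ((if v = 1 then of_int p else 0) - 1))"
    by (simp only: sum_distrib_left[symmetric] inner cong: sum.cong)
  also have "\<dots> = (\<Sum>v\<in>{0..<p}. if v = 1 then chi 1 * of_int p else 0) - (\<Sum>v\<in>{0..<p}. chi v)"
    by (subst sum_subtractf[symmetric], intro sum.cong) (auto simp: algebra_simps)
  also have "\<dots> = of_int p"
    using prime_gt_1_int[OF p] by (simp add: sum_chi chi_1)
  finally show ?thesis .
qed

text \<open>The convolution of \<open>chi\<close> with itself at u is chi(u)^2 times the Jacobi sum,
  as s = u v shows. At u = 0 both sides vanish: the convolution becomes the sum of the conjugate
  character because chi(-1) = 1. As chi^2 is the conjugate character, the remaining sum is the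
  conjugate Gauss sum.\<close>

lemma gauss_square: "gauss ^ 2 = jacobi * cnj gauss"
proof -
  have chi_minus: "chi (- t) = chi t" for t using chi_mult[of "- 1" t] by (simp add: chi_minus_1)
  have conv: "(\<Sum>s\<in>{0..<p}. chi s * chi (u - s)) = chi u ^ 2 * jacobi" for u
  proof (cases "p dvd u")
    case True
    have "(\<Sum>s\<in>{0..<p}. chi s * chi (u - s)) = (\<Sum>s\<in>{0..<p}. cnj (chi s))"
    proof (intro sum.cong refl)
      fix s
      have "chi (u - s) = chi (- s)" by (rule chi_cong) (use True in \<open>simp add: cong_iff_dvd_diff\<close>)
      thus "chi s * chi (u - s) = cnj (chi s)" by (simp add: cnj_chi chi_minus power2_eq_square)
    qed
    also have "\<dots> = cnj (\<Sum>s\<in>{0..<p}. chi s)" by simp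
    also have "\<dots> = 0" by (simp only: sum_chi complex_cnj_zero)
    finally show ?thesis using True by (simp add: chi_def[of u])
  next
    case False
    have "(\<Sum>s\<in>{0..<p}. chi s * chi (u - s)) = (\<Sum>v\<in>{0..<p}. chi (u * v) * chi (u - u * v))"
      by (rule sum_mod_scale[symmetric, OF p_pos _ coprime_p[OF False]])
        (metis chi_cong cong_diff cong_refl)
    also have "\<dots> = chi u ^ 2 * jacobi"
      unfolding jacobi_def sum_distrib_left
    proof (intro sum.cong refl)
      fix v
      have "u - u * v = u * (1 - v)" by (simp add: algebra_simps)
      thus "chi (u * v) * chi (u - u * v) = (chi u)\<^sup>2 * (chi v * chi (1 - v))"
        by (simp only: chi_mult power2_eq_square mult_ac)
    qed
    finally show ?thesis .
  qed
  have "gauss ^ 2 = (\<Sum>s\<in>{0..<p}. \<Sum>t\<in>{0..<p}. chi s * chi t * zeta p (s + t))"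
    unfolding gauss_def power2_eq_square
    by (simp add: sum_product zeta_add mult_ac)
  also have "\<dots> = (\<Sum>s\<in>{0..<p}. \<Sum>u\<in>{0..<p}. chi s * chi (u - s) * zeta p u)"
  proof (rule sum.cong[OF refl])
    fix s
    have "(\<Sum>u\<in>{0..<p}. chi s * chi (u + s - s) * zeta p (u + s)) = (\<Sum>u\<in>{0..<p}. chi s * chi (u - s) * zeta p u)"
      by (rule sum_mod_shift[OF p_pos]) (metis chi_cong cong_diff cong_refl zeta_cong[OF p_pos])
    thus "(\<Sum>t\<in>{0..<p}. chi s * chi t * zeta p (s + t)) = (\<Sum>u\<in>{0..<p}. chi s * chi (u - s) * zeta p u)"
      by (simp add: add.commute)
  qed
  also have "\<dots> = (\<Sum>u\<in>{0..<p}. \<Sum>s\<in>{0..<p}. chi s * chi (u - s) * zeta p u)"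
    by (rule sum.swap)
  also have "\<dots> = (\<Sum>u\<in>{0..<p}. jacobi * (chi u ^ 2 * zeta p u))"
    by (simp only: sum_distrib_right[symmetric] conv) (simp only: mult_ac)
  also have "\<dots> = jacobi * (\<Sum>u\<in>{0..<p}. chi u ^ 2 * zeta p u)"
    by (simp add: sum_distrib_left)
  also have "(\<Sum>u\<in>{0..<p}. chi u ^ 2 * zeta p u) = (\<Sum>u\<in>{0..<p}. chi ((- 1) * u) ^ 2 * zeta p ((- 1) * u))"
    by (rule sum_mod_scale[symmetric, OF p_pos]) (metis chi_cong zeta_cong[OF p_pos], simp)
  also have "\<dots> = cnj gauss"
    by (simp add: gauss_def cnj_chi cnj_zeta chi_minus)
  finally show ?thesis .
qed

lemma gauss_cube: "gauss ^ 3 = of_int p * jacobi"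
  using gauss_cnj gauss_square by (simp add: power2_eq_square power3_eq_cube mult_ac)

lemma jacobi_norm: "jacobi * cnj jacobi = of_int p"
proof -
  have "(gauss * cnj gauss) * (gauss * cnj gauss) = (gauss ^ 2) * cnj (gauss ^ 2)"
    by (simp add: power2_eq_square mult_ac)
  also have "\<dots> = (jacobi * cnj jacobi) * (gauss * cnj gauss)"
    by (simp add: gauss_square mult_ac)
  finally show ?thesis using p_pos by (simp add: gauss_cnj)
qed

text \<open>Under \<omega> -> w the value chi(t) becomes t^k modulo \<open>p\<close>, so the Jacobi
  sum becomes the sum of t^k (1 - t)^k, which vanishes since 2 k < p - 1. Hence the Jacobi sum lies
  in the prime above \<open>p\<close> singled out by \<open>w\<close>.\<close>

lemma jacobi_eis:
  obtains a b where "jacobi = eis a b" "[a + b * w = 0] (mod p)"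
proof -
  \<comment> \<open>\<open>P z r\<close> expresses that \<open>z\<close> is an Eisenstein integer
    whose image under \<omega> -> w is \<open>r\<close> modulo \<open>p\<close>.\<close>
  define P where "P z r \<longleftrightarrow> (\<exists>a b. z = eis a b \<and> [a + b * w = r] (mod p))" for z r
  have P_add: "P (y + z) (r + s)" if yz: "P y r" "P z s" for y z r s
  proof -
    obtain a b c d where *: "y = eis a b" "[a + b * w = r] (mod p)" "z = eis c d" "[c + d * w = s] (mod p)"
      using yz unfolding P_def by blast
    have "[(a + b * w) + (c + d * w) = r + s] (mod p)" by (intro cong_add *)
    hence "[(a + c) + (b + d) * w = r + s] (mod p)" by (simp add: algebra_simps)
    thus ?thesis unfolding P_def using * eis_add by metis
  qed
  have P_mult: "P (y * z) (r * s)" if yz: "P y r" "P z s" for y z r s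
  proof -
    obtain a b c d where *: "y = eis a b" "[a + b * w = r] (mod p)" "z = eis c d" "[c + d * w = s] (mod p)"
      using yz unfolding P_def by blast
    have "(a * c - b * d) + (a * d + b * c - b * d) * w =
        (a + b * w) * (c + d * w) - b * d * (w\<^sup>2 + w + 1)"
      by (simp add: algebra_simps power2_eq_square)
    also have "[\<dots> = r * s - b * d * 0] (mod p)"
      by (intro cong_mult cong_diff * w) auto
    finally show ?thesis unfolding P_def using * eis_mult by (metis diff_zero mult_zero_right)
  qed
  have P0: "P 0 0" unfolding P_def by (intro exI[of _ 0]) (simp add: eis_def)
  have P1: "P 1 1" unfolding P_def by (rule exI[of _ 1], rule exI[of _ 0]) (simp add: eis_def)
  have Pom: "P (om 1) w" unfolding P_def by (rule exI[of _ 0], rule exI[of _ 1]) (simp add: eis_def)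
  have Ppow: "P (om (int j)) (w ^ j)" for j
  proof (induction j)
    case (Suc j)
    have "om (int (Suc j)) = om 1 * om (int j)" by (simp flip: zeta_add)
    thus ?case using P_mult[OF Pom Suc] by simp
  qed (use P1 in simp)
  have P_cong: "P z s" if "P z r" "[r = s] (mod p)" for z r s
    using that unfolding P_def using cong_trans by blast
  have Pchi: "P (chi t) (t ^ k)" for t
  proof (cases "p dvd t")
    case True
    hence "p dvd t ^ k" using k(3) by (meson dvd_power dvd_trans)
    hence "[0 = t ^ k] (mod p)" using cong_0_iff cong_sym by blast
    thus ?thesis using True P_cong[OF P0] by (simp add: chi_def)
  next
    case False
    thus ?thesis using P_cong[OF Ppow cong_sym[OF ell]] by (simp add: chi_def)
  qed
  have Psum: "P (\<Sum>t\<in>S. f t) (\<Sum>t\<in>S. g t)" if "\<And>t. P (f t) (g t)" for f g and S :: "int set"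
    by (induction S rule: infinite_finite_induct) (auto intro: P0 P_add that)
  have "P jacobi (\<Sum>t\<in>{0..<p}. t ^ k * (1 - t) ^ k)"
    unfolding jacobi_def by (intro Psum P_mult Pchi)
  moreover have "[(\<Sum>t\<in>{0..<p}. t ^ k * (1 - t) ^ k) = 0] (mod p)"
    by (rule sum_power_one_minus_cong_0[OF p]) (use k in auto)
  ultimately have "P jacobi 0" by (rule P_cong)
  thus ?thesis using that unfolding P_def by blast
qed

lemma algebraic_int_gauss: "algebraic_int gauss" and algebraic_int_jacobi: "algebraic_int jacobi"
  unfolding gauss_def jacobi_def
  by (auto intro!: algebraic_int_sum algebraic_int_add_mult simp: p_pos)

text \<open>Cubing termwise modulo 3 makes the character trivial, so gauss^3 is congruent to the sum
  of zeta p (3 t) over nonzero t, which is -1. Since gauss^3 = p J and p is 1 modulo 3, the Jacobi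
  sum is primary, with sign -1.\<close>

lemma jacobi_cong_3: "acong 3 jacobi (- 1)"
proof -
  have "acong (int 3) (gauss ^ 3) (\<Sum>t\<in>{0..<p}. (chi t * zeta p t) ^ 3)"
    unfolding gauss_def
    by (rule acong_frobenius_sum) (auto intro!: algebraic_int_add_mult simp: p_pos)
  also have "(\<Sum>t\<in>{0..<p}. (chi t * zeta p t) ^ 3) = (\<Sum>t\<in>{1..<p}. zeta p (3 * t))"
  proof -
    have "{0..<p} = insert 0 {1..<p}" using p_pos by auto
    hence "(\<Sum>t\<in>{0..<p}. (chi t * zeta p t) ^ 3) = (\<Sum>t\<in>{1..<p}. (chi t * zeta p t) ^ 3)"
      by simp
    also have "\<dots> = (\<Sum>t\<in>{1..<p}. zeta p (3 * t))"
    proof (rule sum.cong[OF refl])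
      fix t assume "t \<in> {1..<p}"
      hence "\<not> p dvd t" by (auto dest: zdvd_imp_le)
      thus "(chi t * zeta p t) ^ 3 = zeta p (3 * t)"
        by (simp add: power_mult_distrib chi_cube zeta_power)
    qed
    finally show ?thesis .
  qed
  also have "\<dots> = - 1"
  proof -
    have eq: "{0..<p} = insert 0 {1..<p}" using p_pos by auto
    have "\<not> p dvd 3" using p p3 primes_dvd_imp_eq[of p 3] by auto
    hence "(\<Sum>t\<in>{0..<p}. zeta p (3 * t)) = 0" by (simp add: sum_zeta[OF p_pos])
    thus ?thesis unfolding eq by (simp add: add_eq_0_iff)
  qed
  finally have 1: "acong 3 (of_int p * jacobi) (- 1)" by (simp add: gauss_cube)
  have "[1 = p] (mod 3)" using p_mod_3 by (simp add: cong_def)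
  from acong_scale[OF acong_of_int[OF this] algebraic_int_jacobi]
  have "acong 3 jacobi (of_int p * jacobi)" by (simp add: mult_ac)
  from acong_trans[OF this 1] show ?thesis .
qed

text \<open>Frobenius is applied twice because q^2 is 1 modulo 3 whatever q is, so that chi^(q^2) =
  chi. Then gauss^(q^2) is congruent to chi(q^2)^(-1) gauss = chi(q) gauss, and it also equals (p
  J)^((q^2 - 1) / 3) gauss.\<close>

lemma jacobi_reciprocity:
  assumes q: "prime q" "q \<noteq> 3" "int q \<noteq> p"
  shows "acong (int q) ((of_int p * jacobi) ^ ((q\<^sup>2 - 1) div 3)) (chi (int q))"
proof -
  define e where "e = (q\<^sup>2 - 1) div 3"
  have "\<not> 3 dvd q" using q primes_dvd_imp_eq[of 3 q] by auto
  hence q3: "q mod 3 \<noteq> 0" by presburger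
  have "q\<^sup>2 mod 3 = 1"
  proof -
    have "q mod 3 = 1 \<or> q mod 3 = 2" using q3 by presburger
    moreover have "q\<^sup>2 mod 3 = (q mod 3)\<^sup>2 mod 3" by (simp add: power_mod)
    ultimately show ?thesis by auto
  qed
  hence e: "q\<^sup>2 = 3 * e + 1" unfolding e_def by (metis add.commute add_diff_cancel_left' mod_mult_div_eq nonzero_mult_div_cancel_left zero_neq_numeral)
  have pq: "\<not> p dvd int q"
    using p q primes_dvd_imp_eq[of p "int q"] by auto
  have cop: "coprime p (int q)"
    using pq p by (simp add: prime_imp_coprime)
  have fq: "acong (int q) ((\<Sum>t\<in>{0..<p}. f t) ^ q) (\<Sum>t\<in>{0..<p}. f t ^ q)"
    if "\<And>t. algebraic_int (f t)" for f :: "int \<Rightarrow> complex"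
    by (rule acong_frobenius_sum[OF q(1)]) (rule that)
  have alg: "algebraic_int (chi t * zeta p t)" for t
    by (intro algebraic_int_add_mult) (auto simp: p_pos)
  have "acong (int q) (gauss ^ q) (\<Sum>t\<in>{0..<p}. (chi t * zeta p t) ^ q)"
    unfolding gauss_def by (rule fq[OF alg])
  hence "acong (int q) ((gauss ^ q) ^ q) ((\<Sum>t\<in>{0..<p}. (chi t * zeta p t) ^ q) ^ q)"
    by (rule acong_power) (intro algebraic_int_power algebraic_int_sum algebraic_int_gauss alg)+
  also have "acong (int q) \<dots> (\<Sum>t\<in>{0..<p}. ((chi t * zeta p t) ^ q) ^ q)"
    by (rule fq) (intro algebraic_int_power alg)
  \<comment> \<open>The factor chi(q^2)^2 is the inverse of chi(q^2); inserting it makes the summand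
    that of the Gauss sum at q^2 t.\<close>
  also have "\<dots> = (\<Sum>t\<in>{0..<p}. chi (int q ^ 2) ^ 2 * (chi (int q ^ 2 * t) * zeta p (int q ^ 2 * t)))"
  proof (intro sum.cong refl)
    fix t
    have "chi t ^ (q\<^sup>2) = chi t"
      unfolding e by (cases "p dvd t") (simp_all add: power_mult chi_cube, simp add: chi_def)
    moreover have "\<not> p dvd int q ^ 2" using pq p prime_dvd_power by blast
    hence "chi (int q ^ 2) ^ 2 * chi (int q ^ 2) = 1"
      using chi_cube[of "int q ^ 2"] by (simp add: power2_eq_square power3_eq_cube)
    moreover have "((chi t * zeta p t) ^ q) ^ q = chi t ^ (q\<^sup>2) * zeta p t ^ (q\<^sup>2)"
      unfolding power2_eq_square power_mult by (simp only: power_mult_distrib)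
    moreover have "zeta p t ^ (q\<^sup>2) = zeta p (int q ^ 2 * t)" by (simp only: zeta_power of_nat_power)
    ultimately show "((chi t * zeta p t) ^ q) ^ q = chi (int q ^ 2) ^ 2 * (chi (int q ^ 2 * t) * zeta p (int q ^ 2 * t))"
      by (simp only: chi_mult[of "int q ^ 2" t] mult.assoc[symmetric] mult_1_left)
  qed
  also have "\<dots> = chi (int q ^ 2) ^ 2 * (\<Sum>t\<in>{0..<p}. chi (int q ^ 2 * t) * zeta p (int q ^ 2 * t))"
    by (simp add: sum_distrib_left)
  also have "(\<Sum>t\<in>{0..<p}. chi (int q ^ 2 * t) * zeta p (int q ^ 2 * t)) = gauss"
    unfolding gauss_def
    by (rule sum_mod_scale[OF p_pos])
      (metis chi_cong zeta_cong[OF p_pos], use cop in \<open>simp add: coprime_commute\<close>)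
  also have "chi (int q ^ 2) ^ 2 = chi (int q)"
  proof -
    have "chi (int q ^ 2) ^ 2 = chi (int q) ^ 3 * chi (int q)"
      by (simp add: power2_eq_square power3_eq_cube chi_mult)
    thus ?thesis using pq by (simp add: chi_cube)
  qed
  also have "(gauss ^ q) ^ q = (gauss ^ 3) ^ e * gauss"
  proof -
    have "(gauss ^ q) ^ q = gauss ^ (q\<^sup>2)" by (simp only: power2_eq_square power_mult)
    also have "\<dots> = (gauss ^ 3) ^ e * gauss" by (simp only: e power_add power_mult power_one_right)
    finally show ?thesis .
  qed
  \<comment> \<open>The Gauss sum is cancelled modulo \<open>q\<close> by multiplying with its
    conjugate, which leaves the integer \<open>p\<close>, a unit modulo \<open>q\<close>.\<close>
  finally have "acong (int q) (cnj gauss * ((gauss ^ 3) ^ e * gauss)) (cnj gauss * (chi (int q) * gauss))"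
    by (rule acong_scale) (use algebraic_int_gauss in auto)
  moreover have "cnj gauss * (x * gauss) = of_int p * x" for x
    using gauss_cnj by (simp add: mult_ac)
  ultimately have "acong (int q) (of_int p * (gauss ^ 3) ^ e) (of_int p * chi (int q))" by simp
  hence "acong (int q) ((gauss ^ 3) ^ e) (chi (int q))"
    by (rule acong_cancel_int[OF _ cop]) (auto intro!: algebraic_int_power algebraic_int_gauss)
  thus ?thesis by (simp add: gauss_cube e_def)
qed

end

section \<open>Cubic reciprocity\<close>

text \<open>
  The number \<open>L r\<close> is the exponent of the cubic residue symbol of \<open>r\<close> modulo \<open>\<delta> = eis a b\<close>; it only
  matters modulo 3 and for \<open>r\<close> coprime to the norm \<open>N\<close> of \<open>\<delta>\<close>. The exponent \<open>i\<close> measures by how much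
  \<open>\<delta>\<close> fails to be primary. In the last clause, the power of \<open>N \<delta>\<close> represents the product of the symbols
  of \<open>\<delta>\<close> modulo the primes above \<open>q\<close>, no matter whether \<open>q\<close> is inert or splits.
\<close>

definition cubic_symbol :: "int \<Rightarrow> int \<Rightarrow> (int \<Rightarrow> int) \<Rightarrow> int \<Rightarrow> int \<Rightarrow> bool" where
  "cubic_symbol a b L i \<epsilon> \<longleftrightarrow>
     (let N = a\<^sup>2 - a * b + b\<^sup>2 in
     (\<epsilon> = 1 \<or> \<epsilon> = - 1) \<and> acong 3 (eis a b) (of_int \<epsilon> * om i) \<and>
     (\<forall>r s. coprime r N \<longrightarrow> coprime s N \<longrightarrow> [L (r * s) = L r + L s] (mod 3)) \<and>
     (\<forall>r s. coprime r N \<longrightarrow> [r = s] (mod N) \<longrightarrow> [L r = L s] (mod 3)) \<and>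
     (\<forall>w. N dvd a + b * w \<longrightarrow> [L w = (N - 1) div 3] (mod 3)) \<and>
     (\<forall>q. prime q \<longrightarrow> q \<noteq> 3 \<longrightarrow> \<not> int q dvd N \<longrightarrow>
        acong (int q) ((of_int N * eis a b) ^ ((q\<^sup>2 - 1) div 3))
          (om (L (int q) + i * int ((q\<^sup>2 - 1) div 3)))))"

section \<open>Exponents (q^2 - 1) / 3, the norm form modulo 3, and units\<close>

lemma prime_square_mod_3:
  assumes "prime (q::nat)" "q \<noteq> 3"
  shows "q\<^sup>2 = 3 * ((q\<^sup>2 - 1) div 3) + 1"
proof -
  have "\<not> 3 dvd q" using assms primes_dvd_imp_eq[of 3 q] by auto
  hence "q mod 3 = 1 \<or> q mod 3 = 2" by presburger
  moreover have "q\<^sup>2 mod 3 = (q mod 3)\<^sup>2 mod 3" by (simp add: power_mod)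
  ultimately have "q\<^sup>2 mod 3 = 1" by auto
  thus ?thesis by (metis add.commute add_diff_cancel_left' mod_mult_div_eq nonzero_mult_div_cancel_left zero_neq_numeral)
qed

lemma odd_prime_square_even:
  assumes "prime (q::nat)" "q \<noteq> 3" "q \<noteq> 2"
  shows "even ((q\<^sup>2 - 1) div 3)"
proof -
  have "odd q" using assms primes_dvd_imp_eq[of 2 q] by auto
  hence "odd (q\<^sup>2)" by simp
  thus ?thesis using prime_square_mod_3[OF assms(1,2)] by presburger
qed

lemma fermat_square:
  assumes q: "prime (q::nat)" and "\<not> int q dvd a"
  shows "[a ^ (q\<^sup>2 - 1) = 1] (mod int q)"
proof -
  have "prime (int q)" using q by simp
  from fermat_int[OF this assms(2)] have 1: "[a ^ (q - 1) = 1] (mod int q)"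
    by (simp add: nat_diff_distrib')
  have "q\<^sup>2 - 1 = (q - 1) * (q + 1)" by (simp add: power2_eq_square algebra_simps)
  hence "a ^ (q\<^sup>2 - 1) = (a ^ (q - 1)) ^ (q + 1)" by (simp only: power_mult)
  also have "[\<dots> = 1 ^ (q + 1)] (mod int q)" by (intro cong_pow 1)
  finally show ?thesis by simp
qed

lemma norm_form_mod_3: "(a\<^sup>2 - a * b + b\<^sup>2) mod 3 = ((a + b)\<^sup>2) mod (3::int)"
proof -
  have "(a + b)\<^sup>2 = (a\<^sup>2 - a * b + b\<^sup>2) + 3 * (a * b)"
    by (simp add: power2_eq_square algebra_simps)
  hence "(a + b)\<^sup>2 mod 3 = ((a\<^sup>2 - a * b + b\<^sup>2) + 3 * (a * b)) mod 3" by (simp only:)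
  thus ?thesis by (simp only: mod_mult_self2)
qed

lemma square_mod_3: "\<not> 3 dvd s \<Longrightarrow> s\<^sup>2 mod 3 = (1::int)"
proof -
  assume "\<not> 3 dvd s"
  hence "s mod 3 = 1 \<or> s mod 3 = 2" by presburger
  moreover have "s\<^sup>2 mod 3 = (s mod 3)\<^sup>2 mod 3" by (simp add: power_mod)
  ultimately show ?thesis by auto
qed

lemma square_eq_third: "\<not> 3 dvd s \<Longrightarrow> s\<^sup>2 = 1 + 3 * ((s\<^sup>2 - 1) div (3::int))"
  using square_mod_3[of s] div_mult_mod_eq[of "s\<^sup>2 - 1" 3] by presburger

lemma norm_form_mod_3_eq_1: "\<not> 3 dvd a\<^sup>2 - a * b + b\<^sup>2 \<Longrightarrow> (a\<^sup>2 - a * b + b\<^sup>2) mod 3 = (1::int)"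
proof -
  assume *: "\<not> 3 dvd a\<^sup>2 - a * b + b\<^sup>2"
  have "(a + b)\<^sup>2 = (a\<^sup>2 - a * b + b\<^sup>2) + 3 * (a * b)"
    by (simp add: power2_eq_square algebra_simps)
  hence "a\<^sup>2 - a * b + b\<^sup>2 = (a + b) * (a + b) - 3 * (a * b)"
    by (simp add: power2_eq_square)
  with * have "\<not> 3 dvd a + b" by (metis dvd_diff dvd_mult2 dvd_triv_left)
  thus ?thesis unfolding norm_form_mod_3 by (rule square_mod_3)
qed

text \<open>The map x -> (x - 1) / 3 modulo 3 is a logarithm on the residues modulo 9 that are 1
  modulo 3. It makes the exponents (N - 1) / 3 and (q^2 - 1) / 3 additive under products.\<close>

lemma third_of_product:
  fixes x y :: int
  assumes "x mod 3 = 1" "y mod 3 = 1"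
  shows "[(x * y - 1) div 3 = (x - 1) div 3 + (y - 1) div 3] (mod 3)"
proof -
  obtain k l where kl: "x = 1 + 3 * k" "y = 1 + 3 * l"
    using assms by (metis add.commute mod_mult_div_eq mult.commute)
  have "x * y - 1 = 3 * (k + l + 3 * (k * l))" by (simp add: kl algebra_simps)
  hence "(x * y - 1) div 3 = k + l + 3 * (k * l)" by simp
  moreover have "(x - 1) div 3 = k" "(y - 1) div 3 = l" by (simp_all add: kl)
  ultimately show ?thesis by (simp add: cong_def)
qed

lemma norm_form_pos: "coprime a b \<Longrightarrow> a\<^sup>2 - a * b + b\<^sup>2 > (0::int)"
proof -
  assume c: "coprime a b"
  have "4 * (a\<^sup>2 - a * b + b\<^sup>2) = (2 * a - b)\<^sup>2 + 3 * b\<^sup>2"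
    by (simp add: power2_eq_square algebra_simps)
  moreover have "(2 * a - b)\<^sup>2 + 3 * b\<^sup>2 > 0"
  proof (cases "b = 0")
    case True
    hence "a \<noteq> 0" using c by auto
    thus ?thesis using True by simp
  next
    case False
    hence "b\<^sup>2 > 0" by simp
    moreover have "(2 * a - b)\<^sup>2 \<ge> 0" by simp
    ultimately show ?thesis by linarith
  qed
  ultimately have "4 * (a\<^sup>2 - a * b + b\<^sup>2) > 0" by (simp only:)
  thus ?thesis by (simp only: zero_less_mult_iff) simp
qed

lemma coprime_norm_form:
  fixes a b :: int
  assumes "coprime a b"
  shows "coprime b (a\<^sup>2 - a * b + b\<^sup>2)" "coprime a (a\<^sup>2 - a * b + b\<^sup>2)"
proof -
  have *: "coprime x (x * z + y\<^sup>2)" if xy: "coprime x y" for x y z :: int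
  proof (rule coprimeI)
    fix c assume c: "c dvd x" "c dvd x * z + y\<^sup>2"
    hence "c dvd y\<^sup>2" by (simp add: dvd_add_right_iff)
    moreover have "coprime x (y\<^sup>2)" using xy by simp
    ultimately show "is_unit c" using c(1) coprime_common_divisor by blast
  qed
  have "a\<^sup>2 - a * b + b\<^sup>2 = b * (b - a) + a\<^sup>2" "a\<^sup>2 - a * b + b\<^sup>2 = a * (a - b) + b\<^sup>2"
    by (simp_all add: power2_eq_square algebra_simps)
  moreover have "coprime b a" using assms by (simp add: coprime_commute)
  ultimately show "coprime b (a\<^sup>2 - a * b + b\<^sup>2)" "coprime a (a\<^sup>2 - a * b + b\<^sup>2)"
    using *[of b a "b - a"] *[of a b "a - b"] assms by (simp_all only:)
qed

lemma unit_norm_cases: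
  fixes a b :: int
  assumes "a\<^sup>2 - a * b + b\<^sup>2 = 1"
  obtains \<epsilon> i :: int where "\<epsilon> = 1 \<or> \<epsilon> = - 1" "eis a b = of_int \<epsilon> * om i"
proof -
  have eq: "(2 * a - b)\<^sup>2 + 3 * b\<^sup>2 = 4" "(2 * b - a)\<^sup>2 + 3 * a\<^sup>2 = 4"
    using assms by (simp_all add: power2_eq_square algebra_simps)
  have bound: "\<bar>c\<bar> \<le> 1" if "d\<^sup>2 + 3 * c\<^sup>2 = 4" for c d :: int
  proof -
    have "c\<^sup>2 < 4" using that zero_le_power2[of d] by linarith
    hence "c\<^sup>2 < 2\<^sup>2" by simp
    hence "\<bar>c\<bar> < 2" by (metis abs_le_square_iff abs_numeral linorder_not_less)
    thus ?thesis by linarith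
  qed
  have "\<bar>b\<bar> \<le> 1" "\<bar>a\<bar> \<le> 1" using bound eq by blast+
  hence "a \<in> {- 1, 0, 1}" "b \<in> {- 1, 0, 1}" by auto
  hence cs: "(a, b) \<in> {(1, 0), (- 1, 0), (0, 1), (0, - 1), (1, 1), (- 1, - 1)}"
    using assms by auto
  have vals: "eis 1 0 = of_int 1 * om 0" "eis (- 1) 0 = of_int (- 1) * om 0"
    "eis 0 1 = of_int 1 * om 1" "eis 0 (- 1) = of_int (- 1) * om 1"
    "eis 1 1 = of_int (- 1) * om 2" "eis (- 1) (- 1) = of_int 1 * om 2"
    by (simp_all add: eis_def om_2)
  from cs consider "a = 1" "b = 0" | "a = - 1" "b = 0" | "a = 0" "b = 1" | "a = 0" "b = - 1"
    | "a = 1" "b = 1" | "a = - 1" "b = - 1" by auto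
  thus thesis
  proof cases
    case 1 thus thesis using that[of 1 0] vals(1) by simp
  next
    case 2 thus thesis using that[of "- 1" 0] vals(2) by simp
  next
    case 3 thus thesis using that[of 1 1] vals(3) by simp
  next
    case 4 thus thesis using that[of "- 1" 1] vals(4) by simp
  next
    case 5 thus thesis using that[of "- 1" 2] vals(5) by simp
  next
    case 6 thus thesis using that[of 1 2] vals(6) by simp
  qed
qed

text \<open>Signs are invisible to the cubic symbol: the exponent is even for odd q, and for q = 2
  the two signs coincide.\<close>

lemma acong_sign_power:
  fixes \<epsilon> :: int
  assumes q: "prime (q::nat)" "q \<noteq> 3" and \<epsilon>: "\<epsilon> = 1 \<or> \<epsilon> = - 1"
  shows "[\<epsilon> ^ ((q\<^sup>2 - 1) div 3) = 1] (mod int q)"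
proof (cases "q = 2")
  case True
  thus ?thesis using \<epsilon> by (auto simp: cong_def)
next
  case False
  from odd_prime_square_even[OF q False] \<epsilon> show ?thesis by auto
qed

text \<open>Induction on the norm. As a and b are coprime, a prime p dividing N gives the root w = -
  a / b of w^2 + w + 1 modulo p. The Jacobi sum belonging to (p, w) has norm p and lies in the same
  prime as \<delta>, hence divides \<delta>. All clauses of \<open>cubic_symbol\<close> pass to such
  a product; the unit left at the end supplies \<open>i\<close>.\<close>

lemma cubic_symbol_exists:
  fixes a b :: int
  assumes "coprime a b" "\<not> 3 dvd a\<^sup>2 - a * b + b\<^sup>2"
  shows "\<exists>L i \<epsilon>. cubic_symbol a b L i \<epsilon>"
  using assms
proof (induction "nat (a\<^sup>2 - a * b + b\<^sup>2)" arbitrary: a b rule: less_induct)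
  case less
  define N where "N = a\<^sup>2 - a * b + b\<^sup>2"
  have Npos: "N > 0" using norm_form_pos[OF less.prems(1)] by (simp add: N_def)
  show ?case
  proof (cases "N = 1")
    case True
    obtain \<epsilon> i where e: "\<epsilon> = 1 \<or> \<epsilon> = - 1" "eis a b = of_int \<epsilon> * om i"
      using unit_norm_cases True unfolding N_def by metis
    have "acong (int q) (eis a b ^ ((q\<^sup>2 - 1) div 3)) (om (i * int ((q\<^sup>2 - 1) div 3)))"
      if q: "prime q" "q \<noteq> 3" for q :: nat
    proof -
      define e where "e = (q\<^sup>2 - 1) div 3"
      have "eis a b ^ e = om (i * int e) * of_int (\<epsilon> ^ e)"
        unfolding \<open>eis a b = _\<close> by (simp add: power_mult_distrib zeta_power mult.commute)
      also have "acong (int q) \<dots> (om (i * int e) * of_int 1)"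
        using acong_sign_power[OF q e(1)] unfolding e_def[symmetric] by (intro acong_scale acong_of_int) auto
      finally show ?thesis by (simp add: e_def)
    qed
    \<comment> \<open>Residue symbols modulo a unit are trivial, so reciprocity only records the
      power of the unit itself.\<close>
    hence "cubic_symbol a b (\<lambda>_. 0) i \<epsilon>"
      using e True unfolding cubic_symbol_def N_def[symmetric] Let_def by auto
    thus ?thesis by blast
  next
    case False
    hence "\<not> N dvd 1" using Npos by simp
    then obtain p where pp: "prime p" "p dvd N"
      using Npos prime_divisor_exists[of N] by auto
    have cb: "coprime b N" using coprime_norm_form(1)[OF less.prems(1)] by (simp add: N_def)
    from coprime_divisors[OF dvd_refl pp(2) this] have pb: "coprime b p" .
    obtain b' where "[b * b' = 1] (mod p)" using cong_solve_coprime_int[OF pb] by blast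
    hence "[b * b' * (- a) = 1 * (- a)] (mod p)" by (intro cong_mult cong_refl)
    hence "[b * (b' * (- a)) = - a] (mod p)" by (simp add: mult_ac)
    then obtain w where w: "[b * w = - a] (mod p)" by blast
    have awp: "p dvd a + b * w"
      using w unfolding cong_iff_dvd_diff by (simp add: add.commute)
    have p3: "p \<noteq> 3" using pp less.prems(2) by (auto simp: N_def)
    have "b\<^sup>2 * (w\<^sup>2 + w + 1) = (b * w)\<^sup>2 + b * (b * w) + b\<^sup>2"
      by (simp add: power2_eq_square algebra_simps)
    also have "[\<dots> = (- a)\<^sup>2 + b * (- a) + b\<^sup>2] (mod p)"
      by (intro cong_add cong_pow cong_mult w cong_refl)
    also have "(- a)\<^sup>2 + b * (- a) + b\<^sup>2 = N" by (simp add: N_def algebra_simps)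
    finally have "p dvd b\<^sup>2 * (w\<^sup>2 + w + 1)" using pp(2) cong_dvd_iff by blast
    moreover have "coprime p (b\<^sup>2)" using pb by (simp add: coprime_commute)
    ultimately have ww: "[w\<^sup>2 + w + 1 = 0] (mod p)"
      by (simp add: cong_0_iff coprime_dvd_mult_right_iff)
    interpret cubic_character p w by unfold_locales (use pp p3 ww in auto)
    obtain A B where J: "jacobi = eis A B" "[A + B * w = 0] (mod p)" by (rule jacobi_eis)
    have "eis A B * eis (A - B) (- B) = eis p 0"
      using jacobi_norm J(1) by (simp add: cnj_eis eis_def[of p])
    hence nJ: "A\<^sup>2 - A * B + B\<^sup>2 = p"
      unfolding eis_mult eis_eq_iff by (simp add: power2_eq_square algebra_simps)
    have pA: "p dvd A + B * w" using J(2) by (simp add: cong_0_iff)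
    \<comment> \<open>The product of \<delta> with the conjugate of the Jacobi sum has the
      coordinates a A - a B + b B and b A - a B. Both are divisible by \<open>p\<close>, and the
      quotient \<open>eis a1 b1\<close> is \<delta> divided by the Jacobi sum.\<close>
    have "b * A - a * B = b * (A + B * w) - B * (a + b * w)" by (simp add: algebra_simps)
    hence "p dvd b * A - a * B" using pA awp by simp
    then obtain b1 where b1: "b * A - a * B = p * b1" by blast
    have "a * A - a * B + b * B = a * (A + B * w) - B * (w + 1) * (a + b * w) + b * B * (w\<^sup>2 + w + 1)"
      by (simp add: power2_eq_square algebra_simps)
    moreover have "p dvd w\<^sup>2 + w + 1" using ww by (simp add: cong_0_iff)
    ultimately have "p dvd a * A - a * B + b * B" using pA awp by (simp add: dvd_add dvd_diff)
    then obtain a1 where a1: "a * A - a * B + b * B = p * a1" by blast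
    have "p * (A * a1 - B * b1) = A * (p * a1) - B * (p * b1)" by (simp add: algebra_simps)
    also have "\<dots> = A * (a * A - a * B + b * B) - B * (b * A - a * B)" by (simp only: a1 b1)
    also have "\<dots> = (A\<^sup>2 - A * B + B\<^sup>2) * a" by (simp add: power2_eq_square algebra_simps)
    finally have "p * (A * a1 - B * b1) = p * a" by (simp only: nJ)
    hence a_eq: "a = A * a1 - B * b1" using p_pos by simp
    have "p * (A * b1 + B * a1 - B * b1) = A * (p * b1) + B * (p * a1) - B * (p * b1)"
      by (simp add: algebra_simps)
    also have "\<dots> = A * (b * A - a * B) + B * (a * A - a * B + b * B) - B * (b * A - a * B)"
      by (simp only: a1 b1)
    also have "\<dots> = (A\<^sup>2 - A * B + B\<^sup>2) * b" by (simp add: power2_eq_square algebra_simps)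
    finally have "p * (A * b1 + B * a1 - B * b1) = p * b" by (simp only: nJ)
    hence b_eq: "b = A * b1 + B * a1 - B * b1" using p_pos by simp
    have ab: "eis a b = jacobi * eis a1 b1" by (simp add: J eis_mult a_eq b_eq)
    define N' where "N' = a1\<^sup>2 - a1 * b1 + b1\<^sup>2"
    have N: "N = p * N'" unfolding N_def N'_def nJ[symmetric] a_eq b_eq
      by (simp add: power2_eq_square algebra_simps)
    have N'pos: "N' > 0" using Npos p_pos unfolding N by (simp add: zero_less_mult_iff)
    have "coprime a1 b1"
    proof (rule coprimeI)
      fix d assume "d dvd a1" "d dvd b1"
      hence "d dvd a" "d dvd b" unfolding a_eq b_eq by auto
      thus "is_unit d" using less.prems(1) coprime_common_divisor by blast
    qed
    moreover have n3: "\<not> 3 dvd N'" using less.prems(2) unfolding N_def[symmetric] N by auto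
    moreover have "N' < N" unfolding N using N'pos prime_gt_1_int[OF pp(1)] by simp
    hence "nat N' < nat N" using N'pos by simp
    ultimately obtain L' i' \<epsilon>' where sym: "cubic_symbol a1 b1 L' i' \<epsilon>'"
      using less.hyps[of a1 b1] unfolding N_def N'_def by blast
    have S1: "\<epsilon>' = 1 \<or> \<epsilon>' = - 1" and S2: "acong 3 (eis a1 b1) (of_int \<epsilon>' * om i')"
      and S3: "\<And>r s. coprime r N' \<Longrightarrow> coprime s N' \<Longrightarrow> [L' (r * s) = L' r + L' s] (mod 3)"
      and S4: "\<And>r s. coprime r N' \<Longrightarrow> [r = s] (mod N') \<Longrightarrow> [L' r = L' s] (mod 3)"
      and S5: "\<And>w. N' dvd a1 + b1 * w \<Longrightarrow> [L' w = (N' - 1) div 3] (mod 3)"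
      and S6: "\<And>q. prime q \<Longrightarrow> q \<noteq> 3 \<Longrightarrow> \<not> int q dvd N' \<Longrightarrow>
        acong (int q) ((of_int N' * eis a1 b1) ^ ((q\<^sup>2 - 1) div 3))
          (om (L' (int q) + i' * int ((q\<^sup>2 - 1) div 3)))"
      using sym unfolding cubic_symbol_def N'_def[symmetric] Let_def by blast+
    have N'3: "N' mod 3 = 1" using norm_form_mod_3_eq_1 n3 unfolding N'_def by blast
    \<comment> \<open>Symbols multiply along the factorisation, so exponents add. The sign
      \<epsilon> flips because the Jacobi sum is -1 modulo 3.\<close>
    define L where "L r = L' r + int (ell r)" for r
    have cop: "coprime r N' \<and> \<not> p dvd r" if cr: "coprime r N" for r
    proof
      show "coprime r N'" using cr unfolding N by simp
      show "\<not> p dvd r"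
      proof
        assume "p dvd r"
        hence "is_unit p" using cr pp(2) coprime_common_divisor by blast
        thus False using pp(1) not_prime_unit by blast
      qed
    qed
    have "cubic_symbol a b L i' (- \<epsilon>')"
      unfolding cubic_symbol_def N_def[symmetric] Let_def
    proof (intro conjI allI impI)
      show "- \<epsilon>' = 1 \<or> - \<epsilon>' = - 1" using S1 by auto
      have "acong 3 (jacobi * eis a1 b1) ((- 1) * (of_int \<epsilon>' * om i'))"
        by (intro acong_mult jacobi_cong_3 S2 algebraic_int_jacobi algebraic_int_add_mult) auto
      thus "acong 3 (eis a b) (of_int (- \<epsilon>') * om i')" by (simp add: ab)
    next
      fix r s assume "coprime r N" "coprime s N"
      hence c: "coprime r N'" "coprime s N'" "\<not> p dvd r" "\<not> p dvd s" using cop by blast+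
      have "[L' (r * s) + int (ell (r * s)) = (L' r + L' s) + (int (ell r) + int (ell s))] (mod 3)"
        by (intro cong_add ell_mult S3 c)
      thus "[L (r * s) = L r + L s] (mod 3)" by (simp add: L_def algebra_simps)
    next
      fix r s assume r: "coprime r N" and rs: "[r = s] (mod N)"
      have rs': "[r = s] (mod N')" "[r = s] (mod p)"
        using rs dvd_mult_left[of p N' "r - s"] dvd_mult_right[of p N' "r - s"]
        unfolding N cong_iff_dvd_diff by blast+
      have r': "coprime r N'" "\<not> p dvd r" using cop[OF r] by blast+
      show "[L r = L s] (mod 3)"
        unfolding L_def by (intro cong_add ell_cong S4 r' rs')
    next
      fix v assume v: "N dvd a + b * v"
      have "b\<^sup>2 * (v\<^sup>2 + v + 1) = (a + b * v) * (b * v - a + b) + N"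
        by (simp add: N_def power2_eq_square algebra_simps)
      hence "N dvd b\<^sup>2 * (v\<^sup>2 + v + 1)" using v by simp
      moreover have "coprime N (b\<^sup>2)" using cb by (simp add: coprime_commute)
      ultimately have vv: "N dvd v\<^sup>2 + v + 1" by (simp add: coprime_dvd_mult_right_iff)
      define u where "u = a1 + b1 * v"
      \<comment> \<open>Here A - B - B v is the conjugate of the Jacobi sum with \<omega> replaced
        by v. Since v^2 + v + 1 vanishes modulo N, multiplying by it undoes the Jacobi factor of a +
        b v up to the integer p.\<close>
      have "p * u = (A - B - B * v) * ((a + b * v) + B * b1 * (v\<^sup>2 + v + 1)) + B\<^sup>2 * (v\<^sup>2 + v + 1) * u"
        unfolding nJ[symmetric] a_eq b_eq u_def by (simp add: power2_eq_square algebra_simps)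
      moreover have "N dvd \<dots>"
        by (rule dvd_add[OF dvd_mult[OF dvd_add[OF v dvd_mult[OF vv]]] dvd_mult2[OF dvd_mult[OF vv]]])
      ultimately have "p * N' dvd p * u" using N by (simp only:)
      hence "N' dvd a1 + b1 * v" using p_pos by (simp add: u_def)
      hence 1: "[L' v = (N' - 1) div 3] (mod 3)" by (rule S5)
      have "p dvd b * (v - w)"
      proof -
        have "p dvd (a + b * v) - (a + b * w)" using v pp(2) awp dvd_trans by (intro dvd_diff) blast+
        thus ?thesis by (simp add: algebra_simps)
      qed
      hence vw: "[v = w] (mod p)"
        using pb by (simp add: cong_iff_dvd_diff coprime_dvd_mult_right_iff coprime_commute)
      hence "\<not> p dvd v" using not_dvd_w cong_dvd_iff by blast
      \<comment> \<open>Modulo \<open>p\<close> the number v is the base \<open>w\<close> of the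
        logarithm, so the k-th power of v has exponent k = (p - 1) / 3.\<close>
      hence "[int (ell v) = int k] (mod 3)" by (rule ell_eqI) (intro cong_pow vw)
      moreover have "int k = (p - 1) div 3" using k(1) by linarith
      ultimately have 2: "[int (ell v) = (p - 1) div 3] (mod 3)" by (simp only:)
      have "[L v = (N' - 1) div 3 + (p - 1) div 3] (mod 3)"
        unfolding L_def by (intro cong_add 1 2)
      also have "[(N' - 1) div 3 + (p - 1) div 3 = (N' * p - 1) div 3] (mod 3)"
        by (rule cong_sym, rule third_of_product[OF N'3 p_mod_3])
      finally show "[L v = (N - 1) div 3] (mod 3)" by (simp add: N mult.commute)
    next
      fix q :: nat assume q: "prime q" "q \<noteq> 3" "\<not> int q dvd N"
      define e where "e = (q\<^sup>2 - 1) div 3"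
      have qp: "int q \<noteq> p" "\<not> int q dvd N'" using q(3) unfolding N by auto
      hence pq: "\<not> p dvd int q" using pp(1) q(1) primes_dvd_imp_eq[of p "int q"] by auto
      have "acong (int q) ((of_int p * jacobi) ^ e * (of_int N' * eis a1 b1) ^ e)
          (chi (int q) * om (L' (int q) + i' * int e))"
        unfolding e_def
        by (intro acong_mult jacobi_reciprocity[OF q(1,2) qp(1)] S6[OF q(1,2) qp(2)]
            algebraic_int_power algebraic_int_add_mult algebraic_int_jacobi) auto
      moreover have "(of_int p * jacobi) ^ e * (of_int N' * eis a1 b1) ^ e = (of_int N * eis a b) ^ e"
        by (simp add: power_mult_distrib[symmetric] N ab mult_ac)
      moreover have "chi (int q) * om (L' (int q) + i' * int e) = om (L (int q) + i' * int e)"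
        using pq by (simp add: chi_def L_def flip: zeta_add, simp add: algebra_simps)
      ultimately show "acong (int q) ((of_int N * eis a b) ^ ((q\<^sup>2 - 1) div 3))
          (om (L (int q) + i' * int ((q\<^sup>2 - 1) div 3)))"
        by (simp add: e_def)
    qed
    thus ?thesis by blast
  qed
qed

section \<open>Direct evaluation of the reciprocity power at primes dividing a + b or 2 a -
  b\<close>

lemma int_third_square: "q > 0 \<Longrightarrow> int ((q\<^sup>2 - 1) div 3) = ((int q)\<^sup>2 - 1) div 3"
  by (simp add: zdiv_int of_nat_diff)

text \<open>The numbers 1 + 2 \<omega> and \<omega> - 1 have the squares -3 and -3 \<omega>. For odd
  q, q - 1 divides (q^2 - 1) / 2, so Fermat's theorem makes (-3)^((q^2 - 1) / 2) equal to 1 modulo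
  q.\<close>

lemma acong_minus_3_power:
  assumes q: "prime (q::nat)" "q \<noteq> 3" "q \<noteq> 2"
  shows "acong (int q) (eis 1 2 ^ (q\<^sup>2 - 1)) 1" "acong (int q) (eis (- 1) 1 ^ (q\<^sup>2 - 1)) 1"
proof -
  define e where "e = (q\<^sup>2 - 1) div 3"
  have 3: "q\<^sup>2 - 1 = 3 * e" using prime_square_mod_3[OF q(1,2)] by (simp add: e_def)
  obtain h where h: "e = 2 * h" using odd_prime_square_even[OF q] unfolding e_def by blast
  have eq: "q\<^sup>2 - 1 = 2 * (3 * h)" using 3 h by simp
  have "\<not> int q dvd 3" using q(1,2) primes_dvd_imp_eq[of "int q" 3] by auto
  hence n3: "\<not> int q dvd - 3" by simp
  have "odd q" using q primes_dvd_imp_eq[of 2 q] by auto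
  then obtain j where j: "q = 2 * j + 1" using oddE by blast
  have "q\<^sup>2 - 1 = 4 * (j * (j + 1))" unfolding j by (simp add: power2_eq_square algebra_simps)
  hence jj: "3 * h = (q - 1) * (j + 1)" using eq unfolding j by simp
  have "prime (int q)" using q by simp
  from fermat_int[OF this n3] have f: "[(- 3) ^ (q - 1) = 1] (mod int q)"
    by (simp add: nat_diff_distrib')
  have "(- 3 :: int) ^ (3 * h) = ((- 3) ^ (q - 1)) ^ (j + 1)" unfolding jj by (simp only: power_mult)
  also have "[\<dots> = 1 ^ (j + 1)] (mod int q)" by (intro cong_pow f)
  finally have m3: "[(- 3) ^ (3 * h) = 1] (mod int q)" by simp
  have "eis 1 2 ^ (q\<^sup>2 - 1) = (eis 1 2 ^ 2) ^ (3 * h)" unfolding eq by (simp only: power_mult)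
  also have "eis 1 2 ^ 2 = of_int (- 3)" by (simp add: power2_eq_square eis_mult) (simp add: eis_def)
  also have "of_int (- 3) ^ (3 * h) = (of_int ((- 3) ^ (3 * h)) :: complex)" by (simp only: of_int_power)
  finally show "acong (int q) (eis 1 2 ^ (q\<^sup>2 - 1)) 1" using acong_of_int[OF m3] by simp
  have "eis (- 1) 1 ^ (q\<^sup>2 - 1) = (eis (- 1) 1 ^ 2) ^ (3 * h)" unfolding eq by (simp only: power_mult)
  also have "eis (- 1) 1 ^ 2 = of_int (- 3) * om 1" by (simp add: power2_eq_square eis_mult) (simp add: eis_def)
  also have "(of_int (- 3) * om 1) ^ (3 * h) = (of_int ((- 3) ^ (3 * h)) :: complex) * om 1 ^ (3 * h)"
    by (simp only: of_int_power power_mult_distrib)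
  also have "om 1 ^ (3 * h) = 1" by (simp add: zeta_power zeta_eq_1_iff)
  finally show "acong (int q) (eis (- 1) 1 ^ (q\<^sup>2 - 1)) 1" using acong_of_int[OF m3] by simp
qed

text \<open>Modulo q, \<delta> is b (\<omega> - 1) and N is 3 b^2. The factor b^3 disappears in the
  power by Fermat, and 3 (\<omega> - 1) = - \<omega>^2 (\<omega> - 1)^3 leaves the power of
  \<omega>^2. The prime 2 is checked by hand.\<close>

lemma acong_power_norm_eis_sum:
  fixes a b N :: int
  assumes q: "prime (q::nat)" "q \<noteq> 3" and N: "N = a\<^sup>2 - a * b + b\<^sup>2" and ab: "coprime a b" "int q dvd a + b"
  shows "acong (int q) ((of_int N * eis a b) ^ ((q\<^sup>2 - 1) div 3))
           (om (2 * int ((q\<^sup>2 - 1) div 3)))"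
proof -
  define e where "e = (q\<^sup>2 - 1) div 3"
  have 3: "q\<^sup>2 - 1 = 3 * e" using prime_square_mod_3[OF q] by (simp add: e_def)
  have pq: "prime (int q)" using q by simp
  have am: "[a = - b] (mod int q)" using ab(2) by (simp add: cong_iff_dvd_diff)
  have qb: "\<not> int q dvd b"
  proof
    assume *: "int q dvd b"
    hence "int q dvd a" using ab(2) by (simp add: dvd_add_left_iff)
    with * have "is_unit (int q)" using ab(1) coprime_common_divisor by blast
    thus False using pq not_prime_unit by blast
  qed
  have "[a\<^sup>2 - a * b + b\<^sup>2 = (- b)\<^sup>2 - (- b) * b + b\<^sup>2] (mod int q)"
    by (intro cong_add cong_diff cong_mult cong_pow am cong_refl)
  moreover have "(- b)\<^sup>2 - (- b) * b + b\<^sup>2 = 3 * b\<^sup>2" by (simp add: power2_eq_square)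
  ultimately have Nb: "[N = 3 * b\<^sup>2] (mod int q)" by (simp only: N)
  have "acong (int q) (of_int N * eis a b) (of_int (3 * b\<^sup>2) * eis (- b) b)"
    by (intro acong_mult acong_of_int Nb) (auto simp: acong_eis_iff[OF pq] am)
  moreover have "of_int (3 * b\<^sup>2) * eis (- b) b = of_int (b ^ 3) * (of_int 3 * eis (- 1) 1)"
    by (simp add: eis_def power2_eq_square power3_eq_cube algebra_simps)
  ultimately have "acong (int q) (of_int N * eis a b) (of_int (b ^ 3) * (of_int 3 * eis (- 1) 1))" by (simp only:)
  hence "acong (int q) ((of_int N * eis a b) ^ e)
      ((of_int (b ^ 3) * (of_int 3 * eis (- 1) 1)) ^ e)"
    by (intro acong_power algebraic_int_add_mult algebraic_int_of_int algebraic_int_eis)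
  also have "(of_int (b ^ 3) * (of_int 3 * eis (- 1) 1)) ^ e
      = (of_int 3 * eis (- 1) 1) ^ e * (of_int (b ^ (q\<^sup>2 - 1)) :: complex)"
    unfolding 3 by (simp add: power_mult_distrib power_mult)
  also have "acong (int q) \<dots> ((of_int 3 * eis (- 1) 1) ^ e * of_int 1)"
    by (intro acong_scale acong_of_int fermat_square[OF q(1) qb] algebraic_int_power algebraic_int_add_mult) auto
  also have "(of_int 3 * eis (- 1) 1) ^ e * of_int 1 = (of_int 3 * eis (- 1) 1) ^ e" by simp
  also have "acong (int q) \<dots> (om (2 * int e))"
  proof (cases "q = 2")
    case True
    hence e1: "e = 1" by (simp add: e_def)
    have "of_int 3 * eis (- 1) 1 = eis (- 3) 3" by (simp add: eis_def algebra_simps)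
    moreover have "acong 2 (eis (- 3) 3) (eis (- 1) (- 1))"
      by (subst acong_eis_iff) (auto simp: cong_def)
    ultimately show ?thesis using True by (simp add: e1 om_eis(3))
  next
    case False
    have "of_int 3 * eis (- 1) 1 = of_int (- 1) * om 2 * eis (- 1) 1 ^ 3"
      unfolding om_eis by (simp add: power3_eq_cube eis_mult) (simp add: eis_def algebra_simps)
    hence "(of_int 3 * eis (- 1) 1) ^ e = (of_int (- 1) * om 2 * eis (- 1) 1 ^ 3) ^ e" by (simp only:)
    also have "\<dots> = (om 2 ^ e * (eis (- 1) 1 ^ 3) ^ e) * of_int ((- 1) ^ e)"
      by (simp only: power_mult_distrib of_int_power mult_ac)
    also have "om 2 ^ e = om (2 * int e)" by (simp add: zeta_power mult.commute)
    also have "(eis (- 1) 1 ^ 3) ^ e = eis (- 1) 1 ^ (q\<^sup>2 - 1)" by (simp only: 3 power_mult)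
    finally have "(of_int 3 * eis (- 1) 1) ^ e = (om (2 * int e) * eis (- 1) 1 ^ (q\<^sup>2 - 1)) * of_int ((- 1) ^ e)" .
    also have "acong (int q) ((om (2 * int e) * eis (- 1) 1 ^ (q\<^sup>2 - 1)) * of_int ((- 1) ^ e))
        ((om (2 * int e) * eis (- 1) 1 ^ (q\<^sup>2 - 1)) * of_int 1)"
      using acong_sign_power[OF q, of "- 1"]
      by (intro acong_scale acong_of_int algebraic_int_add_mult algebraic_int_power) (auto simp: e_def)
    also have "(om (2 * int e) * eis (- 1) 1 ^ (q\<^sup>2 - 1)) * of_int 1 = om (2 * int e) * eis (- 1) 1 ^ (q\<^sup>2 - 1)"
      by simp
    also have "acong (int q) \<dots> (om (2 * int e) * 1)"
      by (intro acong_scale acong_minus_3_power q False) auto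
    finally show ?thesis by simp
  qed
  finally show ?thesis by (simp add: e_def)
qed

text \<open>Modulo q, \<delta> is a (1 + 2 \<omega>), a multiple of a square root of -3, and N is 3
  a^2. Since 3 (1 + 2 \<omega>) = - (1 + 2 \<omega>)^3, nothing remains of the power.\<close>

lemma acong_power_norm_eis_double:
  fixes a b N :: int
  assumes q: "prime (q::nat)" "q \<noteq> 3" "q \<noteq> 2" and N: "N = a\<^sup>2 - a * b + b\<^sup>2" and ab: "coprime a b" "int q dvd 2 * a - b"
  shows "acong (int q) ((of_int N * eis a b) ^ ((q\<^sup>2 - 1) div 3)) 1"
proof -
  define e where "e = (q\<^sup>2 - 1) div 3"
  have 3: "q\<^sup>2 - 1 = 3 * e" using prime_square_mod_3[OF q(1,2)] by (simp add: e_def)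
  have ev: "even e" using odd_prime_square_even[OF q] by (simp add: e_def)
  have pq: "prime (int q)" using q by simp
  have am: "[b = 2 * a] (mod int q)" using ab(2) by (simp add: cong_iff_dvd_diff dvd_diff_commute)
  have qa: "\<not> int q dvd a"
  proof
    assume *: "int q dvd a"
    have "int q dvd 2 * a - (2 * a - b)" by (rule dvd_diff[OF dvd_mult[OF *] ab(2)])
    moreover have "2 * a - (2 * a - b) = b" by simp
    ultimately have "int q dvd b" by (simp only:)
    with * have "is_unit (int q)" using ab(1) coprime_common_divisor by blast
    thus False using pq not_prime_unit by blast
  qed
  have "[a\<^sup>2 - a * b + b\<^sup>2 = a\<^sup>2 - a * (2 * a) + (2 * a)\<^sup>2] (mod int q)"
    by (intro cong_add cong_diff cong_mult cong_pow am cong_refl)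
  moreover have "a\<^sup>2 - a * (2 * a) + (2 * a)\<^sup>2 = 3 * a\<^sup>2" by (simp add: power2_eq_square)
  ultimately have Nb: "[N = 3 * a\<^sup>2] (mod int q)" by (simp only: N)
  have "acong (int q) (of_int N * eis a b) (of_int (3 * a\<^sup>2) * eis a (2 * a))"
    by (intro acong_mult acong_of_int Nb) (auto simp: acong_eis_iff[OF pq] am)
  moreover have "of_int (3 * a\<^sup>2) * eis a (2 * a) = of_int (a ^ 3) * (of_int 3 * eis 1 2)"
    by (simp add: eis_def power2_eq_square power3_eq_cube algebra_simps)
  ultimately have "acong (int q) (of_int N * eis a b) (of_int (a ^ 3) * (of_int 3 * eis 1 2))" by (simp only:)
  hence "acong (int q) ((of_int N * eis a b) ^ e)
      ((of_int (a ^ 3) * (of_int 3 * eis 1 2)) ^ e)"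
    by (intro acong_power algebraic_int_add_mult algebraic_int_of_int algebraic_int_eis)
  also have "(of_int (a ^ 3) * (of_int 3 * eis 1 2)) ^ e
      = (of_int 3 * eis 1 2) ^ e * (of_int (a ^ (q\<^sup>2 - 1)) :: complex)"
    unfolding 3 by (simp add: power_mult_distrib power_mult)
  also have "acong (int q) \<dots> ((of_int 3 * eis 1 2) ^ e * of_int 1)"
    by (intro acong_scale acong_of_int fermat_square[OF q(1) qa] algebraic_int_power algebraic_int_add_mult) auto
  also have "(of_int 3 * eis 1 2) ^ e * of_int 1 = eis 1 2 ^ (q\<^sup>2 - 1)"
  proof -
    have "of_int 3 * eis 1 2 = - (eis 1 2 ^ 3)"
      by (simp add: power3_eq_cube eis_mult) (simp add: eis_def algebra_simps)
    thus ?thesis unfolding 3 using ev by (simp add: power_mult)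
  qed
  also have "acong (int q) \<dots> 1" by (rule acong_minus_3_power[OF q])
  finally show ?thesis by (simp add: e_def)
qed

section \<open>Values of the cubic symbol at a + b, at divisors of 2 a - b, and at 3\<close>

locale eisenstein_symbol =
  fixes a b N :: int and L :: "int \<Rightarrow> int" and i \<epsilon> :: int
  assumes cop: "coprime a b" and s3: "\<not> 3 dvd a + b"
    and N_def: "N = a\<^sup>2 - a * b + b\<^sup>2" and sym: "cubic_symbol a b L i \<epsilon>"
begin

lemma eps: "\<epsilon> = 1 \<or> \<epsilon> = - 1" and residue_3: "acong 3 (eis a b) (of_int \<epsilon> * om i)"
  and L_mult: "coprime r N \<Longrightarrow> coprime s N \<Longrightarrow> [L (r * s) = L r + L s] (mod 3)"
  and L_cong: "coprime r N \<Longrightarrow> [r = s] (mod N) \<Longrightarrow> [L r = L s] (mod 3)"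
  and L_root: "N dvd a + b * w \<Longrightarrow> [L w = (N - 1) div 3] (mod 3)"
  and reciprocity: "prime q \<Longrightarrow> q \<noteq> 3 \<Longrightarrow> \<not> int q dvd N \<Longrightarrow>
        acong (int q) ((of_int N * eis a b) ^ ((q\<^sup>2 - 1) div 3))
          (om (L (int q) + i * int ((q\<^sup>2 - 1) div 3)))"
  using sym unfolding cubic_symbol_def N_def[symmetric] Let_def by blast+

text \<open>This identity is used twice: modulo \<open>N\<close> it expresses the symbol of 3 by
  those of a + b, a and b; modulo 9 it expresses (a + b)^2 by the norm equation.\<close>

lemma s_square: "(a + b)\<^sup>2 = N + 3 * (a * b)"
  unfolding N_def by (simp add: power2_eq_square algebra_simps)

lemma s_square_mod_3: "(a + b)\<^sup>2 mod 3 = 1" by (rule square_mod_3[OF s3])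

lemma N_mod_3: "N mod 3 = 1"
  using s_square_mod_3 norm_form_mod_3[of a b] unfolding N_def by simp

lemma L_1: "[L 1 = 0] (mod 3)"
proof -
  have "[L (1 * 1) = L 1 + L 1] (mod 3)" by (rule L_mult) auto
  thus ?thesis by (simp add: cong_iff_dvd_diff)
qed

lemma L_minus: "coprime r N \<Longrightarrow> [L (- r) = L r] (mod 3)"
proof -
  assume r: "coprime r N"
  have "[L ((- 1) * (- 1)) = L (- 1) + L (- 1)] (mod 3)" by (rule L_mult) auto
  hence 0: "[L (- 1) = 0] (mod 3)" using L_1 unfolding cong_def by simp presburger
  have "[L ((- 1) * r) = L (- 1) + L r] (mod 3)" by (rule L_mult) (use r in auto)
  also have "[L (- 1) + L r = 0 + L r] (mod 3)" by (intro cong_add 0 cong_refl)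
  finally show ?thesis by simp
qed

lemma L_power: "coprime r N \<Longrightarrow> [L (r ^ n) = int n * L r] (mod 3)"
proof (induction n)
  case 0
  thus ?case using L_1 by simp
next
  case (Suc n)
  have "[L (r * r ^ n) = L r + L (r ^ n)] (mod 3)" by (rule L_mult) (use Suc in auto)
  also have "[L r + L (r ^ n) = L r + int n * L r] (mod 3)" by (intro cong_add cong_refl Suc)
  finally show ?case by (simp add: algebra_simps)
qed

text \<open>Both sides are additive in products modulo 3, by \<open>L_mult\<close> and
  \<open>third_of_product\<close>, so the prime factors of \<open>s\<close> decide.\<close>

lemma L_from_prime_factors:
  assumes "s > 0" "coprime (int s) N" "\<not> 3 dvd s"
    and "\<And>q. prime q \<Longrightarrow> q dvd s \<Longrightarrow> [L (int q) = c * (((int q)\<^sup>2 - 1) div 3)] (mod 3)"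
  shows "[L (int s) = c * (((int s)\<^sup>2 - 1) div 3)] (mod 3)"
  using assms
proof (induction s rule: less_induct)
  case (less s)
  show ?case
  proof (cases "s = 1")
    case True
    thus ?thesis using L_1 by simp
  next
    case False
    then obtain q where q: "prime q" "q dvd s" using prime_factor_nat by blast
    then obtain t where t: "s = q * t" by blast
    have ts: "t < s" "t > 0" using less.prems(1) q(1) prime_gt_1_nat[OF q(1)] unfolding t by auto
    have ct: "coprime (int t) N" "coprime (int q) N" "\<not> 3 dvd t" "\<not> 3 dvd q"
      using less.prems(2,3) unfolding t by auto
    have IH: "[L (int t) = c * (((int t)\<^sup>2 - 1) div 3)] (mod 3)"
      by (rule less.IH[OF ts ct(1,3)]) (use less.prems(4) t in auto)
    have sq: "(int q)\<^sup>2 mod 3 = 1" "(int t)\<^sup>2 mod 3 = 1"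
      using ct(3,4) by (intro square_mod_3; presburger)+
    have "[L (int q * int t) = L (int q) + L (int t)] (mod 3)" by (rule L_mult[OF ct(2,1)])
    also have "[L (int q) + L (int t) = c * (((int q)\<^sup>2 - 1) div 3) + c * (((int t)\<^sup>2 - 1) div 3)] (mod 3)"
      by (intro cong_add IH less.prems(4) q)
    also have "c * (((int q)\<^sup>2 - 1) div 3) + c * (((int t)\<^sup>2 - 1) div 3)
        = c * (((int q)\<^sup>2 - 1) div 3 + ((int t)\<^sup>2 - 1) div 3)" by (simp add: algebra_simps)
    also have "[\<dots> = c * (((int q)\<^sup>2 * (int t)\<^sup>2 - 1) div 3)] (mod 3)"
      by (intro cong_scalar_left cong_sym[OF third_of_product] sq)
    finally show ?thesis unfolding t by (simp add: power_mult_distrib)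
  qed
qed

lemma L_from_prime_factors_int:
  assumes "coprime s N" "\<not> 3 dvd s"
    and "\<And>q. prime q \<Longrightarrow> int q dvd s \<Longrightarrow> [L (int q) = c * (((int q)\<^sup>2 - 1) div 3)] (mod 3)"
  shows "[L s = c * ((s\<^sup>2 - 1) div 3)] (mod 3)"
proof -
  have s0: "s \<noteq> 0" using assms(2) by auto
  define t where "t = nat \<bar>s\<bar>"
  have t: "int t = \<bar>s\<bar>" by (simp add: t_def)
  have "[L (int t) = c * (((int t)\<^sup>2 - 1) div 3)] (mod 3)"
  proof (rule L_from_prime_factors)
    show "t > 0" using s0 by (simp add: t_def)
    show "coprime (int t) N" using assms(1) by (simp add: t)
    show "\<not> 3 dvd t" using assms(2) t by (metis dvd_abs_iff int_dvd_int_iff of_nat_numeral)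
    show "[L (int q) = c * (((int q)\<^sup>2 - 1) div 3)] (mod 3)" if "prime q" "q dvd t" for q
      by (rule assms(3)[OF that(1)]) (use that(2) t in \<open>metis dvd_abs_iff int_dvd_int_iff\<close>)
  qed
  hence *: "[L \<bar>s\<bar> = c * ((s\<^sup>2 - 1) div 3)] (mod 3)" by (simp add: t)
  show ?thesis
  proof (cases "s \<ge> 0")
    case True
    thus ?thesis using * by simp
  next
    case False
    hence "[L (- s) = c * ((s\<^sup>2 - 1) div 3)] (mod 3)" using * by simp
    moreover have "[L (- s) = L s] (mod 3)" by (rule L_minus[OF assms(1)])
    ultimately show ?thesis using cong_trans cong_sym by blast
  qed
qed

lemma not_dvd_N: "prime q \<Longrightarrow> int q dvd s \<Longrightarrow> coprime s N \<Longrightarrow> \<not> int q dvd N"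
  by (metis coprime_common_divisor not_prime_unit prime_nat_int_transfer)

lemma coprime_s_N: "coprime (a + b) N"
proof (rule coprimeI)
  fix c assume c: "c dvd a + b" "c dvd N"
  have "c dvd (a + b)\<^sup>2 - N" using c by (intro dvd_diff) (auto simp: power2_eq_square)
  hence "c dvd 3 * (a * b)" unfolding s_square by simp
  moreover have "coprime (a + b) a" "coprime (a + b) b"
    using cop gcd_add1[of a b] gcd_add2[of b a] by (simp_all add: coprime_iff_gcd_eq_1 gcd.commute add.commute)
  moreover have "coprime (a + b) 3"
    using s3 prime_imp_coprime[of "3::int" "a + b"] by (simp add: coprime_commute)
  ultimately show "is_unit c" using c(1)
    by (metis coprime_common_divisor coprime_mult_right_iff)
qed

text \<open>For a prime q dividing a + b, comparing reciprocity with the direct value of the power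
  gives L q + i e = 2 e modulo 3, where e = (q^2 - 1) / 3.\<close>

lemma L_s: "[L (a + b) = (2 - i) * (((a + b)\<^sup>2 - 1) div 3)] (mod 3)"
proof (rule L_from_prime_factors_int[OF coprime_s_N s3])
  fix q :: nat assume q: "prime q" "int q dvd a + b"
  have q3: "q \<noteq> 3" using s3 q(2) by auto
  define e where "e = (q\<^sup>2 - 1) div 3"
  have e: "int e = ((int q)\<^sup>2 - 1) div 3"
    unfolding e_def by (rule int_third_square) (use q in \<open>simp add: prime_gt_0_nat\<close>)
  have "acong (int q) (om (L (int q) + i * int e)) (om (2 * int e))"
    using acong_trans[OF acong_sym[OF reciprocity[OF q(1) q3 not_dvd_N[OF q coprime_s_N]]]]
      acong_power_norm_eis_sum[OF q(1) q3 N_def cop q(2)] unfolding e_def by blast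
  hence "[L (int q) + i * int e = 2 * int e] (mod 3)"
    using acong_om_iff[of "int q"] q(1) by simp
  hence "[(L (int q) + i * int e) - i * int e = 2 * int e - i * int e] (mod 3)"
    by (intro cong_diff cong_refl)
  thus "[L (int q) = (2 - i) * (((int q)\<^sup>2 - 1) div 3)] (mod 3)"
    unfolding e[symmetric] by (simp add: algebra_simps)
qed

text \<open>For a prime q dividing \<open>f\<close> the power in the reciprocity law is 1, so L q +
  i e = 0 modulo 3 with e = (q^2 - 1) / 3. In the norm equations, 2 a - b is a multiple of the
  denominator \<open>f\<close>.\<close>

lemma L_f:
  assumes f: "odd f" "\<not> 3 dvd f" "coprime f N" "f dvd 2 * a - b"
  shows "[L f = - i * ((f\<^sup>2 - 1) div 3)] (mod 3)"
proof (rule L_from_prime_factors_int[OF f(3) f(2)])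
  fix q :: nat assume q: "prime q" "int q dvd f"
  have q3: "q \<noteq> 3" "q \<noteq> 2" using f(1,2) q(2) by auto
  have qd: "int q dvd 2 * a - b" using q(2) f(4) dvd_trans by blast
  define e where "e = (q\<^sup>2 - 1) div 3"
  have e: "int e = ((int q)\<^sup>2 - 1) div 3"
    unfolding e_def by (rule int_third_square) (use q in \<open>simp add: prime_gt_0_nat\<close>)
  have "acong (int q) (om (L (int q) + i * int e)) (om 0)"
    using acong_trans[OF acong_sym[OF reciprocity[OF q(1) q3(1) not_dvd_N[OF q f(3)]]]]
      acong_power_norm_eis_double[OF q(1) q3 N_def cop qd] unfolding e_def zeta_0 by blast
  hence "[L (int q) + i * int e = 0] (mod 3)"
    using acong_om_iff[of "int q"] q(1) by (simp del: zeta_0)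
  hence "[(L (int q) + i * int e) - i * int e = 0 - i * int e] (mod 3)"
    by (intro cong_diff cong_refl)
  thus "[L (int q) = - i * (((int q)\<^sup>2 - 1) div 3)] (mod 3)"
    unfolding e[symmetric] by simp
qed

text \<open>A supplementary law: (a + b)^2 = 3 a b modulo N gives 2 L (a + b) = L 3 + L a + L b, and
  a = - b w with w the image of \<omega> gives L a = L b + (N - 1) / 3. The left side is the
  exponent of 3 b^2, the combination met in the norm equations.\<close>

lemma L_3: "[L 3 + 2 * L b = i * (((a + b)\<^sup>2 - 1) div 3) + a * b] (mod 3)"
proof -
  define S where "S = ((a + b)\<^sup>2 - 1) div 3"
  define V where "V = (N - 1) div 3"
  have SV: "S = V + a * b"
    using s_square s_square_mod_3 N_mod_3 unfolding S_def V_def by (simp add: algebra_simps)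
  have c: "coprime a N" "coprime b N" using coprime_norm_form[OF cop] by (simp_all add: N_def)
  have c3: "coprime 3 N"
    using N_mod_3 prime_imp_coprime[of "3::int" N] by (auto simp: dvd_eq_mod_eq_0)
  obtain b' where "[b * b' = 1] (mod N)" using cong_solve_coprime_int[OF c(2)] by blast
  hence "[b * b' * (- a) = 1 * (- a)] (mod N)" by (intro cong_mult cong_refl)
  hence bw: "[b * (b' * (- a)) = - a] (mod N)" by (simp add: mult_ac)
  define w where "w = b' * (- a)"
  have "N dvd a + b * w" using bw unfolding w_def cong_iff_dvd_diff by (simp add: add.commute)
  hence Lw: "[L w = V] (mod 3)" unfolding V_def by (rule L_root)
  have cw: "coprime (b * w) N" using c(1) bw unfolding w_def
    by (metis cong_imp_coprime cong_sym coprime_minus_left_iff)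
  hence cw': "coprime w N" by simp
  have "[L (- a) = L a] (mod 3)" by (rule L_minus[OF c(1)])
  moreover have "[L (b * w) = L (- a)] (mod 3)" by (rule L_cong[OF cw]) (use bw in \<open>simp add: w_def\<close>)
  moreover have "[L (b * w) = L b + L w] (mod 3)" by (rule L_mult[OF c(2) cw'])
  ultimately have La: "[L a = L b + V] (mod 3)" using Lw
    unfolding cong_iff_dvd_diff by presburger
  have "[L ((a + b)\<^sup>2) = L (3 * (a * b))] (mod 3)"
  proof (rule L_cong)
    show "coprime ((a + b)\<^sup>2) N" using coprime_s_N by simp
    show "[(a + b)\<^sup>2 = 3 * (a * b)] (mod N)" unfolding s_square by (simp add: cong_iff_dvd_diff)
  qed
  moreover have "[L ((a + b)\<^sup>2) = int 2 * L (a + b)] (mod 3)" by (rule L_power[OF coprime_s_N])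
  moreover have "[L (3 * (a * b)) = L 3 + L (a * b)] (mod 3)" by (rule L_mult) (use c c3 in auto)
  moreover have "[L (a * b) = L a + L b] (mod 3)" by (rule L_mult[OF c])
  ultimately have "[L 3 + 2 * L b = 2 * L (a + b) - V] (mod 3)" using La
    unfolding cong_iff_dvd_diff by presburger
  also have "[2 * L (a + b) - V = 2 * ((2 - i) * S) - V] (mod 3)"
    unfolding S_def by (intro cong_diff cong_mult L_s cong_refl)
  also have "2 * ((2 - i) * S) - V = (i * S + a * b) + 3 * (S - i * S)"
    unfolding SV by (simp add: algebra_simps)
  also have "[\<dots> = i * S + a * b] (mod 3)" unfolding cong_def by (rule mod_mult_self2)
  finally show ?thesis by (simp add: S_def)
qed

text \<open>The coordinates of \<delta> = \<epsilon> \<omega>^i modulo 3 are compared, with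
  \<omega>^2 = -1 - \<omega>. In each case 3 divides (i + 1) a b, the term that survives in the
  later computations.\<close>

lemma i_cases:
  obtains "[i = 0] (mod 3)" "3 dvd b"
  | "[i = 1] (mod 3)" "3 dvd a" "\<not> 3 dvd b"
  | "[i = 2] (mod 3)" "[a * b = 1] (mod 3)" "\<not> 3 dvd b"
proof -
  have p3: "prime (3::int)" by simp
  have ic: "[i = 0] (mod 3) \<or> [i = 1] (mod 3) \<or> [i = 2] (mod 3)"
    unfolding cong_def by auto
  have sc: "of_int \<epsilon> * eis c d = eis (\<epsilon> * c) (\<epsilon> * d)" for c d
    by (simp add: eis_def algebra_simps)
  have e3: "\<not> 3 dvd \<epsilon>" "\<epsilon> * \<epsilon> = 1" using eps by auto
  from ic show thesis
  proof (elim disjE)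
    assume 0: "[i = 0] (mod 3)"
    hence "om i = eis 1 0" unfolding om_eis(1)[symmetric] om_eq_iff .
    hence "[b = 0] (mod 3)" using residue_3 unfolding sc acong_eis_iff[OF p3]
      by (simp add: sc acong_eis_iff[OF p3])
    thus thesis using that(1) 0 by (simp add: cong_0_iff)
  next
    assume 1: "[i = 1] (mod 3)"
    hence "om i = eis 0 1" unfolding om_eis(2)[symmetric] om_eq_iff .
    hence "[a = 0] (mod 3)" "[b = \<epsilon>] (mod 3)" using residue_3
      by (simp_all add: sc acong_eis_iff[OF p3])
    thus thesis using that(2) 1 e3(1) cong_dvd_iff[of b \<epsilon> 3] by (simp add: cong_0_iff)
  next
    assume 2: "[i = 2] (mod 3)"
    hence "om i = eis (- 1) (- 1)" unfolding om_eis(3)[symmetric] om_eq_iff .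
    hence *: "[a = - \<epsilon>] (mod 3)" "[b = - \<epsilon>] (mod 3)" using residue_3
      by (simp_all add: sc acong_eis_iff[OF p3])
    have "[a * b = (- \<epsilon>) * (- \<epsilon>)] (mod 3)" by (intro cong_mult *)
    moreover have "\<not> 3 dvd b" using *(2) e3(1) cong_dvd_iff[of b "- \<epsilon>" 3] by simp
    ultimately show thesis using that(3) 2 e3(2) by simp
  qed
qed

end

section \<open>Two norm equations\<close>

lemma cong_intE:
  fixes x y m :: int
  assumes "[x = y] (mod m)"
  obtains k where "x = y + m * k"
  using assms by (metis cong_iff_lin cong_sym)

lemma coprime_intI_prime:
  fixes x y :: int
  assumes "\<And>p. prime p \<Longrightarrow> p dvd x \<Longrightarrow> p dvd y \<Longrightarrow> False"
  shows "coprime x y"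
proof (rule ccontr)
  assume "\<not> coprime x y"
  hence g: "\<not> is_unit (gcd x y)" by (simp add: coprime_iff_gcd_eq_1 is_unit_gcd_iff)
  show False
  proof (cases "gcd x y = 0")
    case True
    hence "x = 0" "y = 0" by auto
    thus False using assms[of 2] by auto
  next
    case False
    with g obtain p where "prime p" "p dvd gcd x y" using prime_divisor_exists by blast
    thus False using assms[of p] by auto
  qed
qed

text \<open>The bases 4 and -5 agree modulo 9 with 1 + 3, so their powers modulo 9 reveal the
  exponent modulo 3. In this way the exponent enters a second time, besides the symbol of q.\<close>

lemma four_power_expand: "\<exists>k::int. 4 ^ h = 1 + 3 * int h + 9 * k"
proof (induction h)
  case (Suc h)
  then obtain k :: int where k: "4 ^ h = 1 + 3 * int h + 9 * k" by blast
  have "(4::int) ^ Suc h = 1 + 3 * int (Suc h) + 9 * (int h + 4 * k)" by (simp add: k)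
  thus ?case by blast
qed simp

lemma minus_five_power_expand: "\<exists>k::int. (- 5) ^ h = 1 + 3 * int h + 9 * k"
proof (induction h)
  case (Suc h)
  then obtain k :: int where k: "(- 5) ^ h = 1 + 3 * int h + 9 * k" by blast
  have "(- 5::int) ^ Suc h = 1 + 3 * int (Suc h) + 9 * (- 1 - 2 * int h - 5 * k)" by (simp add: k)
  thus ?case by blast
qed simp

text \<open>The number \<delta> = (f x + Y sqrt(-3)) / 2 has norm 2^n f^2 - 3 m^3 Y^2. Its symbol
  gives n L 2 + 2 L f = L 3 + 2 L b modulo 3; the same equation modulo 9, where m^3 vanishes,
  expresses (a + b)^2 by n. Together they show that 3 divides n (L 2 + i), and reciprocity at 2
  excludes the second factor.\<close>

lemma exponent_of_two_dvd_3:
  fixes m x Y f D :: int and n :: nat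
  assumes m: "3 dvd m" "odd m" and D: "f\<^sup>2 * D = 3 * (4 * m ^ 3 + 1)" and cYf: "coprime Y f"
    and eq: "x\<^sup>2 + D * Y\<^sup>2 = 4 * 2 ^ n" and par: "odd x" "odd Y" and n: "n \<ge> 1"
  shows "3 dvd n"
proof -
  have D_odd: "odd (f\<^sup>2 * D)" unfolding D by simp
  hence f_odd: "odd f" by simp
  obtain m' where m': "m = 3 * m'" using m(1) by blast
  have f3: "\<not> 3 dvd f"
  proof
    assume "3 dvd f"
    then obtain f' where "f = 3 * f'" by blast
    hence "3 * (3 * (f'\<^sup>2 * D)) = 3 * (4 * m ^ 3 + 1)" unfolding D[symmetric] by (simp add: power2_eq_square)
    hence "3 * (f'\<^sup>2 * D) = 4 * m ^ 3 + 1" by (metis mult_cancel_left zero_neq_numeral)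
    hence "3 * (f'\<^sup>2 * D - 36 * m' ^ 3) = 1" by (simp add: m' power3_eq_cube algebra_simps)
    thus False by presburger
  qed
  have D3: "3 dvd D"
  proof -
    have "3 dvd f\<^sup>2 * D" unfolding D by simp
    thus ?thesis using f3 by (auto simp: prime_dvd_mult_iff prime_dvd_power_iff)
  qed
  have x3: "\<not> 3 dvd x"
  proof
    assume "3 dvd x"
    hence "3 dvd x\<^sup>2 + D * Y\<^sup>2" using D3 by (simp add: power2_eq_square)
    hence "3 dvd (4::int) * 2 ^ n" unfolding eq .
    hence "(3::int) dvd 4 \<or> (3::int) dvd 2 ^ n" using prime_dvd_mult_iff[of "3::int" 4 "2 ^ n"] by simp
    moreover have "\<not> (3::int) dvd 2 ^ n" using prime_dvd_power[of "3::int" 2 n] by auto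
    ultimately show False by auto
  qed
  have cmf: "coprime m f"
  proof (rule coprime_intI_prime)
    fix p assume p: "prime p" "p dvd m" "p dvd f"
    have "p dvd f\<^sup>2 * D - 3 * (4 * m ^ 3)" using p by (intro dvd_diff dvd_mult2 dvd_mult) (auto simp: power2_eq_square power3_eq_cube)
    hence "p dvd 3" unfolding D by simp
    hence "p = 3" using p(1) primes_dvd_imp_eq[of p 3] by auto
    thus False using p f3 by simp
  qed
  have cYx: "coprime Y x"
  proof (rule coprime_intI_prime)
    fix p assume p: "prime p" "p dvd Y" "p dvd x"
    have "p dvd x\<^sup>2 + D * Y\<^sup>2" using p by (auto simp: power2_eq_square)
    hence "p dvd 4 * 2 ^ n" unfolding eq .
    hence "p dvd 2 ^ (n + 2)" by (simp add: power_add mult.commute)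
    hence "p dvd 2" using p(1) prime_dvd_power by blast
    hence "p = 2" using p(1) primes_dvd_imp_eq[of p 2] by auto
    thus False using p par by simp
  qed
  have "even (f * x + Y)" using f_odd par by simp
  then obtain a where a: "f * x + Y = 2 * a" by blast
  define b where "b = Y"
  have ab: "2 * a - b = f * x" using a by (simp add: b_def)
  define N where "N = a\<^sup>2 - a * b + b\<^sup>2"
  have "4 * N = (2 * a - b)\<^sup>2 + 3 * b\<^sup>2" unfolding N_def by (simp add: power2_eq_square algebra_simps)
  also have "\<dots> = (f * x)\<^sup>2 + 3 * b\<^sup>2" by (simp only: ab)
  also have "\<dots> = f\<^sup>2 * (x\<^sup>2 + D * Y\<^sup>2) - f\<^sup>2 * D * b\<^sup>2 + 3 * b\<^sup>2"
    unfolding b_def by (simp add: power2_eq_square algebra_simps)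
  also have "\<dots> = 4 * (2 ^ n * f\<^sup>2 - 3 * m ^ 3 * b\<^sup>2)"
    unfolding eq D by (simp add: algebra_simps)
  finally have N: "N = 2 ^ n * f\<^sup>2 - 3 * m ^ 3 * b\<^sup>2" by simp
  have cab: "coprime a b"
  proof (rule coprime_intI_prime)
    fix p assume p: "prime p" "p dvd a" "p dvd b"
    have "p dvd 2 * a - b" using p by (intro dvd_diff dvd_mult)
    hence "p dvd f * x" unfolding ab .
    hence "p dvd f \<or> p dvd x" using p(1) by (simp add: prime_dvd_mult_iff)
    thus False using cYf cYx p unfolding b_def by (metis coprime_common_divisor not_prime_unit)
  qed
  have s3: "\<not> 3 dvd a + b"
  proof
    assume "3 dvd a + b"
    hence "3 dvd 2 * (a + b) - 3 * b" by (intro dvd_diff[OF dvd_mult dvd_triv_left])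
    moreover have "2 * (a + b) - 3 * b = f * x" using ab by simp
    ultimately have "3 dvd f * x" by (simp only:)
    thus False using f3 x3 by (simp add: prime_dvd_mult_iff)
  qed
  have N3: "\<not> 3 dvd a\<^sup>2 - a * b + b\<^sup>2"
    using square_mod_3[OF s3] norm_form_mod_3[of a b] by auto
  obtain L i \<epsilon> where sym: "cubic_symbol a b L i \<epsilon>" using cubic_symbol_exists[OF cab N3] by blast
  interpret eisenstein_symbol a b N L i \<epsilon>
    by unfold_locales (use cab s3 N_def sym in auto)
  have N_odd: "odd N" unfolding N b_def using n m par by simp
  have c2: "coprime 2 N" using N_odd by simp
  have c3: "coprime 3 N" using N3 prime_imp_coprime[of "3::int" N] unfolding N_def by simp
  have cb: "coprime b N" using coprime_norm_form[OF cab] unfolding N_def by simp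
  have cm: "coprime m N"
  proof (rule coprime_intI_prime)
    fix p assume p: "prime p" "p dvd m" "p dvd N"
    have "p dvd N + 3 * m ^ 3 * b\<^sup>2" using p by (simp add: power3_eq_cube)
    hence "p dvd 2 ^ n * f\<^sup>2" unfolding N by simp
    hence "p dvd 2 \<or> p dvd f" using p(1) prime_dvd_power by (auto simp: prime_dvd_mult_iff)
    moreover have "\<not> p dvd 2" using p m(2) primes_dvd_imp_eq[of p 2] by auto
    ultimately show False using cmf p by (metis coprime_common_divisor not_prime_unit)
  qed
  have cf: "coprime f N"
  proof (rule coprime_intI_prime)
    fix p assume p: "prime p" "p dvd f" "p dvd N"
    have "p dvd 2 ^ n * f\<^sup>2 - N" using p by (simp add: power2_eq_square)
    hence "p dvd 3 * (m ^ 3 * b\<^sup>2)" unfolding N by (simp add: mult.assoc)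
    hence "p dvd 3 \<or> p dvd m \<or> p dvd b" using p(1) prime_dvd_power by (metis prime_dvd_mult_iff)
    moreover have "\<not> p dvd 3" using p f3 primes_dvd_imp_eq[of p 3] by auto
    ultimately show False using cmf cYf p unfolding b_def by (metis coprime_common_divisor not_prime_unit)
  qed
  define S where "S = ((a + b)\<^sup>2 - 1) div 3"
  define F where "F = (f\<^sup>2 - 1) div 3"
  have S: "(a + b)\<^sup>2 = 1 + 3 * S" unfolding S_def by (rule square_eq_third[OF s3])
  have F: "f\<^sup>2 = 1 + 3 * F" unfolding F_def by (rule square_eq_third[OF f3])
  have Lf: "[L f = - i * F] (mod 3)" unfolding F_def by (rule L_f) (use f_odd f3 cf ab in auto)
  have L3: "[L 3 + 2 * L b = i * S + a * b] (mod 3)" unfolding S_def by (rule L_3)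
  define nL where "nL = int n * L 2"
  have "[L (2 ^ n * f\<^sup>2) = L (2 ^ n) + L (f\<^sup>2)] (mod 3)" by (rule L_mult) (use c2 cf in auto)
  moreover have "[L (2 ^ n) = nL] (mod 3)" unfolding nL_def by (rule L_power[OF c2])
  moreover have "[L (f\<^sup>2) = int 2 * L f] (mod 3)" by (rule L_power[OF cf])
  moreover have "[L (3 * (m ^ 3 * b\<^sup>2)) = L 3 + L (m ^ 3 * b\<^sup>2)] (mod 3)" by (rule L_mult) (use c3 cm cb in auto)
  moreover have "[L (m ^ 3 * b\<^sup>2) = L (m ^ 3) + L (b\<^sup>2)] (mod 3)" by (rule L_mult) (use cm cb in auto)
  moreover have "[L (m ^ 3) = int 3 * L m] (mod 3)" by (rule L_power[OF cm])
  moreover have "[L (b\<^sup>2) = int 2 * L b] (mod 3)" by (rule L_power[OF cb])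
  moreover have "[L (2 ^ n * f\<^sup>2) = L (3 * (m ^ 3 * b\<^sup>2))] (mod 3)"
    by (rule L_cong) (use c2 cf in \<open>auto simp: cong_iff_dvd_diff N mult.assoc\<close>)
  ultimately have "[nL + 2 * L f = L 3 + 2 * L b] (mod 3)"
    unfolding cong_iff_dvd_diff by presburger
  then obtain k1 where k1: "int n * L 2 + 2 * L f = L 3 + 2 * L b + 3 * k1"
    unfolding nL_def by (rule cong_intE)
  obtain k2 where k2: "L f = - i * F + 3 * k2" by (rule cong_intE[OF Lf])
  obtain k3 where k3: "L 3 + 2 * L b = i * S + a * b + 3 * k3" by (rule cong_intE[OF L3])
  \<comment> \<open>As N and f^2 are 1 modulo 3, so is 2^n. Hence n = 2 h is even and 2^n = 4^h is
    known modulo 9.\<close>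
  have "2 ^ n mod (3::int) = 1"
  proof -
    have "N mod 3 = 1" by (rule N_mod_3)
    moreover have "N = 2 ^ n + 3 * (2 ^ n * F - m ^ 3 * b\<^sup>2)" unfolding N F by (simp add: algebra_simps)
    ultimately show ?thesis by (metis mod_mult_self2)
  qed
  hence "even n"
  proof (rule_tac ccontr)
    assume "2 ^ n mod (3::int) = 1" "odd n"
    then obtain h where "n = 2 * h + 1" by (auto elim: oddE)
    moreover obtain k :: int where "4 ^ h = 1 + 3 * int h + 9 * k" using four_power_expand by blast
    moreover have "(2::int) ^ (2 * h + 1) = 2 * 4 ^ h" by (simp add: power_mult)
    ultimately have "(2::int) ^ n = 2 + 3 * (2 * int h + 6 * k)" by simp
    hence "2 ^ n mod (3::int) = 2" by (simp only: mod_mult_self2) simp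
    thus False using \<open>2 ^ n mod (3::int) = 1\<close> by simp
  qed
  then obtain h where h: "n = 2 * h" by blast
  obtain k where "(4::int) ^ h = 1 + 3 * int h + 9 * k" using four_power_expand by blast
  hence pow: "(2::int) ^ n = 1 + 3 * int h + 9 * k" unfolding h by (simp add: power_mult)
  have "3 * (S - F) = (a + b)\<^sup>2 - f\<^sup>2" unfolding S F by simp
  also have "\<dots> = 3 * ((int h + 3 * k) * f\<^sup>2 + a * b - m ^ 3 * b\<^sup>2)"
    unfolding s_square N pow by (simp add: algebra_simps)
  finally have "S - F = (int h + 3 * k) * f\<^sup>2 + a * b - m ^ 3 * b\<^sup>2" by simp
  also have "\<dots> = int h + a * b + 3 * (int h * F + k * f\<^sup>2 - 9 * m' ^ 3 * b\<^sup>2)"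
    unfolding F m' by (simp add: power3_eq_cube algebra_simps)
  finally have k4: "S = F + int h + a * b + 3 * (int h * F + k * f\<^sup>2 - 9 * m' ^ 3 * b\<^sup>2)"
    (is "_ = _ + 3 * ?k4") by simp
  \<comment> \<open>Since n = 2 h, the added term n i is 2 i h, which completes the i h coming from
    i S to a multiple of 3.\<close>
  have "int n * (L 2 + i) = (i + 1) * (a * b) + 3 * (k1 - 2 * k2 + k3 + i * int h + i * ?k4 + i * F)"
  proof -
    have "int n * (L 2 + i) = int n * L 2 + 2 * int h * i" unfolding h by (simp add: algebra_simps)
    also have "int n * L 2 = i * S + a * b + 3 * k3 + 3 * k1 - 2 * (- i * F + 3 * k2)"
      using k1 unfolding k2 k3 by simp
    finally show ?thesis unfolding k4 by (simp add: algebra_simps)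
  qed
  moreover have "3 dvd (i + 1) * (a * b)"
  proof (rule i_cases)
    assume "[i = 2] (mod 3)"
    hence "3 dvd i + 1" unfolding cong_iff_dvd_diff by presburger
    thus ?thesis by simp
  qed auto
  ultimately have "3 dvd int n * (L 2 + i)" by simp
  hence "3 dvd int n \<or> 3 dvd L 2 + i" by (simp add: prime_dvd_mult_iff)
  \<comment> \<open>For q = 2 the exponent (q^2 - 1) / 3 is 1, so reciprocity reads N \<delta> =
    \<omega>^(L 2 + i) modulo 2. This is not 1, because the second coordinate N Y is odd.\<close>
  moreover have "\<not> 3 dvd L 2 + i"
  proof
    assume "3 dvd L 2 + i"
    hence "om (L 2 + i) = om 0" unfolding om_eq_iff by (simp add: cong_0_iff)
    hence 1: "om (L 2 + i) = eis 1 0" by (simp add: eis_def)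
    have "acong (int 2) ((of_int N * eis a b) ^ ((2\<^sup>2 - 1) div 3)) (om (L (int 2) + i * int ((2\<^sup>2 - 1) div 3)))"
      by (rule reciprocity) (use N_odd in auto)
    hence "acong 2 (of_int N * eis a b) (eis 1 0)" using 1 by simp
    moreover have "of_int N * eis a b = eis (N * a) (N * b)" by (simp add: eis_def algebra_simps)
    ultimately have "acong 2 (eis (N * a) (N * b)) (eis 1 0)" by simp
    hence "[N * b = 0] (mod 2)" by (subst (asm) acong_eis_iff) auto
    thus False using N_odd par unfolding b_def cong_0_iff by simp
  qed
  ultimately have "3 dvd int n" by blast
  thus ?thesis by presburger
qed

text \<open>Now \<delta> = f x + Y sqrt(-3) has norm \<eta> 5^n f^2 + 6 M^3 Y^2. The additional
  symbol of 2, from the factor 6 and from b = 2 Y, is given by reciprocity at 2. The residue of M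
  modulo 3 evaluates M^3 modulo 9; its residue modulo 5 determines \<delta> modulo 5 up to an
  integer factor.\<close>

lemma exponent_of_five_dvd_3:
  fixes M x Y f D \<eta> :: int and n :: nat
  assumes M: "[M = 4] (mod 15)" "odd M" and D: "f\<^sup>2 * D = 3 * (2 * M ^ 3 - 1)" and cYf: "coprime Y f"
    and eq: "x\<^sup>2 - D * Y\<^sup>2 = \<eta> * 5 ^ n" and \<eta>: "\<eta> = 1 \<or> \<eta> = - 1"
    and prim: "\<not> (5 dvd x \<and> 5 dvd Y)" and n: "n \<ge> 1"
  shows "3 dvd n"
proof -
  have D_odd: "odd (f\<^sup>2 * D)" unfolding D by simp
  hence f_odd: "odd f" "odd D" by simp_all
  have M3: "[M = 1] (mod 3)" and M5: "[M = - 1] (mod 5)"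
    using M(1) unfolding cong_iff_dvd_diff by presburger+
  obtain m' where m': "M = 1 + 3 * m'" by (rule cong_intE[OF M3])
  have M33: "M ^ 3 = 1 + 9 * (m' + 3 * m'\<^sup>2 + 3 * m' ^ 3)"
    unfolding m' by (simp add: power2_eq_square power3_eq_cube algebra_simps)
  have f3: "\<not> 3 dvd f"
  proof
    assume "3 dvd f"
    then obtain f' where "f = 3 * f'" by blast
    hence "3 * (3 * (f'\<^sup>2 * D)) = 3 * (2 * M ^ 3 - 1)" unfolding D[symmetric] by (simp add: power2_eq_square)
    hence "3 * (f'\<^sup>2 * D) = 2 * M ^ 3 - 1" by (metis mult_cancel_left zero_neq_numeral)
    hence "3 * (f'\<^sup>2 * D - 6 * (m' + 3 * m'\<^sup>2 + 3 * m' ^ 3)) = 1" unfolding M33 by (simp add: algebra_simps)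
    thus False by presburger
  qed
  have D3: "3 dvd D"
  proof -
    have "3 dvd f\<^sup>2 * D" unfolding D by simp
    thus ?thesis using f3 by (auto simp: prime_dvd_mult_iff prime_dvd_power_iff)
  qed
  have x3: "\<not> 3 dvd x"
  proof
    assume "3 dvd x"
    hence "3 dvd x\<^sup>2 - D * Y\<^sup>2" using D3 by (simp add: power2_eq_square)
    hence "3 dvd \<eta> * 5 ^ n" unfolding eq .
    hence "3 dvd (5::int) ^ n" using \<eta> by auto
    thus False using prime_dvd_power[of "3::int" 5 n] by auto
  qed
  have cMf: "coprime M f"
  proof (rule coprime_intI_prime)
    fix p assume p: "prime p" "p dvd M" "p dvd f"
    have "p dvd 3 * (2 * M ^ 3) - f\<^sup>2 * D" using p by (intro dvd_diff dvd_mult2 dvd_mult) (auto simp: power2_eq_square power3_eq_cube)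
    hence "p dvd 3" unfolding D by simp
    hence "p = 3" using p(1) primes_dvd_imp_eq[of p 3] by auto
    thus False using p f3 by simp
  qed
  have cYx: "coprime Y x"
  proof (rule coprime_intI_prime)
    fix p assume p: "prime p" "p dvd Y" "p dvd x"
    have "p dvd x\<^sup>2 - D * Y\<^sup>2" using p by (auto simp: power2_eq_square)
    hence "p dvd \<eta> * 5 ^ n" unfolding eq .
    hence "p dvd 5 ^ n" using \<eta> by auto
    hence "p dvd 5" using p(1) prime_dvd_power by blast
    hence "p = 5" using p(1) primes_dvd_imp_eq[of p 5] by auto
    thus False using p prim by simp
  qed
  define a where "a = f * x + Y"
  define b where "b = 2 * Y"
  have ab: "2 * a - b = f * (2 * x)" by (simp add: a_def b_def)
  define N where "N = a\<^sup>2 - a * b + b\<^sup>2"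
  have Nxy: "N = (f * x)\<^sup>2 + 3 * Y\<^sup>2"
    unfolding N_def a_def b_def by (simp add: power2_eq_square algebra_simps)
  also have "\<dots> = f\<^sup>2 * (x\<^sup>2 - D * Y\<^sup>2) + f\<^sup>2 * D * Y\<^sup>2 + 3 * Y\<^sup>2"
    by (simp add: power2_eq_square algebra_simps)
  also have "\<dots> = \<eta> * 5 ^ n * f\<^sup>2 + 6 * M ^ 3 * Y\<^sup>2"
    unfolding eq D by (simp add: algebra_simps)
  finally have N: "N = \<eta> * 5 ^ n * f\<^sup>2 + 6 * M ^ 3 * Y\<^sup>2" .
  have "odd (x\<^sup>2 - D * Y\<^sup>2)" unfolding eq using \<eta> by auto
  hence a_odd: "odd a" unfolding a_def using f_odd by simp
  have N_odd: "odd N" unfolding N_def using a_odd by (simp add: b_def)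
  have cab: "coprime a b"
  proof (rule coprime_intI_prime)
    fix p assume p: "prime p" "p dvd a" "p dvd b"
    have "p \<noteq> 2" using p a_odd by auto
    hence "\<not> p dvd 2" using p(1) primes_dvd_imp_eq[of p 2] by auto
    hence pY: "p dvd Y" using p unfolding b_def by (simp add: prime_dvd_mult_iff)
    hence "p dvd a - Y" using p by simp
    hence "p dvd f * x" unfolding a_def by simp
    hence "p dvd f \<or> p dvd x" using p(1) by (simp add: prime_dvd_mult_iff)
    thus False using cYf cYx p pY by (metis coprime_common_divisor not_prime_unit)
  qed
  have s3: "\<not> 3 dvd a + b"
  proof
    assume "3 dvd a + b"
    hence "3 dvd (a + b) - 3 * Y" by (intro dvd_diff) auto
    moreover have "(a + b) - 3 * Y = f * x" by (simp add: a_def b_def)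
    ultimately have "3 dvd f * x" by (simp only:)
    thus False using f3 x3 by (simp add: prime_dvd_mult_iff)
  qed
  have N3: "\<not> 3 dvd a\<^sup>2 - a * b + b\<^sup>2"
    using square_mod_3[OF s3] norm_form_mod_3[of a b] by auto
  obtain L i \<epsilon> where sym: "cubic_symbol a b L i \<epsilon>" using cubic_symbol_exists[OF cab N3] by blast
  interpret eisenstein_symbol a b N L i \<epsilon>
    by unfold_locales (use cab s3 N_def sym in auto)
  have fx_Y: "[(f * x)\<^sup>2 = Y\<^sup>2] (mod 5)"
  proof -
    have "(f * x)\<^sup>2 - Y\<^sup>2 = \<eta> * 5 ^ n * f\<^sup>2 + 6 * M ^ 3 * Y\<^sup>2 - 4 * Y\<^sup>2"
      using N Nxy by simp
    also have "[\<dots> = \<eta> * 0 * f\<^sup>2 + 6 * (- 1) ^ 3 * Y\<^sup>2 - 4 * Y\<^sup>2] (mod 5)"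
      by (intro cong_add cong_diff cong_mult cong_pow M5 cong_refl) (use n in \<open>auto simp: cong_0_iff\<close>)
    also have "\<eta> * 0 * f\<^sup>2 + 6 * (- 1) ^ 3 * Y\<^sup>2 - 4 * Y\<^sup>2 = 5 * (- 2 * Y\<^sup>2)" by simp
    also have "[5 * (- 2 * Y\<^sup>2) = 0] (mod 5)" by (simp only: cong_0_iff dvd_triv_left)
    finally have "[(f * x)\<^sup>2 - Y\<^sup>2 = 0] (mod 5)" .
    thus ?thesis by (simp add: cong_iff_dvd_diff)
  qed
  have Y5: "\<not> 5 dvd Y"
  proof
    assume Y: "5 dvd Y"
    hence "5 dvd Y\<^sup>2" by (simp add: power2_eq_square)
    hence "5 dvd (f * x)\<^sup>2" using fx_Y cong_dvd_iff by blast
    hence "5 dvd f * x" by (rule prime_dvd_power[rotated]) simp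
    hence "5 dvd f \<or> 5 dvd x" by (simp add: prime_dvd_mult_iff)
    moreover have "\<not> 5 dvd f" using cYf Y using coprime_common_divisor[of Y f 5] by auto
    ultimately show False using prim Y by blast
  qed
  have N_mod_5: "[N = 4 * Y\<^sup>2] (mod 5)"
  proof -
    have "[N = Y\<^sup>2 + 3 * Y\<^sup>2] (mod 5)" unfolding Nxy by (intro cong_add cong_refl fx_Y)
    thus ?thesis by simp
  qed
  have N5: "\<not> 5 dvd N"
  proof
    assume "5 dvd N"
    hence "5 dvd 4 * Y\<^sup>2" using N_mod_5 cong_dvd_iff by blast
    hence "(5::int) dvd 4 \<or> 5 dvd Y\<^sup>2" using prime_dvd_mult_iff[of "5::int" 4 "Y\<^sup>2"] by simp
    thus False using Y5 prime_dvd_power[of "5::int" Y 2] by auto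
  qed
  have c2: "coprime 2 N" using N_odd by simp
  have c3: "coprime 3 N" using N3 prime_imp_coprime[of "3::int" N] unfolding N_def by simp
  have c5: "coprime 5 N" using N5 prime_imp_coprime[of "5::int" N] by simp
  have cb: "coprime b N" using coprime_norm_form[OF cab] unfolding N_def by simp
  have cY: "coprime Y N" using cb unfolding b_def by simp
  have cM: "coprime M N"
  proof (rule coprime_intI_prime)
    fix p assume p: "prime p" "p dvd M" "p dvd N"
    have "p dvd N - 6 * M ^ 3 * Y\<^sup>2" using p by (simp add: power3_eq_cube)
    hence "p dvd \<eta> * (5 ^ n * f\<^sup>2)" unfolding N by (simp add: mult.assoc)
    hence "p dvd 5 ^ n * f\<^sup>2" using \<eta> by auto
    hence "p dvd 5 \<or> p dvd f" using p(1) prime_dvd_power by (metis prime_dvd_mult_iff)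
    moreover have "\<not> p dvd 5"
    proof
      assume "p dvd 5"
      hence "p = 5" using p(1) primes_dvd_imp_eq[of p 5] by auto
      hence "5 dvd M" using p by simp
      thus False using M5 unfolding cong_iff_dvd_diff by presburger
    qed
    ultimately show False using cMf p by (metis coprime_common_divisor not_prime_unit)
  qed
  have cf: "coprime f N"
  proof (rule coprime_intI_prime)
    fix p assume p: "prime p" "p dvd f" "p dvd N"
    have "p dvd N - \<eta> * 5 ^ n * f\<^sup>2" using p by (simp add: power2_eq_square)
    hence "p dvd 6 * (M ^ 3 * Y\<^sup>2)" unfolding N by (simp add: mult.assoc)
    hence "p dvd 2 * (3 * (M ^ 3 * Y\<^sup>2))" by simp
    hence "p dvd 2 \<or> p dvd 3 \<or> p dvd M \<or> p dvd Y" using p(1) prime_dvd_power by (metis prime_dvd_mult_iff)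
    moreover have "\<not> p dvd 3" using p f3 primes_dvd_imp_eq[of p 3] by auto
    moreover have "\<not> p dvd 2" using p f_odd primes_dvd_imp_eq[of p 2] by auto
    ultimately show False using cMf cYf p by (metis coprime_common_divisor not_prime_unit)
  qed
  define S where "S = ((a + b)\<^sup>2 - 1) div 3"
  define F where "F = (f\<^sup>2 - 1) div 3"
  have S: "(a + b)\<^sup>2 = 1 + 3 * S" unfolding S_def by (rule square_eq_third[OF s3])
  have F: "f\<^sup>2 = 1 + 3 * F" unfolding F_def by (rule square_eq_third[OF f3])
  have Lf: "[L f = - i * F] (mod 3)" unfolding F_def by (rule L_f) (use f_odd f3 cf ab in auto)
  have L3: "[L 3 + 2 * L b = i * S + a * b] (mod 3)" unfolding S_def by (rule L_3)
  \<comment> \<open>Here b is even while a and N are odd, so N \<delta> is 1 modulo 2, and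
    reciprocity at 2 has exponent 1.\<close>
  have L2: "[L 2 = - i] (mod 3)"
  proof -
    have "acong (int 2) ((of_int N * eis a b) ^ ((2\<^sup>2 - 1) div 3)) (om (L (int 2) + i * int ((2\<^sup>2 - 1) div 3)))"
      by (rule reciprocity) (use N_odd in auto)
    hence 1: "acong 2 (of_int N * eis a b) (om (L 2 + i))" by simp
    have "of_int N * eis a b = eis (N * a) (N * b)" by (simp add: eis_def algebra_simps)
    moreover have "acong 2 (eis (N * a) (N * b)) (eis 1 0)"
    proof (subst acong_eis_iff)
      show "[N * a = 1] (mod 2) \<and> [N * b = 0] (mod 2)"
        using N_odd a_odd by (auto simp: cong_iff_dvd_diff b_def)
    qed simp
    moreover have "eis 1 0 = om 0" by (simp add: eis_def)
    ultimately have "acong 2 (om (L 2 + i)) (om 0)" using acong_trans[OF acong_sym[OF 1]] by simp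
    hence "[L 2 + i = 0] (mod 3)" by (subst (asm) acong_om_iff) auto
    thus ?thesis unfolding cong_iff_dvd_diff by simp
  qed
  define nL where "nL = int n * L 5"
  define P where "P = 5 ^ n * f\<^sup>2"
  define Q where "Q = 2 * (3 * (M ^ 3 * Y\<^sup>2))"
  have cP: "coprime P N" using c5 cf by (simp add: P_def)
  have cQ3: "coprime (M ^ 3 * Y\<^sup>2) N" using cM cY by simp
  hence cQ2: "coprime (3 * (M ^ 3 * Y\<^sup>2)) N" using c3 by (simp only: coprime_mult_left_iff)
  hence cQ: "coprime Q N" unfolding Q_def using c2 by (simp only: coprime_mult_left_iff)
  have "[L P = L (5 ^ n) + L (f\<^sup>2)] (mod 3)" unfolding P_def by (rule L_mult) (use c5 cf in auto)
  moreover have "[L (5 ^ n) = nL] (mod 3)" unfolding nL_def by (rule L_power[OF c5])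
  moreover have "[L (f\<^sup>2) = int 2 * L f] (mod 3)" by (rule L_power[OF cf])
  ultimately have LP: "[L P = nL + 2 * L f] (mod 3)" using cong_trans cong_add by fastforce
  have "[L (M ^ 3 * Y\<^sup>2) = L (M ^ 3) + L (Y\<^sup>2)] (mod 3)" by (rule L_mult) (use cM cY in auto)
  also have "[L (M ^ 3) + L (Y\<^sup>2) = int 3 * L M + int 2 * L Y] (mod 3)"
    by (intro cong_add L_power cM cY)
  also have "[int 3 * L M + int 2 * L Y = 2 * L Y] (mod 3)" by (simp add: cong_def)
  finally have 1: "[L (M ^ 3 * Y\<^sup>2) = 2 * L Y] (mod 3)" .
  have "[L (3 * (M ^ 3 * Y\<^sup>2)) = L 3 + L (M ^ 3 * Y\<^sup>2)] (mod 3)" by (rule L_mult[OF c3 cQ3])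
  also have "[L 3 + L (M ^ 3 * Y\<^sup>2) = L 3 + 2 * L Y] (mod 3)" by (intro cong_add cong_refl 1)
  finally have 2: "[L (3 * (M ^ 3 * Y\<^sup>2)) = L 3 + 2 * L Y] (mod 3)" .
  have "[L Q = L 2 + L (3 * (M ^ 3 * Y\<^sup>2))] (mod 3)" unfolding Q_def by (rule L_mult[OF c2 cQ2])
  also have "[L 2 + L (3 * (M ^ 3 * Y\<^sup>2)) = L 2 + (L 3 + 2 * L Y)] (mod 3)" by (intro cong_add cong_refl 2)
  finally have LQ: "[L Q = L 2 + (L 3 + 2 * L Y)] (mod 3)" .
  have "[nL + 2 * L f = L P] (mod 3)" by (rule cong_sym[OF LP])
  also have "[L P = L (\<eta> * P)] (mod 3)" using \<eta> cong_sym[OF L_minus[OF cP]] by auto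
  also have "[L (\<eta> * P) = L (- Q)] (mod 3)"
  proof (rule L_cong)
    show "coprime (\<eta> * P) N" using cP \<eta> by auto
    have "\<eta> * P - (- Q) = N" unfolding N P_def Q_def by (simp add: algebra_simps)
    thus "[\<eta> * P = - Q] (mod N)" by (simp only: cong_iff_dvd_diff dvd_refl)
  qed
  also have "[L (- Q) = L Q] (mod 3)" by (rule L_minus[OF cQ])
  also note LQ
  also have "L 2 + (L 3 + 2 * L Y) = (L 3 + 2 * (L 2 + L Y)) - L 2" by simp
  also have "[\<dots> = (L 3 + 2 * L b) - L 2] (mod 3)"
    unfolding b_def by (intro cong_add cong_diff cong_mult cong_refl cong_sym[OF L_mult] c2 cY)
  finally have "[nL + 2 * L f = (L 3 + 2 * L b) - L 2] (mod 3)" .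
  then obtain k1 where k1: "int n * L 5 + 2 * L f = (L 3 + 2 * L b) - L 2 + 3 * k1"
    unfolding nL_def by (rule cong_intE)
  obtain k2 where k2: "L f = - i * F + 3 * k2" by (rule cong_intE[OF Lf])
  obtain k3 where k3: "L 3 + 2 * L b = i * S + a * b + 3 * k3" by (rule cong_intE[OF L3])
  obtain k5 where k5: "L 2 = - i + 3 * k5" by (rule cong_intE[OF L2])
  obtain k where k: "(- 5::int) ^ n = 1 + 3 * int n + 9 * k" using minus_five_power_expand by blast
  \<comment> \<open>The two sides agree up to sign and are both 1 modulo 3, because N is. So the
    sign of the norm is forced to be (-1)^n.\<close>
  have pow: "\<eta> * 5 ^ n = (- 5) ^ n"
  proof -
    have pm: "(5::int) ^ n = (- 5) ^ n \<or> (5::int) ^ n = - ((- 5) ^ n)"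
      by (cases "even n") auto
    hence c: "\<eta> * 5 ^ n = (- 5) ^ n \<or> \<eta> * 5 ^ n = - ((- 5) ^ n)" using \<eta> by auto
    have "\<eta> * 5 ^ n = N - 3 * (\<eta> * 5 ^ n * F + 2 * M ^ 3 * Y\<^sup>2)"
      unfolding N F by (simp add: algebra_simps)
    hence t: "(\<eta> * 5 ^ n) mod 3 = 1" using N_mod_3 by (metis mod_diff_right_eq mod_mult_self1_is_0 diff_zero)
    have "\<eta> * 5 ^ n \<noteq> - ((- 5) ^ n)"
    proof
      assume "\<eta> * 5 ^ n = - ((- 5) ^ n)"
      hence "\<eta> * 5 ^ n = 2 + 3 * (- 1 - int n - 3 * k)" unfolding k by simp
      hence "(\<eta> * 5 ^ n) mod 3 = 2 mod 3" by (simp only: mod_mult_self2)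
      thus False using t by simp
    qed
    thus ?thesis using c by blast
  qed
  have "3 * (S - F) = (a + b)\<^sup>2 - f\<^sup>2" unfolding S F by simp
  also have "\<dots> = 3 * ((int n + 3 * k) * f\<^sup>2 + a * b + 2 * M ^ 3 * Y\<^sup>2)"
    unfolding s_square N pow k by (simp add: algebra_simps)
  finally have "S - F = (int n + 3 * k) * f\<^sup>2 + a * b + 2 * M ^ 3 * Y\<^sup>2" by simp
  also have "\<dots> = int n + a * b + 2 * Y\<^sup>2 + 3 * (int n * F + k * f\<^sup>2 + 6 * (m' + 3 * m'\<^sup>2 + 3 * m' ^ 3) * Y\<^sup>2)"
    unfolding F M33 by (simp add: algebra_simps)
  finally have k4: "S = F + int n + a * b + 2 * Y\<^sup>2
      + 3 * (int n * F + k * f\<^sup>2 + 6 * (m' + 3 * m'\<^sup>2 + 3 * m' ^ 3) * Y\<^sup>2)"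
    (is "_ = _ + 3 * ?k4") by simp
  \<comment> \<open>The coefficient 8 is -1 modulo 3 and also (5^2 - 1) / 3, so L 5 + 8 i is exactly
    the exponent in reciprocity at 5.\<close>
  have "int n * (L 5 + 8 * i) = (i + 1) * (a * b) + i * (2 * Y\<^sup>2 + 1) + 3 * (k1 - 2 * k2 + k3 - k5 + i * ?k4 + i * F + 3 * (int n * i))"
  proof -
    have "int n * (L 5 + 8 * i) = int n * L 5 + 8 * (int n * i)" by (simp add: algebra_simps)
    also have "int n * L 5 = i * S + a * b + 3 * k3 - (- i + 3 * k5) + 3 * k1 - 2 * (- i * F + 3 * k2)"
      using k1 unfolding k2 k3 k5 by simp
    finally show ?thesis unfolding k4 by (simp add: algebra_simps)
  qed
  moreover have "3 dvd (i + 1) * (a * b) + i * (2 * Y\<^sup>2 + 1)"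
  proof -
    have Y2: "3 dvd 2 * Y\<^sup>2 + 1" if "\<not> 3 dvd b"
    proof -
      have "\<not> 3 dvd Y" using that unfolding b_def by auto
      hence "Y\<^sup>2 mod 3 = 1" by (rule square_mod_3)
      thus ?thesis by presburger
    qed
    show ?thesis
    proof (rule i_cases)
      assume "[i = 0] (mod 3)" "3 dvd b"
      hence "3 dvd i" "3 dvd b" by (simp_all add: cong_0_iff)
      thus ?thesis by simp
    next
      assume "3 dvd a" "\<not> 3 dvd b"
      thus ?thesis using Y2 by simp
    next
      assume "[i = 2] (mod 3)" "\<not> 3 dvd b"
      moreover have "3 dvd i + 1" using \<open>[i = 2] (mod 3)\<close> unfolding cong_iff_dvd_diff by presburger
      ultimately show ?thesis using Y2 by simp
    qed
  qed
  ultimately have "3 dvd int n * (L 5 + 8 * i)" by simp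
  hence "3 dvd int n \<or> 3 dvd L 5 + 8 * i" by (simp add: prime_dvd_mult_iff)
  moreover have "\<not> 3 dvd L 5 + 8 * i"
  proof
    assume "3 dvd L 5 + 8 * i"
    hence 1: "om (L 5 + 8 * i) = om 0" unfolding om_eq_iff by (simp add: cong_0_iff)
    have "acong (int 5) ((of_int N * eis a b) ^ ((5\<^sup>2 - 1) div 3)) (om (L (int 5) + i * int ((5\<^sup>2 - 1) div 3)))"
      by (rule reciprocity) (use N5 in auto)
    hence r: "acong 5 ((of_int N * eis a b) ^ 8) (om 0)" using 1 by (simp add: mult.commute)
    have "5 dvd (f * x)\<^sup>2 - Y\<^sup>2" using fx_Y by (simp only: cong_iff_dvd_diff)
    also have "(f * x)\<^sup>2 - Y\<^sup>2 = (f * x - Y) * (f * x + Y)" by (simp add: power2_eq_square algebra_simps)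
    finally have "5 dvd f * x - Y \<or> 5 dvd f * x + Y" by (simp add: prime_dvd_mult_iff)
    \<comment> \<open>From f x = +-Y modulo 5 it follows that \<delta> is 2 Y (1 + \<omega>) = -2 Y
      \<omega>^2 or 2 Y \<omega>: an integer times a nontrivial cube root of unity.\<close>
    then obtain j s where js: "acong 5 (eis a b) (of_int (s * (2 * Y)) * om j)" "j = 1 \<or> j = 2" "s = 1 \<or> s = - 1"
    proof
      assume "5 dvd f * x - Y"
      hence "acong 5 (eis a b) (eis (2 * Y) (2 * Y))"
        by (subst acong_eis_iff) (auto simp: cong_iff_dvd_diff a_def b_def)
      moreover have "eis (2 * Y) (2 * Y) = of_int (- 1 * (2 * Y)) * om 2"
        by (simp add: eis_def om_2 algebra_simps)
      ultimately show thesis using that[of "- 1" 2] by simp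
    next
      assume "5 dvd f * x + Y"
      hence "acong 5 (eis a b) (eis 0 (2 * Y))"
        by (subst acong_eis_iff) (auto simp: cong_iff_dvd_diff a_def b_def)
      moreover have "eis 0 (2 * Y) = of_int (1 * (2 * Y)) * om 1" by (simp add: eis_def)
      ultimately show thesis using that[of 1 1] by simp
    qed
    have "acong 5 (of_int N * eis a b) (of_int (4 * Y\<^sup>2) * (of_int (s * (2 * Y)) * om j))"
      by (intro acong_mult acong_of_int N_mod_5 js(1) algebraic_int_add_mult algebraic_int_of_int) auto
    hence "acong 5 ((of_int N * eis a b) ^ 8) ((of_int (4 * Y\<^sup>2) * (of_int (s * (2 * Y)) * om j)) ^ 8)"
      by (intro acong_power algebraic_int_add_mult algebraic_int_of_int algebraic_int_eis) auto
    also have "(of_int (4 * Y\<^sup>2) * (of_int (s * (2 * Y)) * om j)) ^ 8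
        = (om j ^ 8 * of_int ((4 * Y\<^sup>2 * (s * (2 * Y))) ^ 8) :: complex)"
      by (simp only: of_int_power of_int_mult power_mult_distrib mult_ac)
    \<comment> \<open>Since N = (2 Y)^2 modulo 5, the integer part of N \<delta> is +-(2 Y)^3. Its
      8th power is (2 Y)^24 with 24 = 5^2 - 1, hence 1 modulo 5.\<close>
    also have "(4 * Y\<^sup>2 * (s * (2 * Y))) ^ 8 = (2 * Y) ^ 24"
    proof -
      have "4 * Y\<^sup>2 * (s * (2 * Y)) = s * (2 * Y) ^ 3" by (simp add: power2_eq_square power3_eq_cube)
      hence "(4 * Y\<^sup>2 * (s * (2 * Y))) ^ 8 = s ^ 8 * ((2 * Y) ^ 3) ^ 8" by (simp only: power_mult_distrib)
      moreover have "s ^ 8 = 1" using js(3) by auto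
      moreover have "((2 * Y) ^ 3) ^ 8 = (2 * Y) ^ (3 * 8)" by (simp only: power_mult)
      ultimately show ?thesis by (simp only: mult_1_left) simp
    qed
    also have "acong 5 (om j ^ 8 * of_int ((2 * Y) ^ 24)) (om j ^ 8 * of_int 1)"
    proof (intro acong_scale acong_of_int algebraic_int_power)
      have "\<not> int 5 dvd 2 * Y" using Y5 by (auto simp: prime_dvd_mult_iff)
      from fermat_square[OF _ this] have "[(2 * Y) ^ (5\<^sup>2 - 1) = 1] (mod int 5)" by simp
      moreover have "(5\<^sup>2 - 1 :: nat) = 24" by simp
      ultimately show "[(2 * Y) ^ 24 = 1] (mod 5)" by (simp only: of_nat_numeral)
    qed auto
    also have "om j ^ 8 * of_int 1 = om (8 * j)" by (simp add: zeta_power)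
    finally have "acong 5 (om 0) (om (8 * j))" using acong_trans[OF acong_sym[OF r]] by blast
    hence "[0 = 8 * j] (mod 3)" by (subst (asm) acong_om_iff) auto
    thus False using js(2) by (auto simp: cong_def)
  qed
  ultimately have "3 dvd int n" by blast
  thus ?thesis by presburger
qed

section \<open>Quadratic fields and their fractional ideals\<close>

lemma rational_square_int:
  fixes y :: rat
  assumes "y\<^sup>2 \<in> \<int>"
  shows "y \<in> \<int>"
proof (rule rational_algebraic_int_is_int)
  have "(of_rat y :: rat) \<in> \<rat>" by (rule Rats_of_rat)
  thus "y \<in> \<rat>" by simp
  show "algebraic_int y"
  proof (rule algebraic_int.intros[of "[:- y\<^sup>2, 0, 1:]"])
    show "\<forall>i. coeff [:- y\<^sup>2, 0, 1:] i \<in> \<int>"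
      using assms by (auto simp: coeff_pCons split: nat.splits)
  qed (auto simp: power2_eq_square)
qed

lemma int_subgroup_generator:
  fixes H :: "int set"
  assumes "0 \<in> H" and sub: "\<And>x y. x \<in> H \<Longrightarrow> y \<in> H \<Longrightarrow> x - y \<in> H"
  obtains d where "d \<in> H" "\<And>x. x \<in> H \<Longrightarrow> d dvd x"
proof (cases "H = {0}")
  case True
  thus thesis using that[of 0] by auto
next
  case False
  have neg: "- x \<in> H" if "x \<in> H" for x using sub[OF assms(1) that] by simp
  have add: "x + y \<in> H" if "x \<in> H" "y \<in> H" for x y using sub[OF that(1) neg[OF that(2)]] by simp
  have mul: "of_nat k * x \<in> H" if "x \<in> H" for k :: nat and x
    by (induction k) (auto simp: assms(1) distrib_right intro: add that)
  have imul: "k * x \<in> H" if "x \<in> H" for k x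
  proof (cases "k \<ge> 0")
    case True
    thus ?thesis using mul[OF that, of "nat k"] by simp
  next
    case False
    thus ?thesis using neg[OF mul[OF that, of "nat (- k)"]] by simp
  qed
  from False assms(1) obtain x where "x \<in> H" "x \<noteq> 0" by auto
  hence "\<exists>n::nat. n > 0 \<and> int n \<in> H"
  proof (cases "x > 0")
    case True
    thus ?thesis using \<open>x \<in> H\<close> by (intro exI[of _ "nat x"]) simp
  next
    case False
    thus ?thesis using neg[OF \<open>x \<in> H\<close>] \<open>x \<noteq> 0\<close> by (intro exI[of _ "nat (- x)"]) simp
  qed
  then obtain n where n: "n > 0" "int n \<in> H" and min: "\<And>k. k < n \<Longrightarrow> \<not> (k > 0 \<and> int k \<in> H)"
    unfolding exists_least_iff[of "\<lambda>n. n > 0 \<and> int n \<in> H"] by blast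
  show thesis
  proof (rule that[OF n(2)])
    fix x assume x: "x \<in> H"
    have "x - (x div int n) * int n \<in> H" by (rule sub[OF x imul[OF n(2)]])
    hence m: "x mod int n \<in> H" by (simp add: minus_div_mult_eq_mod)
    have "nat (x mod int n) < n" using n(1) by (simp add: nat_less_iff)
    from min[OF this] have "\<not> 0 < nat (x mod int n)" using m n(1) by simp
    hence "x mod int n = 0" using n(1) pos_mod_sign[of "int n" x] by linarith
    thus "int n dvd x" by (rule mod_0_imp_dvd)
  qed
qed

lemma of_rat_in_Ints_iff: "(of_rat q :: complex) \<in> \<int> \<longleftrightarrow> q \<in> \<int>"
proof
  assume "(of_rat q :: complex) \<in> \<int>"
  then obtain k where "(of_rat q :: complex) = of_int k" by (rule Ints_cases)
  hence "(of_rat q :: complex) = of_rat (of_int k)" by simp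
  hence "q = of_int k" using of_rat_eq_iff by blast
  thus "q \<in> \<int>" by simp
qed (auto elim!: Ints_cases)

lemma algebraic_int_of_rat_iff: "algebraic_int (of_rat q :: complex) \<longleftrightarrow> q \<in> \<int>"
proof
  assume "algebraic_int (of_rat q :: complex)"
  hence "(of_rat q :: complex) \<in> \<int>" by (rule rational_algebraic_int_is_int) simp
  thus "q \<in> \<int>" by (simp add: of_rat_in_Ints_iff)
qed (auto elim!: Ints_cases)

section \<open>Elements, conjugation and integrality in a quadratic field\<close>

locale quadratic =
  fixes D :: int
  assumes nonsquare: "\<And>q::rat. q\<^sup>2 \<noteq> of_int D"
begin

abbreviation K :: "complex set" where "K \<equiv> quadratic_field D"
abbreviation R :: "complex set" where "R \<equiv> ring_of_integers (quadratic_field D)"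

definition el :: "rat \<Rightarrow> rat \<Rightarrow> complex" where
  "el a b = of_rat a + of_rat b * csqrt (of_int D)"

text \<open>The nontrivial automorphism of \<open>K\<close>; for D > 0 it differs from complex
  conjugation, which is then trivial on \<open>K\<close>. The description is unique on
  \<open>K\<close> because coordinates are.\<close>

definition gconj :: "complex \<Rightarrow> complex" where
  "gconj x = (THE y. \<exists>a b. x = el a b \<and> y = el a (- b))"

lemma D_nonzero: "D \<noteq> 0" using nonsquare[of 0] by auto

lemma root_square: "csqrt (of_int D) * csqrt (of_int D) = of_int D"
  by (metis power2_csqrt power2_eq_square)

lemma el_inject: "el a b = el c d \<longleftrightarrow> a = c \<and> b = d"
proof
  assume *: "el a b = el c d"
  show "a = c \<and> b = d"
  proof (cases "b = d")
    case True
    thus ?thesis using * by (simp add: el_def)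
  next
    case False
    define s :: complex where "s = csqrt (of_int D)"
    have s2: "s * s = of_int D" by (simp add: s_def root_square)
    have "of_rat (d - b) * s = of_rat (a - c)"
      using * by (simp add: el_def s_def of_rat_diff algebra_simps)
    hence "s = of_rat ((a - c) / (d - b))"
      using False by (simp add: of_rat_divide field_simps)
    hence "(of_rat (((a - c) / (d - b)) * ((a - c) / (d - b))) :: complex) = of_rat (of_int D)"
      using s2 by (simp only: of_rat_mult of_rat_of_int_eq)
    hence "((a - c) / (d - b))\<^sup>2 = of_int D" unfolding power2_eq_square of_rat_eq_iff .
    thus ?thesis using nonsquare by blast
  qed
qed auto

lemma conj_el: "gconj (el a b) = el a (- b)"
  unfolding gconj_def by (rule the_equality) (auto simp: el_inject)

lemma K_eq: "K = {el a b | a b. True}"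
  unfolding quadratic_field_def el_def by auto

lemma el_in_K [simp]: "el a b \<in> K" unfolding K_eq by blast

lemma K_cases: assumes "x \<in> K" obtains a b where "x = el a b"
  using assms unfolding K_eq by blast

lemma el_add: "el a b + el c d = el (a + c) (b + d)"
  by (simp add: el_def of_rat_add algebra_simps)

lemma el_mult: "el a b * el c d = el (a * c + of_int D * (b * d)) (a * d + b * c)"
proof -
  define s :: complex where "s = csqrt (of_int D)"
  have "el a b * el c d = of_rat a * of_rat c + (s * s) * (of_rat b * of_rat d) + (of_rat a * of_rat d + of_rat b * of_rat c) * s"
    by (simp add: el_def s_def[symmetric] algebra_simps)
  also have "s * s = of_int D" by (simp add: s_def root_square)
  finally show ?thesis by (simp add: el_def s_def of_rat_add of_rat_mult)
qed

lemma of_rat_el: "of_rat a = el a 0" by (simp add: el_def)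
lemma of_int_el: "of_int k = el (of_int k) 0" by (simp add: el_def)

lemma K_add: "x \<in> K \<Longrightarrow> y \<in> K \<Longrightarrow> x + y \<in> K"
  by (elim K_cases) (simp add: el_add)
lemma K_mult: "x \<in> K \<Longrightarrow> y \<in> K \<Longrightarrow> x * y \<in> K"
  by (elim K_cases) (simp add: el_mult)
lemma K_of_rat: "of_rat a \<in> K" by (simp add: of_rat_el)
lemma K_of_int: "of_int a \<in> K" by (simp add: of_int_el)

lemma conj_K: "x \<in> K \<Longrightarrow> gconj x \<in> K"
  by (elim K_cases) (simp add: conj_el)
lemma conj_conj: "x \<in> K \<Longrightarrow> gconj (gconj x) = x"
  by (elim K_cases) (simp add: conj_el)
lemma conj_add: "x \<in> K \<Longrightarrow> y \<in> K \<Longrightarrow> gconj (x + y) = gconj x + gconj y"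
  by (elim K_cases) (simp add: el_add conj_el)
lemma conj_mult: "x \<in> K \<Longrightarrow> y \<in> K \<Longrightarrow> gconj (x * y) = gconj x * gconj y"
  by (elim K_cases) (simp add: el_mult conj_el)
lemma conj_of_rat: "gconj (of_rat a) = of_rat a"
  unfolding of_rat_el conj_el by simp
lemma conj_of_int: "gconj (of_int a) = of_int a"
  unfolding of_int_el conj_el by simp

lemma trace_el: "el a b + gconj (el a b) = of_rat (2 * a)"
  by (simp add: conj_el el_add of_rat_el)

lemma norm_el: "el a b * gconj (el a b) = of_rat (a\<^sup>2 - of_int D * b\<^sup>2)"
  by (simp add: conj_el el_mult of_rat_el power2_eq_square)

lemma norm_nonzero:
  assumes "x \<in> K" "x \<noteq> 0"
  obtains q where "q \<noteq> 0" "x * gconj x = of_rat q"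
proof -
  obtain a b where x: "x = el a b" using assms(1) by (rule K_cases)
  have ab: "a \<noteq> 0 \<or> b \<noteq> 0" using assms(2) unfolding x by (auto simp: el_def)
  have "a\<^sup>2 - of_int D * b\<^sup>2 \<noteq> 0"
  proof
    assume *: "a\<^sup>2 - of_int D * b\<^sup>2 = 0"
    hence "b \<noteq> 0" using ab by auto
    hence "(a / b)\<^sup>2 = of_int D" using * by (simp add: field_simps)
    thus False using nonsquare by blast
  qed
  thus thesis using that norm_el unfolding x by blast
qed

lemma K_inverse: "x \<in> K \<Longrightarrow> inverse x \<in> K"
proof (cases "x = 0")
  case True
  thus ?thesis using K_of_int[of 0] by simp
next
  case False
  assume x: "x \<in> K"
  obtain q where q: "q \<noteq> 0" "x * gconj x = of_rat q" using norm_nonzero[OF x False] .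
  have "x * (gconj x * of_rat (inverse q)) = of_rat (q * inverse q)"
    using q(2) by (simp only: of_rat_mult mult.assoc[symmetric])
  hence "x * (gconj x * of_rat (inverse q)) = 1" using q(1) by simp
  hence "inverse x = gconj x * of_rat (inverse q)" by (rule inverse_unique)
  thus ?thesis using K_mult[OF conj_K[OF x] K_of_rat] by simp
qed

lemma poly_conj:
  fixes p :: "int poly"
  assumes "x \<in> K"
  shows "poly (map_poly of_int p) x \<in> K \<and> gconj (poly (map_poly of_int p) x) = poly (map_poly of_int p) (gconj x)"
proof (induction p)
  case 0
  show ?case using K_of_int[of 0] conj_of_int[of 0] by simp
next
  case (pCons c p)
  have "map_poly of_int (pCons c p) = (pCons (of_int c) (map_poly of_int p) :: complex poly)"
    using pCons(1) by (simp add: map_poly_pCons)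
  thus ?case using pCons(2)
    by (simp add: K_add K_mult assms K_of_int conj_add conj_mult conj_of_int)
qed

lemma algebraic_int_conj:
  assumes "x \<in> K" "algebraic_int x"
  shows "algebraic_int (gconj x)"
proof -
  from assms(2) obtain p :: "int poly" where p: "poly (map_poly of_int p) x = 0" "lead_coeff p = 1"
    unfolding algebraic_int_altdef_ipoly by blast
  have "poly (map_poly of_int p) (gconj x) = gconj 0" using poly_conj[OF assms(1), of p] p(1) by simp
  also have "gconj 0 = 0" using conj_of_int[of 0] by simp
  finally show ?thesis unfolding algebraic_int_altdef_ipoly using p(2) by blast
qed

text \<open>Trace and norm of an algebraic integer are rational algebraic integers; conversely the
  element is a root of the monic quadratic polynomial they define. This criterion needs neither a
  squarefree \<open>D\<close> nor its residue modulo 4.\<close>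

lemma algebraic_int_el_iff: "algebraic_int (el a b) \<longleftrightarrow> 2 * a \<in> \<int> \<and> a\<^sup>2 - of_int D * b\<^sup>2 \<in> \<int>"
proof
  assume *: "algebraic_int (el a b)"
  have c: "algebraic_int (gconj (el a b))" by (rule algebraic_int_conj[OF _ *]) simp
  have "algebraic_int (of_rat (2 * a) :: complex)"
    using algebraic_int_add_mult(1)[OF * c] unfolding trace_el .
  moreover have "algebraic_int (of_rat (a\<^sup>2 - of_int D * b\<^sup>2) :: complex)"
    using algebraic_int_add_mult(2)[OF * c] unfolding norm_el .
  ultimately show "2 * a \<in> \<int> \<and> a\<^sup>2 - of_int D * b\<^sup>2 \<in> \<int>" by (simp only: algebraic_int_of_rat_iff)
next
  assume *: "2 * a \<in> \<int> \<and> a\<^sup>2 - of_int D * b\<^sup>2 \<in> \<int>"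
  define x where "x = el a b"
  define p :: "complex poly" where "p = [:x * gconj x, - (x + gconj x), 1:]"
  show "algebraic_int (el a b)"
  proof (rule algebraic_int.intros[of p])
    have "x * gconj x \<in> \<int>" "x + gconj x \<in> \<int>"
      unfolding x_def norm_el trace_el using * by (simp_all only: of_rat_in_Ints_iff)
    moreover from this have "- (x + gconj x) \<in> \<int>" by (simp only: Ints_minus)
    ultimately show "\<forall>i. coeff p i \<in> \<int>" unfolding p_def coeff_pCons by (simp split: nat.splits del: minus_add_distrib add: Ints_1 Ints_0)
    show "lead_coeff p = 1" by (simp add: p_def)
    show "poly p (el a b) = 0" by (simp add: p_def x_def[symmetric] algebra_simps)
  qed
qed

lemma R_iff: "x \<in> R \<longleftrightarrow> x \<in> K \<and> algebraic_int x" by (simp add: ring_of_integers_def)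
lemma R_K: "x \<in> R \<Longrightarrow> x \<in> K" by (simp add: R_iff)
lemma R_add: "x \<in> R \<Longrightarrow> y \<in> R \<Longrightarrow> x + y \<in> R" by (simp add: R_iff K_add algebraic_int_add_mult)
lemma R_mult: "x \<in> R \<Longrightarrow> y \<in> R \<Longrightarrow> x * y \<in> R" by (simp add: R_iff K_mult algebraic_int_add_mult)
lemma R_of_int: "of_int k \<in> R" by (simp add: R_iff K_of_int)
lemma R_conj: "x \<in> R \<Longrightarrow> gconj x \<in> R" by (simp add: R_iff conj_K algebraic_int_conj)
lemma R_power: "x \<in> R \<Longrightarrow> x ^ n \<in> R" using R_of_int[of 1] by (induction n) (auto intro: R_mult)
lemma R_0: "0 \<in> R" and R_1: "1 \<in> R" using R_of_int[of 0] R_of_int[of 1] by simp_all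
lemma R_of_rat_iff: "of_rat q \<in> R \<longleftrightarrow> q \<in> \<int>" by (simp add: R_iff K_of_rat algebraic_int_of_rat_iff)
lemma R_el_iff: "el a b \<in> R \<longleftrightarrow> 2 * a \<in> \<int> \<and> a\<^sup>2 - of_int D * b\<^sup>2 \<in> \<int>"
  by (simp add: R_iff algebraic_int_el_iff)

text \<open>The square of 2 D b is D times (trace^2 - 4 norm), an integer. Second coordinates of
  integers thus have a common denominator, and those occurring in an ideal form, after scaling, a
  subgroup of Z.\<close>

lemma R_second_coordinate:
  assumes "el a b \<in> R"
  obtains k where "2 * of_int D * b = of_int k"
proof -
  have *: "2 * a \<in> \<int>" "a\<^sup>2 - of_int D * b\<^sup>2 \<in> \<int>" using assms by (simp_all add: R_el_iff)
  have "of_int D * ((2 * a) * (2 * a) - 4 * (a\<^sup>2 - of_int D * b\<^sup>2)) \<in> \<int>"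
    by (rule Ints_mult[OF Ints_of_int Ints_diff[OF Ints_mult[OF *(1) *(1)] Ints_mult[OF Ints_numeral *(2)]]])
  also have "of_int D * ((2 * a) * (2 * a) - 4 * (a\<^sup>2 - of_int D * b\<^sup>2)) = (2 * of_int D * b)\<^sup>2"
    by (simp add: power2_eq_square algebra_simps)
  finally have "2 * of_int D * b \<in> \<int>" by (rule rational_square_int)
  thus thesis using that by (auto elim: Ints_cases)
qed

end

section \<open>Products of sets of complex numbers\<close>

abbreviation cprod :: "complex set \<Rightarrow> complex set \<Rightarrow> complex set" (infixl \<open>\<star>\<close> 75) where
  "M \<star> N \<equiv> ideal_prod ring_of_type_algebra M N"

lemma cprod_mult: "x \<in> M \<Longrightarrow> y \<in> N \<Longrightarrow> x * y \<in> M \<star> N"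
  using ideal_prod.prod[of x M y N "ring_of_type_algebra :: complex ring"]
  by (simp add: ring_of_type_algebra_def)

lemma cprod_add: "x \<in> M \<star> N \<Longrightarrow> y \<in> M \<star> N \<Longrightarrow> x + y \<in> M \<star> N"
  using ideal_prod.sum[of x "ring_of_type_algebra :: complex ring" M N y]
  by (simp add: ring_of_type_algebra_def)

lemma cprod_induct [consumes 1, case_names mult add]:
  assumes "z \<in> M \<star> N"
    and "\<And>x y. x \<in> M \<Longrightarrow> y \<in> N \<Longrightarrow> P (x * y)"
    and "\<And>x y. P x \<Longrightarrow> P y \<Longrightarrow> P (x + y)"
  shows "P z"
  using assms(1) by (induction rule: ideal_prod.induct) (auto simp: ring_of_type_algebra_def assms)

lemma cprod_commute: "M \<star> N = N \<star> M"
proof -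
  have "z \<in> N \<star> M" if "z \<in> M \<star> N" for z M N
    using that by (induction rule: cprod_induct) (metis cprod_mult mult.commute, rule cprod_add)
  thus ?thesis by blast
qed

lemma cprod_assoc_subset: "(M \<star> N) \<star> P \<subseteq> M \<star> (N \<star> P)"
proof
  fix z assume "z \<in> (M \<star> N) \<star> P"
  thus "z \<in> M \<star> (N \<star> P)"
  proof (induction rule: cprod_induct)
    case (mult x y)
    from mult(1) show ?case
    proof (induction rule: cprod_induct)
      case (mult u v)
      thus ?case using \<open>y \<in> P\<close> by (simp add: mult.assoc cprod_mult)
    qed (simp add: distrib_right cprod_add)
  qed (rule cprod_add)
qed

lemma cprod_assoc: "(M \<star> N) \<star> P = M \<star> (N \<star> P)"
proof
  show "M \<star> (N \<star> P) \<subseteq> (M \<star> N) \<star> P"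
  proof -
    have "M \<star> (N \<star> P) = (P \<star> N) \<star> M" by (simp only: cprod_commute[of M] cprod_commute[of N])
    also have "\<dots> \<subseteq> P \<star> (N \<star> M)" by (rule cprod_assoc_subset)
    also have "\<dots> = (M \<star> N) \<star> P" by (simp only: cprod_commute[of P] cprod_commute[of N])
    finally show ?thesis .
  qed
qed (rule cprod_assoc_subset)

lemma additive_subgroup_complex_iff:
  fixes M :: "complex set"
  shows "additive_subgroup M ring_of_type_algebra \<longleftrightarrow>
    0 \<in> M \<and> (\<forall>x\<in>M. \<forall>y\<in>M. x + y \<in> M) \<and> (\<forall>x\<in>M. - x \<in> M)"
proof -
  let ?R = "ring_of_type_algebra :: complex ring"
  interpret ring ?R by (rule ring_from_type_algebra)
  have "\<ominus>\<^bsub>?R\<^esub> x = - x" for x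
    by (rule minus_equality) (auto simp: ring_of_type_algebra_def)
  hence inv: "inv\<^bsub>add_monoid ?R\<^esub> x = - x" for x by (simp add: a_inv_def)
  show ?thesis
    unfolding additive_subgroup_def subgroup_def inv
    by (auto simp: ring_of_type_algebra_def)
qed

section \<open>Fractional ideals of the ring of integers and their inverses\<close>

context quadratic
begin

text \<open>The additive subgroup condition is reduced to zero and sums, since negatives come from
  multiplication by -1 in \<open>R\<close>.\<close>

definition fideal :: "complex set \<Rightarrow> bool" where
  "fideal M \<longleftrightarrow> M \<subseteq> K \<and> M \<noteq> {0} \<and> 0 \<in> M \<and> (\<forall>x\<in>M. \<forall>y\<in>M. x + y \<in> M) \<and>
     (\<forall>r\<in>R. \<forall>x\<in>M. r * x \<in> M) \<and> (\<exists>c\<in>R. c \<noteq> 0 \<and> (\<forall>x\<in>M. c * x \<in> R))"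

lemma fideal_iff: "fractional_ideal K M \<longleftrightarrow> fideal M"
proof -
  have "(\<forall>x\<in>M. - x \<in> M)" if m: "\<forall>r\<in>R. \<forall>x\<in>M. r * x \<in> M"
  proof
    fix x assume "x \<in> M"
    hence "of_int (- 1) * x \<in> M" using m R_of_int by blast
    thus "- x \<in> M" by simp
  qed
  thus ?thesis unfolding fractional_ideal_def fideal_def additive_subgroup_complex_iff by blast
qed

lemma fidealD:
  assumes "fideal M"
  shows "M \<subseteq> K" "0 \<in> M" "\<And>x y. x \<in> M \<Longrightarrow> y \<in> M \<Longrightarrow> x + y \<in> M"
    "\<And>r x. r \<in> R \<Longrightarrow> x \<in> M \<Longrightarrow> r * x \<in> M" "\<exists>x\<in>M. x \<noteq> 0"
    "\<exists>c\<in>R. c \<noteq> 0 \<and> (\<forall>x\<in>M. c * x \<in> R)"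
  using assms unfolding fideal_def by blast+

lemma fidealI:
  assumes "M \<subseteq> K" "x0 \<in> M" "x0 \<noteq> 0" "\<And>x y. x \<in> M \<Longrightarrow> y \<in> M \<Longrightarrow> x + y \<in> M"
    "\<And>r x. r \<in> R \<Longrightarrow> x \<in> M \<Longrightarrow> r * x \<in> M" "c \<in> R" "c \<noteq> 0" "\<And>x. x \<in> M \<Longrightarrow> c * x \<in> R"
  shows "fideal M"
proof -
  have "0 \<in> M" using assms(5)[OF R_0 assms(2)] by simp
  moreover have "M \<noteq> {0}" using assms(2,3) by blast
  moreover have "\<exists>c\<in>R. c \<noteq> 0 \<and> (\<forall>x\<in>M. c * x \<in> R)" using assms(6-8) by blast
  ultimately show ?thesis unfolding fideal_def by (intro conjI ballI assms(1,4,5))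
qed

lemma fideal_cprod:
  assumes M: "fideal M" and N: "fideal N"
  shows "fideal (M \<star> N)"
proof -
  obtain x0 y0 where x0: "x0 \<in> M" "x0 \<noteq> 0" "y0 \<in> N" "y0 \<noteq> 0" using fidealD(5) M N by blast
  obtain c where c: "c \<in> R" "c \<noteq> 0" "\<And>x. x \<in> M \<Longrightarrow> c * x \<in> R" using fidealD(6)[OF M] by blast
  obtain d where d: "d \<in> R" "d \<noteq> 0" "\<And>x. x \<in> N \<Longrightarrow> d * x \<in> R" using fidealD(6)[OF N] by blast
  show ?thesis
  proof (rule fidealI)
    show "M \<star> N \<subseteq> K"
    proof
      fix z assume "z \<in> M \<star> N"
      thus "z \<in> K" by (induction rule: cprod_induct) (use fidealD(1) M N in \<open>auto intro: K_add K_mult\<close>)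
    qed
    show "x0 * y0 \<in> M \<star> N" using x0 by (intro cprod_mult)
    show "x0 * y0 \<noteq> 0" "c * d \<noteq> 0" "c * d \<in> R" using x0 c d by (auto intro: R_mult)
    show "r * z \<in> M \<star> N" if r: "r \<in> R" and z: "z \<in> M \<star> N" for r z
      using z
    proof (induction rule: cprod_induct)
      case (mult x y)
      thus ?case using cprod_mult[OF fidealD(4)[OF M r] , of x y] by (simp add: mult.assoc)
    qed (simp add: distrib_left cprod_add)
    show "c * d * z \<in> R" if "z \<in> M \<star> N" for z
      using that
    proof (induction rule: cprod_induct)
      case (mult x y)
      have "c * d * (x * y) = (c * x) * (d * y)" by (simp add: mult_ac)
      thus ?case using R_mult[OF c(3)[OF mult(1)] d(3)[OF mult(2)]] by (simp only:)
    qed (simp add: distrib_left R_add)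
  qed (rule cprod_add)
qed

definition principal :: "complex \<Rightarrow> complex set" where
  "principal x = (\<lambda>r. x * r) ` R"

lemma principal_mem: "y \<in> R \<Longrightarrow> x * y \<in> principal x" "x \<in> principal x"
  unfolding principal_def using R_1 by (auto intro: image_eqI[of _ _ 1])

lemma fideal_principal:
  assumes x: "x \<in> K" "x \<noteq> 0"
  shows "fideal (principal x)"
proof -
  obtain a b where ab: "inverse x = el a b" using K_inverse[OF x(1)] by (rule K_cases)
  obtain n1 d1 where 1: "quotient_of a = (n1, d1)" by fastforce
  obtain n2 d2 where 2: "quotient_of b = (n2, d2)" by fastforce
  have d: "d1 > 0" "d2 > 0" using quotient_of_denom_pos 1 2 by blast+
  have ab_eq: "a = of_int n1 / of_int d1" "b = of_int n2 / of_int d2"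
    using quotient_of_div 1 2 by blast+
  \<comment> \<open>A common denominator of the coordinates of 1 / x, divided by x: this
    \<open>c\<close> is integral, and c x = d1 d2 is an integer.\<close>
  define c where "c = of_int (d1 * d2) * inverse x"
  have "c = el (of_int (n1 * d2)) (of_int (n2 * d1))"
  proof -
    have "c = el (of_int (d1 * d2)) 0 * el a b" unfolding c_def ab of_int_el ..
    also have "\<dots> = el (of_int (d1 * d2) * a) (of_int (d1 * d2) * b)" unfolding el_mult by simp
    also have "of_int (d1 * d2) * a = of_int (n1 * d2)" unfolding ab_eq using d by simp
    also have "of_int (d1 * d2) * b = of_int (n2 * d1)" unfolding ab_eq using d by simp
    finally show ?thesis .
  qed
  moreover have "el (of_int (n1 * d2)) (of_int (n2 * d1)) \<in> R"
    unfolding R_el_iff by (intro conjI Ints_mult Ints_diff Ints_power Ints_of_int Ints_numeral)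
  ultimately have cR: "c \<in> R" by (simp only:)
  have c0: "c \<noteq> 0" using d x by (simp add: c_def)
  show ?thesis
  proof (rule fidealI[OF _ principal_mem(2) x(2) _ _ cR c0])
    show "principal x \<subseteq> K" unfolding principal_def using x R_K K_mult by blast
    show "y + z \<in> principal x" if "y \<in> principal x" "z \<in> principal x" for y z
      using that R_add unfolding principal_def by (auto simp: distrib_left[symmetric])
    show "r * y \<in> principal x" if r: "r \<in> R" and y: "y \<in> principal x" for r y
    proof -
      obtain s where s: "s \<in> R" "y = x * s" using y unfolding principal_def by blast
      have "x * (r * s) \<in> principal x" by (rule principal_mem(1)[OF R_mult[OF r s(1)]])
      thus ?thesis using s by (simp add: mult_ac)
    qed
    show "c * y \<in> R" if y: "y \<in> principal x" for y
    proof -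
      obtain s where s: "s \<in> R" "y = x * s" using y unfolding principal_def by blast
      have "c * y = of_int (d1 * d2) * s" using s x by (simp add: c_def)
      thus ?thesis using R_mult[OF R_of_int s(1)] by (simp only:)
    qed
  qed
qed

lemma principal_1: "principal 1 = R" unfolding principal_def by simp

lemma fideal_R: "fideal R"
  using fideal_principal[of 1] K_of_int[of 1] by (simp add: principal_1)

lemma cprod_subsetI:
  assumes "\<And>x y. x \<in> M \<Longrightarrow> y \<in> N \<Longrightarrow> x * y \<in> P" "\<And>x y. x \<in> P \<Longrightarrow> y \<in> P \<Longrightarrow> x + y \<in> P"
  shows "M \<star> N \<subseteq> P"
proof
  fix z assume "z \<in> M \<star> N"
  thus "z \<in> P" by (induction rule: cprod_induct) (use assms in auto)
qed

lemma cprod_R: assumes "fideal M" shows "R \<star> M = M"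
proof
  show "R \<star> M \<subseteq> M" by (rule cprod_subsetI) (use fidealD(3,4)[OF assms] in auto)
  show "M \<subseteq> R \<star> M" using cprod_mult[OF R_1] by fastforce
qed

lemma cprod_principal:
  assumes "x \<in> K" "x \<noteq> 0" "y \<in> K" "y \<noteq> 0"
  shows "principal x \<star> principal y = principal (x * y)"
proof
  have "fideal (principal (x * y))" using assms by (intro fideal_principal K_mult) auto
  note f = fidealD[OF this]
  show "principal x \<star> principal y \<subseteq> principal (x * y)"
  proof (rule cprod_subsetI)
    fix u v assume "u \<in> principal x" "v \<in> principal y"
    then obtain r s where rs: "r \<in> R" "s \<in> R" "u = x * r" "v = y * s" unfolding principal_def by blast
    have "x * y * (r * s) \<in> principal (x * y)" by (rule principal_mem(1)[OF R_mult[OF rs(1,2)]])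
    thus "u * v \<in> principal (x * y)" using rs by (simp add: mult_ac)
  qed (rule f(3))
  show "principal (x * y) \<subseteq> principal x \<star> principal y"
  proof
    fix z assume "z \<in> principal (x * y)"
    then obtain r where r: "r \<in> R" "z = (x * y) * r" unfolding principal_def by blast
    have "(x * r) * y \<in> principal x \<star> principal y" using r(1) by (intro cprod_mult principal_mem)
    thus "z \<in> principal x \<star> principal y" using r(2) by (simp add: mult_ac)
  qed
qed

text \<open>Generators in triangular form: \<open>n\<close> generates the rational integers in
  \<open>I\<close>, and the second coordinate of \<alpha> generates all second coordinates.
  Subtracting a multiple of \<alpha> from an element leaves a rational integer in
  \<open>I\<close>.\<close>

lemma integral_ideal_basis:
  assumes I: "fideal I" "I \<subseteq> R"
  obtains \<alpha> and n :: int where "\<alpha> \<in> I" "of_int n \<in> I" "n \<noteq> 0"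
    "\<forall>x\<in>I. \<exists>s t::int. x = of_int s * \<alpha> + of_int t * of_int n"
proof -
  note f = fidealD[OF I(1)]
  have sub: "x - y \<in> I" if "x \<in> I" "y \<in> I" for x y
    using f(3)[OF that(1) f(4)[OF R_of_int[of "- 1"] that(2)]] by simp
  define H where "H = {n::int. of_int n \<in> I}"
  obtain n where n: "n \<in> H" "\<And>x. x \<in> H \<Longrightarrow> n dvd x"
    by (rule int_subgroup_generator[of H]) (use f(2) sub in \<open>auto simp: H_def\<close>)
  define V where "V = {k::int. \<exists>a b. el a b \<in> I \<and> 2 * of_int D * b = of_int k}"
  obtain k where k: "k \<in> V" "\<And>x. x \<in> V \<Longrightarrow> k dvd x"
  proof (rule int_subgroup_generator[of V])
    have "el 0 0 \<in> I" using f(2) by (simp add: el_def)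
    thus "0 \<in> V" unfolding V_def by force
    fix x y assume "x \<in> V" "y \<in> V"
    then obtain a b c d where *: "el a b \<in> I" "2 * of_int D * b = of_int x"
      "el c d \<in> I" "2 * of_int D * d = of_int y" unfolding V_def by blast
    have "el (a - c) (b - d) = el a b - el c d" by (simp add: el_def of_rat_diff algebra_simps)
    hence "el (a - c) (b - d) \<in> I" using sub[OF *(1,3)] by simp
    moreover have "2 * of_int D * (b - d) = of_int (x - y)" using *(2,4) by (simp add: algebra_simps)
    ultimately show "x - y \<in> V" unfolding V_def by blast
  qed blast
  from k(1) obtain a0 b0 where \<alpha>: "el a0 b0 \<in> I" "2 * of_int D * b0 = of_int k" unfolding V_def by blast
  show thesis
  proof (rule that[OF \<alpha>(1)])
    show "of_int n \<in> I" using n(1) by (simp add: H_def)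
    \<comment> \<open>The norm of a nonzero element of \<open>I\<close> is a nonzero rational
      integer that lies in \<open>I\<close>.\<close>
    show "n \<noteq> 0"
    proof
      assume n0: "n = 0"
      obtain x where x: "x \<in> I" "x \<noteq> 0" using f(5) by blast
      have xK: "x \<in> K" using x f(1) by blast
      obtain q where q: "q \<noteq> 0" "x * gconj x = of_rat q" using norm_nonzero[OF xK x(2)] .
      have "gconj x * x \<in> I" by (rule f(4)[OF R_conj x(1)]) (use I(2) x in blast)
      hence qI: "of_rat q \<in> I" using q(2) by (simp add: mult.commute)
      hence "q \<in> \<int>" using I(2) R_of_rat_iff by blast
      then obtain l where l: "q = of_int l" by (rule Ints_cases)
      hence "l \<in> H" using qI by (simp add: H_def)
      hence "l = 0" using n(2)[of l] n0 by simp
      thus False using q(1) l by simp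
    qed
    show "\<forall>x\<in>I. \<exists>s t. x = of_int s * el a0 b0 + of_int t * of_int n"
    proof
    fix x assume x: "x \<in> I"
    hence "x \<in> K" using f(1) by blast
    then obtain a b where ab: "x = el a b" by (rule K_cases)
    have "el a b \<in> R" using x I(2) ab by blast
    then obtain l where l: "2 * of_int D * b = of_int l" by (rule R_second_coordinate)
    hence "l \<in> V" using x ab unfolding V_def by blast
    then obtain s where s: "l = k * s" using k(2) by blast
    have "2 * of_int D * b = 2 * of_int D * (of_int s * b0)"
      using \<alpha>(2) l s by (simp add: mult_ac)
    hence b: "b = of_int s * b0" using D_nonzero by simp
    have eq: "x - of_int s * el a0 b0 = of_rat (a - of_int s * a0)"
      by (simp add: ab b el_def of_rat_diff of_rat_mult algebra_simps)
    have "x - of_int s * el a0 b0 \<in> I" by (intro sub x f(4) R_of_int \<alpha>)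
    hence qI: "of_rat (a - of_int s * a0) \<in> I" unfolding eq .
    hence "a - of_int s * a0 \<in> \<int>" using I(2) R_of_rat_iff by blast
    then obtain m where m: "a - of_int s * a0 = of_int m" by (rule Ints_cases)
    hence "m \<in> H" using qI by (simp add: H_def)
    then obtain t where mt: "m = n * t" using n(2) by blast
    have "x = of_int s * el a0 b0 + of_int m"
      using eq unfolding m of_rat_of_int_eq by (simp add: algebra_simps)
    hence "x = of_int s * el a0 b0 + of_int t * of_int n" unfolding mt by (simp add: mult.commute)
    thus "\<exists>s t. x = of_int s * el a0 b0 + of_int t * of_int n" by blast
    qed
  qed
qed

lemma R_div_intI:
  assumes "x \<in> K" "x + gconj x = of_int t" "x * gconj x = of_int u" "g \<noteq> 0" "g dvd t" "g\<^sup>2 dvd u"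
  shows "x / of_int g \<in> R"
proof -
  obtain a b where x: "x = el a b" using assms(1) by (rule K_cases)
  have "(of_rat (2 * a) :: complex) = of_rat (of_int t)" using assms(2) unfolding x trace_el by simp
  hence a: "2 * a = of_int t" using of_rat_eq_iff by blast
  have "(of_rat (a\<^sup>2 - of_int D * b\<^sup>2) :: complex) = of_rat (of_int u)" using assms(3) unfolding x norm_el by simp
  hence n: "a\<^sup>2 - of_int D * b\<^sup>2 = of_int u" using of_rat_eq_iff by blast
  have eq: "x / of_int g = el (a / of_int g) (b / of_int g)"
    by (simp add: x el_def of_rat_divide add_divide_distrib)
  obtain t' u' where tu: "t = g * t'" "u = g\<^sup>2 * u'" using assms by blast
  have "2 * (a / of_int g) = of_int t'" using a tu assms(4) by (simp add: field_simps)
  moreover have "(a / of_int g)\<^sup>2 - of_int D * (b / of_int g)\<^sup>2 = (a\<^sup>2 - of_int D * b\<^sup>2) / (of_int g)\<^sup>2"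
    by (simp add: power_divide diff_divide_distrib)
  hence "(a / of_int g)\<^sup>2 - of_int D * (b / of_int g)\<^sup>2 = of_int u'"
    unfolding n tu using assms(4) by simp
  ultimately show ?thesis unfolding eq R_el_iff by simp
qed

lemma R_trace_norm:
  assumes "x \<in> R"
  obtains t u where "x + gconj x = of_int t" "x * gconj x = of_int u"
proof -
  obtain a b where x: "x = el a b" using R_K[OF assms] by (rule K_cases)
  have "2 * a \<in> \<int>" "a\<^sup>2 - of_int D * b\<^sup>2 \<in> \<int>" using assms unfolding x R_el_iff by blast+
  then obtain t u where "2 * a = of_int t" "a\<^sup>2 - of_int D * b\<^sup>2 = of_int u" by (metis Ints_cases)
  hence "x + gconj x = of_int t" "x * gconj x = of_int u" unfolding x trace_el norm_el by simp_all
  thus thesis by (rule that)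
qed

text \<open>
  The inverse of an integral ideal \<open>I\<close> generated by \<open>\<alpha>\<close> and the integer \<open>n\<close> is its conjugate
  divided by the greatest common divisor \<open>g\<close> of the integers \<open>\<alpha> \<alpha>'\<close>, \<open>n (\<alpha> + \<alpha>')\<close> and \<open>n\<^sup>2\<close>,
  because \<open>n \<alpha> / g\<close> has integral trace and norm.
\<close>

lemma fideal_inverse_exists:
  assumes M: "fideal M"
  obtains J where "fideal J" "J \<star> M = R"
proof -
  obtain c where c: "c \<in> R" "c \<noteq> 0" "\<And>x. x \<in> M \<Longrightarrow> c * x \<in> R" using fidealD(6)[OF M] by blast
  note fM = fidealD[OF M]
  define I where "I = (\<lambda>x. c * x) ` M"
  have cK: "c \<in> K" using c R_K by blast
  have IR: "I \<subseteq> R" using c(3) by (auto simp: I_def)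
  obtain x1 where x1: "x1 \<in> M" "x1 \<noteq> 0" using fM(5) by blast
  have fI: "fideal I"
  proof (rule fidealI[of I "c * x1" 1])
    show "I \<subseteq> K" using IR R_K by blast
    show "c * x1 \<in> I" "c * x1 \<noteq> 0" using x1 c by (auto simp: I_def)
    show "x + y \<in> I" if "x \<in> I" "y \<in> I" for x y
      using that fM(3) unfolding I_def by (auto simp: distrib_left[symmetric])
    show "r * x \<in> I" if r: "r \<in> R" and x: "x \<in> I" for r x
    proof -
      obtain y where y: "y \<in> M" "x = c * y" using x by (auto simp: I_def)
      have "c * (r * y) \<in> I" unfolding I_def using fM(4)[OF r y(1)] by blast
      thus ?thesis using y by (simp add: mult_ac)
    qed
    show "1 \<in> R" by (rule R_1)
    show "1 * x \<in> R" if "x \<in> I" for x using that IR by auto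
  qed simp
  note f = fidealD[OF fI]
  obtain \<alpha> n where \<alpha>: "\<alpha> \<in> I" "of_int n \<in> I" "n \<noteq> 0"
    "\<forall>x\<in>I. \<exists>s t::int. x = of_int s * \<alpha> + of_int t * of_int n"
    by (rule integral_ideal_basis[OF fI IR])
  have \<alpha>R: "\<alpha> \<in> R" "\<alpha> \<in> K" using \<alpha> IR R_K by blast+
  obtain t u where tu: "\<alpha> + gconj \<alpha> = of_int t" "\<alpha> * gconj \<alpha> = of_int u" by (rule R_trace_norm[OF \<alpha>R(1)])
  define g where "g = gcd u (gcd (n * t) (n * n))"
  have g0: "g \<noteq> 0" using \<alpha>(3) by (simp add: g_def)
  have gd: "g dvd u" "g dvd n * t" "g dvd n * n" unfolding g_def by (auto intro: dvd_trans[OF gcd_dvd2])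
  obtain p q r where bez: "g = p * u + q * (n * t) + r * (n * n)"
  proof -
    obtain p s where 1: "p * u + s * gcd (n * t) (n * n) = g" using bezout_int unfolding g_def by blast
    obtain q r where 2: "q * (n * t) + r * (n * n) = gcd (n * t) (n * n)" using bezout_int by blast
    have "g = p * u + (s * q) * (n * t) + (s * r) * (n * n)"
      unfolding 1[symmetric] 2[symmetric] by (simp add: algebra_simps)
    thus thesis by (rule that)
  qed
  have n\<alpha>: "of_int n * \<alpha> / of_int g \<in> R"
  proof (rule R_div_intI)
    show "of_int n * \<alpha> \<in> K" by (intro K_mult K_of_int \<alpha>R)
    have cj: "gconj (of_int n * \<alpha>) = of_int n * gconj \<alpha>" by (simp add: conj_mult K_of_int \<alpha>R conj_of_int)
    show "of_int n * \<alpha> + gconj (of_int n * \<alpha>) = of_int (n * t)"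
      unfolding cj by (simp add: distrib_left[symmetric] tu)
    have "of_int n * \<alpha> * (of_int n * gconj \<alpha>) = of_int n * of_int n * (\<alpha> * gconj \<alpha>)" by (simp add: mult_ac)
    thus "of_int n * \<alpha> * gconj (of_int n * \<alpha>) = of_int (n * n * u)" unfolding cj tu by simp
    show "g\<^sup>2 dvd n * n * u" unfolding power2_eq_square by (rule mult_dvd_mono[OF gd(3,1)])
  qed (use g0 gd in auto)
  have n\<alpha>': "of_int n * gconj \<alpha> / of_int g \<in> R"
  proof -
    have "gconj (of_int n * \<alpha> * of_rat (1 / of_int g)) = of_int n * gconj \<alpha> * of_rat (1 / of_int g)"
      by (simp add: conj_mult K_mult K_of_int K_of_rat \<alpha>R conj_of_int conj_of_rat)
    thus ?thesis using R_conj[OF n\<alpha>] by (simp add: of_rat_divide)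
  qed
  have intg: "of_int l / of_int g \<in> R" if gl: "g dvd l" for l
  proof -
    obtain l' where "l = g * l'" using gl by blast
    thus ?thesis using g0 R_of_int[of l'] by simp
  qed
  have prod_R: "x * gconj y / of_int g \<in> R" if x: "x \<in> I" and y: "y \<in> I" for x y
  proof -
    obtain s1 s2 :: int where s: "x = of_int s1 * \<alpha> + of_int s2 * of_int n" using \<alpha>(4) x by blast
    obtain t1 t2 :: int where t: "y = of_int t1 * \<alpha> + of_int t2 * of_int n" using \<alpha>(4) y by blast
    have cy: "gconj y = of_int t1 * gconj \<alpha> + of_int t2 * of_int n"
      unfolding t by (simp add: conj_add conj_mult K_mult K_of_int \<alpha>R conj_of_int)
    have "x * gconj y = of_int (s1 * t1) * (\<alpha> * gconj \<alpha>) + of_int (s1 * t2) * (of_int n * \<alpha>)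
        + of_int (s2 * t1) * (of_int n * gconj \<alpha>) + of_int (s2 * t2) * of_int (n * n)"
      unfolding cy s by (simp add: algebra_simps)
    hence "x * gconj y / of_int g = of_int (s1 * t1) * (of_int u / of_int g) + of_int (s1 * t2) * (of_int n * \<alpha> / of_int g)
        + of_int (s2 * t1) * (of_int n * gconj \<alpha> / of_int g) + of_int (s2 * t2) * (of_int (n * n) / of_int g)"
      unfolding tu(2) by (simp add: add_divide_distrib)
    thus ?thesis using n\<alpha> n\<alpha>' intg[OF gd(1)] intg[OF gd(3)] by (simp only: R_add R_mult R_of_int)
  qed
  \<comment> \<open>Since I = c M, the inverse of \<open>M\<close> is \<open>c\<close> times the
    inverse of \<open>I\<close>.\<close>
  define J where "J = (\<lambda>y. c * gconj y / of_int g) ` I"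
  have IK: "x \<in> K" if "x \<in> I" for x using that f(1) by blast
  have fJ: "fideal J"
  proof (rule fidealI[of J "c * gconj (c * x1) / of_int g" "of_int g"])
    show "J \<subseteq> K"
    proof
      fix z assume "z \<in> J"
      then obtain y where y: "y \<in> I" "z = c * gconj y / of_int g" by (auto simp: J_def)
      have "z = c * gconj y * of_rat (1 / of_int g)" using y by (simp add: of_rat_divide)
      thus "z \<in> K" using IK[OF y(1)] by (simp only: K_mult cK conj_K K_of_rat)
    qed
    have x1I: "c * x1 \<in> I" using x1 by (auto simp: I_def)
    thus "c * gconj (c * x1) / of_int g \<in> J" by (auto simp: J_def)
    show "c * gconj (c * x1) / of_int g \<noteq> 0"
    proof
      assume "c * gconj (c * x1) / of_int g = 0"
      hence "gconj (c * x1) = 0" using c g0 by simp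
      hence "gconj (gconj (c * x1)) = 0" using conj_of_int[of 0] by simp
      hence "c * x1 = 0" using conj_conj[OF IK[OF x1I]] by simp
      thus False using c x1 by simp
    qed
    show "x + y \<in> J" if xy: "x \<in> J" "y \<in> J" for x y
    proof -
      obtain u v where uv: "u \<in> I" "v \<in> I" "x = c * gconj u / of_int g" "y = c * gconj v / of_int g"
        using xy by (auto simp: J_def)
      have "x + y = c * gconj (u + v) / of_int g"
        using uv by (simp add: conj_add IK add_divide_distrib distrib_left)
      thus ?thesis using f(3)[OF uv(1,2)] by (auto simp: J_def)
    qed
    show "r * x \<in> J" if r: "r \<in> R" and x: "x \<in> J" for r x
    proof -
      obtain u where u: "u \<in> I" "x = c * gconj u / of_int g" using x by (auto simp: J_def)
      have "r * x = c * gconj (gconj r * u) / of_int g"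
        using u by (simp add: conj_mult conj_K R_K[OF r] IK conj_conj)
      thus ?thesis using f(4)[OF R_conj[OF r] u(1)] by (auto simp: J_def)
    qed
    show "of_int g \<in> R" by (rule R_of_int)
    show "of_int g \<noteq> (0::complex)" using g0 by simp
    show "of_int g * x \<in> R" if x: "x \<in> J" for x
    proof -
      obtain u where u: "u \<in> I" "x = c * gconj u / of_int g" using x by (auto simp: J_def)
      have "of_int g * x = c * gconj u" using u g0 by simp
      thus ?thesis using R_mult[OF c(1) R_conj] u(1) IR by auto
    qed
  qed
  have JM: "x * gconj y / of_int g \<in> J \<star> M" if x: "x \<in> I" and y: "y \<in> I" for x y
  proof -
    obtain z where z: "z \<in> M" "x = c * z" using x by (auto simp: I_def)
    have "(c * gconj y / of_int g) * z \<in> J \<star> M" by (rule cprod_mult) (use y z in \<open>auto simp: J_def\<close>)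
    thus ?thesis using z by (simp add: mult_ac)
  qed
  note fp = fidealD[OF fideal_cprod[OF fJ M]]
  have "J \<star> M = R"
  proof
    show "J \<star> M \<subseteq> R"
    proof (rule cprod_subsetI)
      fix u v assume "u \<in> J" "v \<in> M"
      then obtain y where y: "y \<in> I" "u = c * gconj y / of_int g" by (auto simp: J_def)
      have "(c * v) * gconj y / of_int g \<in> R" by (rule prod_R) (use y \<open>v \<in> M\<close> in \<open>auto simp: I_def\<close>)
      thus "u * v \<in> R" using y by (simp add: mult_ac)
    qed (rule R_add)
    \<comment> \<open>The Bezout representation of \<open>g\<close>, divided by \<open>g\<close> and
      written with products x gconj y / g for x and y in \<open>I\<close>.\<close>
    have "of_int p * (\<alpha> * gconj \<alpha> / of_int g) + of_int q * (of_int n * gconj \<alpha> / of_int g)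
        + of_int q * (\<alpha> * gconj (of_int n) / of_int g) + of_int r * (of_int n * gconj (of_int n) / of_int g) \<in> J \<star> M"
      by (intro fp(3) fp(4) R_of_int JM \<alpha>)
    also have "of_int p * (\<alpha> * gconj \<alpha> / of_int g) + of_int q * (of_int n * gconj \<alpha> / of_int g)
        + of_int q * (\<alpha> * gconj (of_int n) / of_int g) + of_int r * (of_int n * gconj (of_int n) / of_int g)
        = (of_int p * (\<alpha> * gconj \<alpha>) + of_int q * (of_int n * (\<alpha> + gconj \<alpha>)) + of_int r * (of_int n * of_int n)) / of_int g"
      by (simp add: conj_of_int add_divide_distrib algebra_simps)
    also have "\<dots> = of_int g / of_int g" unfolding tu by (simp add: bez)
    also have "\<dots> = 1" using g0 by simp
    finally have 1: "1 \<in> J \<star> M" .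
    show "R \<subseteq> J \<star> M" using fp(4)[OF _ 1] by auto
  qed
  with fJ show thesis by (rule that)
qed

section \<open>The group of fractional ideals and its subgroup of principal ones\<close>

abbreviation G :: "complex set monoid" where "G \<equiv> fractional_ideal_group K"
abbreviation H :: "complex set set" where "H \<equiv> principal_fractional_ideals K"

lemma G_simps: "carrier G = {M. fideal M}" "M \<otimes>\<^bsub>G\<^esub> N = M \<star> N" "\<one>\<^bsub>G\<^esub> = R"
  by (simp_all add: fractional_ideal_group_def fideal_iff)

lemma H_eq: "H = {principal x | x. x \<in> K \<and> x \<noteq> 0}"
  by (simp add: principal_fractional_ideals_def principal_def)

lemma comm_group_G: "comm_group G"
proof (rule comm_groupI)
  show "\<exists>N\<in>carrier G. N \<otimes>\<^bsub>G\<^esub> M = \<one>\<^bsub>G\<^esub>" if "M \<in> carrier G" for M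
    using that fideal_inverse_exists unfolding G_simps by blast
  show "M \<otimes>\<^bsub>G\<^esub> N \<in> carrier G" if "M \<in> carrier G" "N \<in> carrier G" for M N
    using that unfolding G_simps by (simp add: fideal_cprod)
  show "\<one>\<^bsub>G\<^esub> \<in> carrier G" unfolding G_simps by (simp add: fideal_R)
  show "(M \<otimes>\<^bsub>G\<^esub> N) \<otimes>\<^bsub>G\<^esub> P = M \<otimes>\<^bsub>G\<^esub> (N \<otimes>\<^bsub>G\<^esub> P)" for M N P
    unfolding G_simps by (rule cprod_assoc)
  show "M \<otimes>\<^bsub>G\<^esub> N = N \<otimes>\<^bsub>G\<^esub> M" for M N
    unfolding G_simps by (rule cprod_commute)
  show "\<one>\<^bsub>G\<^esub> \<otimes>\<^bsub>G\<^esub> M = M" if "M \<in> carrier G" for M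
    using that unfolding G_simps by (simp add: cprod_R)
qed

lemma subgroup_H: "subgroup H G"
proof -
  interpret comm_group G by (rule comm_group_G)
  show ?thesis
  proof (rule subgroupI)
    show "H \<subseteq> carrier G" unfolding H_eq G_simps using fideal_principal by blast
    show "H \<noteq> {}" unfolding H_eq using K_of_int[of 1] by fastforce
    show "inv\<^bsub>G\<^esub> M \<in> H" if M: "M \<in> H" for M
    proof -
      obtain x where x: "x \<in> K" "x \<noteq> 0" "M = principal x" using M unfolding H_eq by blast
      have "inv\<^bsub>G\<^esub> M = principal (inverse x)"
      proof (rule inv_equality)
        show "principal (inverse x) \<otimes>\<^bsub>G\<^esub> M = \<one>\<^bsub>G\<^esub>"
          unfolding G_simps x(3) using x(1,2) cprod_principal[of "inverse x" x] K_inverse[of x] by (simp add: principal_1)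
      qed (use x K_inverse fideal_principal in \<open>auto simp: G_simps\<close>)
      thus ?thesis unfolding H_eq using x K_inverse by auto
    qed
    show "M \<otimes>\<^bsub>G\<^esub> N \<in> H" if MN: "M \<in> H" "N \<in> H" for M N
    proof -
      obtain x y where "x \<in> K" "x \<noteq> 0" "M = principal x" "y \<in> K" "y \<noteq> 0" "N = principal y"
        using MN unfolding H_eq by blast
      thus ?thesis unfolding G_simps H_eq using cprod_principal K_mult by fastforce
    qed
  qed
qed

end

section \<open>Class numbers\<close>

context quadratic
begin

lemma two_generator_fideal:
  assumes "x \<in> R" "y \<in> R" "x \<noteq> 0"
  shows "fideal {x * r + y * s | r s. r \<in> R \<and> s \<in> R}" (is "fideal ?M")
proof (rule fidealI[of ?M x 1])
  show "?M \<subseteq> K" using assms(1,2) by (auto intro!: R_K R_add R_mult)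
  have "x = x * 1 + y * 0" by simp
  thus "x \<in> ?M" using R_0 R_1 by blast
  show "u + v \<in> ?M" if uv: "u \<in> ?M" "v \<in> ?M" for u v
  proof -
    obtain r s r' s' where *: "u = x * r + y * s" "r \<in> R" "s \<in> R" "v = x * r' + y * s'" "r' \<in> R" "s' \<in> R"
      using uv by blast
    have "u + v = x * (r + r') + y * (s + s')" using * by (simp add: algebra_simps)
    thus ?thesis using R_add[OF *(2,5)] R_add[OF *(3,6)] by blast
  qed
  show "c * u \<in> ?M" if c: "c \<in> R" and u: "u \<in> ?M" for c u
  proof -
    obtain r s where *: "u = x * r + y * s" "r \<in> R" "s \<in> R" using u by blast
    have "c * u = x * (c * r) + y * (c * s)" using * by (simp add: algebra_simps)
    thus ?thesis using R_mult[OF c *(2)] R_mult[OF c *(3)] by blast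
  qed
  show "1 * u \<in> R" if u: "u \<in> ?M" for u
  proof -
    obtain r s where *: "u = x * r + y * s" "r \<in> R" "s \<in> R" using u by blast
    thus ?thesis using assms by (simp add: R_add R_mult)
  qed
qed (use assms R_1 in auto)

lemma gconj_cprod:
  assumes "M \<subseteq> K" "N \<subseteq> K"
  shows "gconj ` (M \<star> N) = (gconj ` M) \<star> (gconj ` N)"
proof -
  have sub: "gconj ` (M \<star> N) \<subseteq> (gconj ` M) \<star> (gconj ` N)" if MN: "M \<subseteq> K" "N \<subseteq> K" for M N
  proof
    fix w assume "w \<in> gconj ` (M \<star> N)"
    then obtain z where z: "z \<in> M \<star> N" "w = gconj z" by blast
    from z(1) have "z \<in> K \<and> gconj z \<in> (gconj ` M) \<star> (gconj ` N)"
    proof (induction rule: cprod_induct)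
      case (mult x y)
      have xy: "x \<in> K" "y \<in> K" using mult MN by blast+
      have "gconj x * gconj y \<in> (gconj ` M) \<star> (gconj ` N)" by (intro cprod_mult imageI mult)
      thus ?case using xy by (simp add: K_mult conj_mult)
    qed (simp add: K_add conj_add cprod_add)
    thus "w \<in> (gconj ` M) \<star> (gconj ` N)" using z(2) by simp
  qed
  have inv: "gconj ` gconj ` M = M" if MK: "M \<subseteq> K" for M
  proof -
    have "(\<lambda>x. gconj (gconj x)) ` M = (\<lambda>x. x) ` M" by (rule image_cong) (use MK conj_conj in auto)
    thus ?thesis by (simp add: image_image)
  qed
  have cK: "gconj ` M \<subseteq> K" if "M \<subseteq> K" for M using that conj_K by blast
  have "gconj ` ((gconj ` M) \<star> (gconj ` N)) \<subseteq> M \<star> N"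
    using sub[OF cK[OF assms(1)] cK[OF assms(2)]] inv assms by simp
  hence "gconj ` gconj ` ((gconj ` M) \<star> (gconj ` N)) \<subseteq> gconj ` (M \<star> N)" by (rule image_mono)
  moreover have "(gconj ` M) \<star> (gconj ` N) \<subseteq> K"
    by (rule cprod_subsetI) (use assms in \<open>auto intro!: K_mult K_add conj_K\<close>)
  ultimately have "(gconj ` M) \<star> (gconj ` N) \<subseteq> gconj ` (M \<star> N)" using inv by simp
  thus ?thesis using sub[OF assms] by blast
qed

lemma gconj_R: "gconj ` R = R"
proof
  show "gconj ` R \<subseteq> R" using R_conj by blast
  show "R \<subseteq> gconj ` R"
  proof
    fix x assume x: "x \<in> R"
    have "x = gconj (gconj x)" using conj_conj[OF R_K[OF x]] by simp
    thus "x \<in> gconj ` R" using R_conj[OF x] by blast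
  qed
qed

lemma gconj_principal: "x \<in> K \<Longrightarrow> gconj ` principal x = principal (gconj x)"
proof -
  assume x: "x \<in> K"
  have "gconj ` principal x = (\<lambda>r. gconj x * gconj r) ` R"
    unfolding principal_def image_image by (rule image_cong) (auto simp: conj_mult x R_K)
  also have "\<dots> = (\<lambda>r. gconj x * r) ` gconj ` R" by (simp add: image_image)
  finally show ?thesis by (simp add: gconj_R principal_def)
qed

text \<open>The mixed terms of the power contain x y and are therefore multiples of q. The exponent
  is a successor because exponent 0 would compare 1 with 1 + 1.\<close>

lemma power_sum_mod:
  assumes x: "x \<in> R" "y \<in> R" and xy: "x * y = of_int q * z" "z \<in> R"
  shows "\<exists>w\<in>R. (x + y) ^ Suc n = x ^ Suc n + y ^ Suc n + of_int q * w"
proof (induction n)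
  case 0
  show ?case using R_0 by (intro bexI[of _ 0]) auto
next
  case (Suc n)
  then obtain w where w: "w \<in> R" "(x + y) ^ Suc n = x ^ Suc n + y ^ Suc n + of_int q * w" by blast
  have "(x + y) ^ Suc (Suc n) = (x + y) * (x + y) ^ Suc n" by simp
  also have "\<dots> = x ^ Suc (Suc n) + y ^ Suc (Suc n) + (x * y) * (x ^ n + y ^ n) + of_int q * (w * (x + y))"
    unfolding w(2) by (simp add: algebra_simps)
  also have "\<dots> = x ^ Suc (Suc n) + y ^ Suc (Suc n) + of_int q * (z * (x ^ n + y ^ n) + w * (x + y))"
    unfolding xy(1) by (simp add: algebra_simps)
  finally show ?case
    by (rule bexI) (intro R_add R_mult R_power xy(2) w(1) x)
qed

text \<open>The ideal P = (q, \<pi>) and its conjugate P' satisfy P P' = (q), since the product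
  contains q^2 and q t, and q does not divide t. If P^n = (\<gamma>), then \<gamma> has norm +-q^n.
  Moreover q does not divide \<gamma>: otherwise it divides \<pi>^n and its conjugate, hence t^n. So
  \<open>gen\<close> applies to every n >= 1 with P^n principal, in particular to the order of the
  class of P.\<close>

lemma three_dvd_class_number:
  fixes q :: int
  assumes q: "prime q" and \<pi>: "\<pi> \<in> R" and tr: "\<pi> + gconj \<pi> = of_int t" "\<not> q dvd t"
    and nm: "\<pi> * gconj \<pi> = of_int (q * u)"
    and gen: "\<And>\<gamma> n. \<gamma> \<in> R \<Longrightarrow> n \<ge> 1 \<Longrightarrow> \<gamma> * gconj \<gamma> = of_int (q ^ n) \<or> \<gamma> * gconj \<gamma> = of_int (- (q ^ n)) \<Longrightarrow>
      \<gamma> / of_int q \<notin> R \<Longrightarrow> 3 dvd n"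
  shows "3 dvd class_number K"
proof -
  interpret G: comm_group G by (rule comm_group_G)
  have norm: "H \<lhd> G" by (rule G.normal_iff_subgroup[THEN iffD2, OF subgroup_H])
  then interpret N: normal H G .
  interpret Q: group "G Mod H" by (rule N.factorgroup_is_group)
  have q0: "q \<noteq> 0" using q by auto
  define P where "P = {of_int q * r + \<pi> * s | r s. r \<in> R \<and> s \<in> R}"
  define P' where "P' = {of_int q * r + gconj \<pi> * s | r s. r \<in> R \<and> s \<in> R}"
  have \<pi>': "gconj \<pi> \<in> R" by (rule R_conj[OF \<pi>])
  have fP: "fideal P" "fideal P'" unfolding P_def P'_def
    by (rule two_generator_fideal; use R_of_int \<pi> \<pi>' q0 in simp)+
  have PG: "P \<in> carrier G" "P' \<in> carrier G" using fP by (simp_all add: G_simps)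
  have PR: "P \<subseteq> R" unfolding P_def using \<pi> by (auto intro!: R_add R_mult R_of_int)
  have conjP: "gconj ` P = P'"
  proof -
    have sub: "gconj ` {of_int q * r + x * s | r s. r \<in> R \<and> s \<in> R} \<subseteq> {of_int q * r + gconj x * s | r s. r \<in> R \<and> s \<in> R}"
      if x: "x \<in> R" for x
    proof
      fix w assume "w \<in> gconj ` {of_int q * r + x * s | r s. r \<in> R \<and> s \<in> R}"
      then obtain r s where rs: "r \<in> R" "s \<in> R" "w = gconj (of_int q * r + x * s)" by blast
      hence "w = of_int q * gconj r + gconj x * gconj s"
        using x by (simp add: conj_add conj_mult K_mult K_of_int R_K conj_of_int)
      thus "w \<in> {of_int q * r + gconj x * s | r s. r \<in> R \<and> s \<in> R}" using R_conj rs by blast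
    qed
    have "gconj ` P' \<subseteq> P" using sub[OF \<pi>'] conj_conj[OF R_K[OF \<pi>]] unfolding P_def P'_def by simp
    hence "gconj ` gconj ` P' \<subseteq> gconj ` P" by (rule image_mono)
    moreover have "gconj ` gconj ` P' = P'"
    proof -
      have "(\<lambda>x. gconj (gconj x)) ` P' = (\<lambda>x. x) ` P'"
        by (rule image_cong) (use fidealD(1)[OF fP(2)] conj_conj in auto)
      thus ?thesis by (simp add: image_image)
    qed
    moreover have "gconj ` P \<subseteq> P'" using sub[OF \<pi>] unfolding P_def P'_def .
    ultimately show ?thesis by (simp only: set_eq_subset)
  qed
  have qK: "of_int q \<in> K" "of_int q \<noteq> (0::complex)" using K_of_int q0 by auto
  note fq = fidealD[OF fideal_principal[OF qK]] and fPP = fidealD[OF fideal_cprod[OF fP]]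
  have PP: "P \<star> P' = principal (of_int q)"
  proof
    show "P \<star> P' \<subseteq> principal (of_int q)"
    proof (rule cprod_subsetI)
      fix x y assume "x \<in> P" "y \<in> P'"
      then obtain r s r' s' where *: "r \<in> R" "s \<in> R" "r' \<in> R" "s' \<in> R"
        "x = of_int q * r + \<pi> * s" "y = of_int q * r' + gconj \<pi> * s'" unfolding P_def P'_def by blast
      have "x * y = of_int q * (of_int q * r * r' + r * gconj \<pi> * s' + \<pi> * s * r') + (\<pi> * gconj \<pi>) * (s * s')"
        using * by (simp add: algebra_simps)
      also have "\<dots> = of_int q * (of_int q * r * r' + r * gconj \<pi> * s' + \<pi> * s * r' + of_int u * s * s')"
        unfolding nm by (simp add: algebra_simps)
      finally have "x * y = of_int q * (of_int q * r * r' + r * gconj \<pi> * s' + \<pi> * s * r' + of_int u * s * s')" .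
      moreover have "of_int q * r * r' + r * gconj \<pi> * s' + \<pi> * s * r' + of_int u * s * s' \<in> R"
        by (intro R_add R_mult R_of_int * \<pi> \<pi>')
      ultimately show "x * y \<in> principal (of_int q)" using principal_mem(1) by simp
    qed (rule fq(3))
    have m: "of_int q \<in> P" "\<pi> \<in> P" "of_int q \<in> P'" "gconj \<pi> \<in> P'"
    proof -
      have "of_int q = of_int q * 1 + x * 0" "x = of_int q * 0 + x * 1" for x :: complex by simp_all
      thus "of_int q \<in> P" "\<pi> \<in> P" "of_int q \<in> P'" "gconj \<pi> \<in> P'"
        unfolding P_def P'_def using R_0 R_1 by blast+
    qed
    have "coprime q t" using q tr(2) by (rule prime_imp_coprime)
    then obtain a b where ab: "a * q + b * t = 1" using bezout_int[of q t] by (auto simp: coprime_iff_gcd_eq_1)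
    have "of_int a * (of_int q * of_int q) + of_int b * (\<pi> * of_int q) + of_int b * (of_int q * gconj \<pi>) \<in> P \<star> P'"
      by (intro fPP(3) fPP(4) R_of_int cprod_mult m)
    also have "of_int a * (of_int q * of_int q) + of_int b * (\<pi> * of_int q) + of_int b * (of_int q * gconj \<pi>)
        = of_int q * (of_int a * of_int q + of_int b * (\<pi> + gconj \<pi>))" by (simp add: algebra_simps)
    also have "\<dots> = of_int (q * (a * q + b * t))" unfolding tr by simp
    finally have "of_int q \<in> P \<star> P'" unfolding ab by simp
    thus "principal (of_int q) \<subseteq> P \<star> P'"
      unfolding principal_def using fPP(4) by (auto simp: mult.commute)
  qed
  have main: "3 dvd n" if n: "n \<ge> 1" and PH: "P [^]\<^bsub>G\<^esub> n \<in> H" for n :: nat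
  proof -
    obtain \<gamma> where \<gamma>: "\<gamma> \<in> K" "\<gamma> \<noteq> 0" "P [^]\<^bsub>G\<^esub> n = principal \<gamma>" using PH unfolding H_eq by blast
    have pow: "P [^]\<^bsub>G\<^esub> l \<subseteq> R \<and> gconj ` (P [^]\<^bsub>G\<^esub> l) = P' [^]\<^bsub>G\<^esub> l \<and> \<pi> ^ l \<in> P [^]\<^bsub>G\<^esub> l
        \<and> principal (of_int q) [^]\<^bsub>G\<^esub> l = principal (of_int (q ^ l))" for l :: nat
    proof (induction l)
      case 0
      show ?case by (simp add: G_simps gconj_R R_1 principal_1)
    next
      case (Suc l)
      have "P [^]\<^bsub>G\<^esub> l \<star> P \<subseteq> R"
        by (rule cprod_subsetI) (use Suc PR in \<open>auto intro: R_mult R_add\<close>)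
      moreover have "gconj ` (P [^]\<^bsub>G\<^esub> l \<star> P) = P' [^]\<^bsub>G\<^esub> l \<star> P'"
        using gconj_cprod[of "P [^]\<^bsub>G\<^esub> l" P] Suc PR R_K conjP by (simp add: subset_iff)
      moreover have "\<pi> = of_int q * 0 + \<pi> * 1" by simp
      hence "\<pi> \<in> P" unfolding P_def using R_0 R_1 by blast
      hence "\<pi> ^ l * \<pi> \<in> P [^]\<^bsub>G\<^esub> l \<star> P" using Suc by (intro cprod_mult) auto
      moreover have "principal (of_int (q ^ l)) \<star> principal (of_int q) = principal (of_int (q ^ l) * of_int q)"
        by (rule cprod_principal[OF K_of_int _ qK]) (use q0 in simp)
      ultimately show ?case using Suc by (simp add: G_simps mult.commute)
    qed
    have \<gamma>R: "\<gamma> \<in> R" using pow[of n] principal_mem(2)[of \<gamma>] unfolding \<gamma>(3) by blast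
    have "principal (of_int (q ^ n)) = (P \<otimes>\<^bsub>G\<^esub> P') [^]\<^bsub>G\<^esub> n" using pow[of n] PP by (simp add: G_simps)
    also have "\<dots> = P [^]\<^bsub>G\<^esub> n \<otimes>\<^bsub>G\<^esub> P' [^]\<^bsub>G\<^esub> n" by (rule G.nat_pow_distrib[OF PG])
    also have "\<dots> = principal \<gamma> \<star> principal (gconj \<gamma>)"
      using pow[of n] gconj_principal[OF \<gamma>(1)] \<gamma>(3) by (simp add: G_simps)
    also have "\<dots> = principal (\<gamma> * gconj \<gamma>)"
    proof (rule cprod_principal[OF \<gamma>(1,2) conj_K[OF \<gamma>(1)]])
      show "gconj \<gamma> \<noteq> 0"
      proof
        assume "gconj \<gamma> = 0"
        hence "gconj (gconj \<gamma>) = 0" using conj_of_int[of 0] by simp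
        thus False using conj_conj[OF \<gamma>(1)] \<gamma>(2) by simp
      qed
    qed
    finally have peq: "principal (of_int (q ^ n)) = principal (\<gamma> * gconj \<gamma>)" .
    obtain T0 N0 where "\<gamma> + gconj \<gamma> = of_int T0" and N0: "\<gamma> * gconj \<gamma> = of_int N0" by (rule R_trace_norm[OF \<gamma>R])
    have dv: "a dvd b" if ab: "principal (of_int a) = principal (of_int b)" "a \<noteq> 0" for a b :: int
    proof -
      have "of_int b \<in> principal (of_int a)" using principal_mem(2) ab by simp
      then obtain r where r: "r \<in> R" "of_int b = of_int a * r" unfolding principal_def by blast
      hence "r = of_rat (of_int b / of_int a)" using ab(2) by (simp add: of_rat_divide field_simps)
      hence "(of_int b / of_int a :: rat) \<in> \<int>" using r(1) R_of_rat_iff by simp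
      then obtain k where "(of_int b / of_int a :: rat) = of_int k" by (rule Ints_cases)
      hence "(of_int b :: rat) = of_int (a * k)" using ab(2) by (simp add: field_simps)
      hence "b = a * k" using of_int_eq_iff by blast
      thus ?thesis by simp
    qed
    have 1: "q ^ n dvd N0" using dv peq N0 q0 by simp
    have "N0 \<noteq> 0" 
    proof
      assume "N0 = 0"
      hence *: "\<gamma> * gconj \<gamma> = 0" using N0 by simp
      obtain x where "x \<noteq> 0" "\<gamma> * gconj \<gamma> = of_rat x" by (rule norm_nonzero[OF \<gamma>(1,2)])
      thus False using * by simp
    qed
    hence 2: "N0 dvd q ^ n" using dv peq N0 by simp
    have "\<bar>N0\<bar> = \<bar>q ^ n\<bar>" using zdvd_antisym_abs[OF 2 1] .
    hence "\<gamma> * gconj \<gamma> = of_int (q ^ n) \<or> \<gamma> * gconj \<gamma> = of_int (- (q ^ n))"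
      unfolding N0 of_int_eq_iff by (simp only: abs_eq_iff)
    moreover have "\<gamma> / of_int q \<notin> R"
    proof
      assume *: "\<gamma> / of_int q \<in> R"
      obtain w where w: "w \<in> R" "\<pi> ^ n = \<gamma> * w" using pow[of n] unfolding \<gamma>(3) principal_def by blast
      define v where "v = (\<gamma> / of_int q) * w"
      have v: "v \<in> R" "\<pi> ^ n = of_int q * v" using R_mult[OF * w(1)] w(2) q0 by (simp_all add: v_def)
      have cv: "gconj \<pi> ^ l = gconj (\<pi> ^ l)" for l
      proof (induction l)
        case 0 show ?case using conj_of_int[of 1] by simp
      next
        case (Suc l) thus ?case by (simp add: conj_mult R_K \<pi> R_power)
      qed
      have cvq: "gconj \<pi> ^ n = of_int q * gconj v"
        unfolding cv v(2) by (simp add: conj_mult K_of_int R_K[OF v(1)] conj_of_int)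
      have "\<pi> * gconj \<pi> = of_int q * of_int u" using nm by simp
      from power_sum_mod[OF \<pi> \<pi>' this R_of_int, of "n - 1"] n
      obtain z where z: "z \<in> R" "(\<pi> + gconj \<pi>) ^ n = \<pi> ^ n + gconj \<pi> ^ n + of_int q * z" by auto
      have "of_int (t ^ n) = of_int q * (v + gconj v + z)"
        using z(2) unfolding tr v(2) cvq by (simp add: algebra_simps)
      hence "of_rat (of_int (t ^ n)) / of_int q = v + gconj v + z" using q0 unfolding of_rat_of_int_eq by (simp add: field_simps)
      hence "of_rat (of_int (t ^ n) / of_int q) = v + gconj v + z" unfolding of_rat_divide of_rat_of_int_eq .
      hence "of_rat (of_int (t ^ n) / of_int q) \<in> R" using v z R_conj R_add by simp
      hence "(of_int (t ^ n) / of_int q :: rat) \<in> \<int>" by (simp only: R_of_rat_iff)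
      then obtain k where "(of_int (t ^ n) / of_int q :: rat) = of_int k" by (rule Ints_cases)
      hence "(of_int (t ^ n) :: rat) = of_int (q * k)" using q0 by (simp add: field_simps)
      hence "t ^ n = q * k" using of_int_eq_iff by blast
      hence "q dvd t ^ n" by simp
      hence "q dvd t" using q prime_dvd_power by blast
      thus False using tr(2) by simp
    qed
    ultimately show ?thesis using gen[OF \<gamma>R n] by blast
  qed
  show ?thesis
  proof (cases "finite (carrier (G Mod H))")
    case False \<comment> \<open>the order of an infinite group is 0 by convention\<close>
    thus ?thesis unfolding class_number_def class_group_def Coset.order_def by simp
  next
    case True
    define c where "c = H #>\<^bsub>G\<^esub> P"
    have c: "c \<in> carrier (G Mod H)" unfolding c_def carrier_FactGroup using PG by blast
    have o: "Q.ord c \<ge> 1" using Q.ord_ge_1[OF True c] .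
    have "c [^]\<^bsub>G Mod H\<^esub> Q.ord c = \<one>\<^bsub>G Mod H\<^esub>" by (rule Q.pow_ord_eq_1[OF c])
    hence "H #>\<^bsub>G\<^esub> (P [^]\<^bsub>G\<^esub> Q.ord c) = H"
      unfolding c_def N.FactGroup_pow[OF PG(1)] by simp
    hence "P [^]\<^bsub>G\<^esub> Q.ord c \<in> H"
      using G.rcos_self[OF G.nat_pow_closed[OF PG(1)] subgroup_H, of "Q.ord c"] by (simp only:)
    hence "3 dvd Q.ord c" using main[OF o] by blast
    also have "Q.ord c dvd Coset.order (G Mod H)" by (rule Q.ord_dvd_group_order[OF c])
    finally show ?thesis by (simp add: class_number_def class_group_def)
  qed
qed

text \<open>Write \<gamma> = (x + (Y / f) sqrt D) / 2 with Y / f in lowest terms. The norm equation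
  x^2 f^2 - D Y^2 = 4 k f^2 forces f^2 to divide D. A nontrivial \<open>f\<close> can occur because
  \<open>D\<close> may have square factors.\<close>

lemma R_coordinates:
  assumes \<gamma>: "\<gamma> \<in> R" and nm: "\<gamma> * gconj \<gamma> = of_int k"
  obtains x Y f D' where "\<gamma> + gconj \<gamma> = of_int x" "coprime Y f" "D = f\<^sup>2 * D'" "x\<^sup>2 - D' * Y\<^sup>2 = 4 * k"
proof -
  obtain a b where ab: "\<gamma> = el a b" using R_K[OF \<gamma>] by (rule K_cases)
  have "2 * a \<in> \<int>" using \<gamma> unfolding ab R_el_iff by blast
  then obtain x where x: "2 * a = of_int x" by (rule Ints_cases)
  have "(of_rat (a\<^sup>2 - of_int D * b\<^sup>2) :: complex) = of_rat (of_int k)" using nm unfolding ab norm_el by simp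
  hence n: "a\<^sup>2 - of_int D * b\<^sup>2 = of_int k" using of_rat_eq_iff by blast
  obtain Y f where Yf: "quotient_of (2 * b) = (Y, f)" by fastforce
  have f: "f > 0" "coprime Y f" using quotient_of_denom_pos[OF Yf] quotient_of_coprime[OF Yf] .
  have b: "2 * b * of_int f = of_int Y" using quotient_of_div[OF Yf] f(1) by simp
  have "of_int (x\<^sup>2 * f\<^sup>2 - D * Y\<^sup>2) = (2 * a * of_int f)\<^sup>2 - of_int D * (2 * b * of_int f)\<^sup>2"
    unfolding b x by (simp add: power_mult_distrib)
  also have "\<dots> = 4 * (a\<^sup>2 - of_int D * b\<^sup>2) * (of_int f)\<^sup>2"
    by (simp add: power2_eq_square algebra_simps)
  also have "\<dots> = of_int (4 * k * f\<^sup>2)" unfolding n by simp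
  finally have eq: "x\<^sup>2 * f\<^sup>2 - D * Y\<^sup>2 = 4 * k * f\<^sup>2" using of_int_eq_iff by blast
  hence "D * Y\<^sup>2 = f\<^sup>2 * (x\<^sup>2 - 4 * k)" by (simp add: algebra_simps)
  hence "f\<^sup>2 dvd D * Y\<^sup>2" by simp
  moreover have "coprime (f\<^sup>2) (Y\<^sup>2)" using f(2) by (simp add: coprime_commute)
  ultimately have "f\<^sup>2 dvd D" by (simp add: coprime_dvd_mult_left_iff)
  then obtain D' where D': "D = f\<^sup>2 * D'" by blast
  have "f\<^sup>2 * (x\<^sup>2 - D' * Y\<^sup>2) = f\<^sup>2 * (4 * k)" using eq unfolding D' by (simp add: algebra_simps)
  hence "x\<^sup>2 - D' * Y\<^sup>2 = 4 * k" using f(1) by simp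
  moreover have "\<gamma> + gconj \<gamma> = of_int x" unfolding ab trace_el x by simp
  ultimately show thesis using that f(2) D' by blast
qed

end

section \<open>The two families of quadratic fields\<close>

lemma square_mod_4: "\<exists>j::int. (even y \<and> y\<^sup>2 = 4 * j) \<or> (odd y \<and> y\<^sup>2 = 1 + 4 * j)"
proof (cases "even y")
  case True
  then obtain z where "y = 2 * z" by blast
  hence "y\<^sup>2 = 4 * z\<^sup>2" by (simp add: power2_eq_square)
  thus ?thesis using True by blast
next
  case False
  then obtain z where "y = 2 * z + 1" by (auto elim: oddE)
  hence "y\<^sup>2 = 1 + 4 * (z\<^sup>2 + z)" by (simp add: power2_eq_square algebra_simps)
  thus ?thesis using False by blast
qed

lemma class_number_case_two:
  fixes m :: int
  assumes m: "odd m" "m > 0" "3 dvd m"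
  shows "3 dvd class_number (quadratic_field (- 3 * (4 * m ^ 3 + 1)))"
proof -
  define D where "D = - 3 * (4 * m ^ 3 + 1)"
  have "m ^ 3 > 0" using m by simp
  hence "4 * m ^ 3 + 1 > 0" by simp
  hence Dneg: "D < 0" unfolding D_def by (intro mult_neg_pos) auto
  interpret quadratic D
  proof
    fix q :: rat
    have "q\<^sup>2 \<ge> 0" by simp
    moreover have "rat_of_int D < 0" using Dneg by simp
    ultimately show "q\<^sup>2 \<noteq> of_int D" by linarith
  qed
  have "odd (m ^ 3)" using m by simp
  then obtain v where v: "m ^ 3 = 2 * v + 1" by (rule oddE)
  have D4: "D = 1 + 4 * (- 1 - 3 * m ^ 3)" unfolding D_def by simp
  \<comment> \<open>The element (1 + sqrt D) / 2 has trace 1 and norm (1 - D) / 4 = 1 + 3 m^3, which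
    is even because m is odd.\<close>
  define \<pi> where "\<pi> = el (1 / 2) (1 / 2)"
  have nm2: "(1 / 2)\<^sup>2 - of_int D * (1 / 2)\<^sup>2 = (of_int (2 * (2 + 3 * v)) :: rat)"
    unfolding D_def v by (simp add: power2_eq_square field_simps)
  have "3 dvd class_number K"
  proof (rule three_dvd_class_number[of 2 \<pi> 1 "2 + 3 * v"])
    show "\<pi> \<in> R" unfolding \<pi>_def R_el_iff nm2 by simp
    show "\<pi> + gconj \<pi> = of_int 1" unfolding \<pi>_def trace_el by simp
    show "\<pi> * gconj \<pi> = of_int (2 * (2 + 3 * v))" unfolding \<pi>_def norm_el nm2 by (simp only: of_rat_of_int_eq)
    fix \<gamma> n assume \<gamma>: "\<gamma> \<in> R" and n: "n \<ge> 1"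
      and or: "\<gamma> * gconj \<gamma> = of_int (2 ^ n) \<or> \<gamma> * gconj \<gamma> = of_int (- (2 ^ n))"
      and nd: "\<gamma> / of_int 2 \<notin> R"
    obtain k where k: "k = 2 ^ n \<or> k = - (2 ^ n)" and nk: "\<gamma> * gconj \<gamma> = of_int k" using or by blast
    obtain x Y f D' where co: "\<gamma> + gconj \<gamma> = of_int x" "coprime Y f" "D = f\<^sup>2 * D'" "x\<^sup>2 - D' * Y\<^sup>2 = 4 * k"
      by (rule R_coordinates[OF \<gamma> nk])
    \<comment> \<open>The field is imaginary, so norms are not negative and the value -2^n is
      excluded.\<close>
    have "D' < 0" using Dneg unfolding co(3) by (auto simp: mult_less_0_iff)
    hence "D' * Y\<^sup>2 \<le> 0" by (simp add: mult_nonpos_nonneg)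
    hence "k \<ge> 0" using co(4) zero_le_power2[of x] by linarith
    moreover have "(2::int) ^ n > 0" by simp
    ultimately have kn: "k = 2 ^ n" using k by linarith
    have fD: "f\<^sup>2 * (- D') = 3 * (4 * m ^ 3 + 1)" using co(3) by (simp add: D_def)
    have "odd (f\<^sup>2 * (- D'))" unfolding fD by simp
    hence odds: "odd f" "odd D'" by simp_all
    have par: "even x \<longleftrightarrow> even Y"
    proof -
      have "even (x\<^sup>2 - D' * Y\<^sup>2)" unfolding co(4) by simp
      thus ?thesis using odds by simp
    qed
    \<comment> \<open>If x and Y were even, then for n >= 2 trace and norm would show that \<gamma>
      / 2 is integral. For n = 1 the equation x1^2 - D' Y1^2 = 2 is impossible modulo 4, as D' is 1
      modulo 4.\<close>
    have "odd x"
    proof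
      assume "even x"
      hence "even x" "even Y" using par by auto
      then obtain x1 Y1 where x1: "x = 2 * x1" "Y = 2 * Y1" by blast
      have eq1: "x1\<^sup>2 - D' * Y1\<^sup>2 = 2 ^ n" using co(4) unfolding x1 kn by (simp add: power2_eq_square)
      have n1: "n \<noteq> 1"
      proof
        assume n1: "n = 1"
        obtain f1 where f1: "f = 2 * f1 + 1" using odds(1) by (auto elim: oddE)
        have "f\<^sup>2 = 1 + 4 * (f1\<^sup>2 + f1)" unfolding f1 by (simp add: power2_eq_square algebra_simps)
        hence "D = D' + 4 * ((f1\<^sup>2 + f1) * D')" unfolding co(3) by (simp add: algebra_simps)
        hence "D' = 1 + 4 * (- 1 - 3 * m ^ 3 - (f1\<^sup>2 + f1) * D')" unfolding D4 by (simp add: algebra_simps)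
        then obtain j where j: "D' = 1 + 4 * j" by blast
        obtain i1 i2 where i: "x1\<^sup>2 = 4 * i1 \<or> x1\<^sup>2 = 1 + 4 * i1" "Y1\<^sup>2 = 4 * i2 \<or> Y1\<^sup>2 = 1 + 4 * i2"
          using square_mod_4[of x1] square_mod_4[of Y1] by blast
        define J where "J = j * Y1\<^sup>2"
        have "x1\<^sup>2 - Y1\<^sup>2 - 4 * J = 2" using eq1 unfolding j n1 J_def by (simp add: algebra_simps)
        thus False using i by presburger
      qed
      have "\<gamma> / of_int 2 \<in> R"
      proof (rule R_div_intI[OF R_K[OF \<gamma>] co(1) nk])
        have "n = 2 + (n - 2)" using n n1 by simp
        hence "(2::int) ^ n = 2\<^sup>2 * 2 ^ (n - 2)" by (metis power_add)
        thus "2\<^sup>2 dvd k" unfolding kn by simp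
      qed (use \<open>even x\<close> in auto)
      thus False using nd by simp
    qed
    moreover have "odd Y" using \<open>odd x\<close> par by simp
    moreover have "x\<^sup>2 + (- D') * Y\<^sup>2 = 4 * 2 ^ n" using co(4) kn by simp
    ultimately show "3 dvd n" using exponent_of_two_dvd_3[OF m(3,1) fD co(2)] n by blast
  qed auto
  thus ?thesis by (simp add: D_def)
qed

lemma class_number_case_five:
  fixes M :: int
  assumes M: "odd M" "[M = 4] (mod 15)"
  shows "3 dvd class_number (quadratic_field (3 * (2 * M ^ 3 - 1)))"
proof -
  define D where "D = 3 * (2 * M ^ 3 - 1)"
  have M3: "[M = 1] (mod 3)" and M5: "[M = - 1] (mod 5)"
    using M(2) unfolding cong_iff_dvd_diff by presburger+
  obtain m' where m': "M = 1 + 3 * m'" by (rule cong_intE[OF M3])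
  \<comment> \<open>D is 3 modulo 9, so it is divisible by 3 but not by 9 and cannot be a
    square.\<close>
  have D9: "D = 3 + 9 * (2 * (3 * m' + 9 * m'\<^sup>2 + 9 * m' ^ 3))"
    unfolding D_def m' by (simp add: power2_eq_square power3_eq_cube algebra_simps)
  interpret quadratic D
  proof
    fix q :: rat
    show "q\<^sup>2 \<noteq> of_int D"
    proof
      assume q: "q\<^sup>2 = of_int D"
      hence "q\<^sup>2 \<in> \<int>" by simp
      hence "q \<in> \<int>" by (rule rational_square_int)
      then obtain k where "q = of_int k" by (rule Ints_cases)
      hence "(of_int (k\<^sup>2) :: rat) = of_int D" using q by simp
      hence k: "k\<^sup>2 = D" using of_int_eq_iff by blast
      hence "3 dvd k\<^sup>2" by (simp add: D_def)
      hence "3 dvd k" using prime_dvd_power[of "3::int" k 2] by simp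
      then obtain l where "k = 3 * l" by blast
      hence "9 * l\<^sup>2 = D" using k by (simp add: power2_eq_square)
      hence "9 * (l\<^sup>2 - 2 * (3 * m' + 9 * m'\<^sup>2 + 9 * m' ^ 3)) = 3" unfolding D9 by simp
      hence "9 dvd (3::int)" by (metis dvd_triv_left)
      thus False by simp
    qed
  qed
  have "odd (M ^ 3)" using M by simp
  then obtain v where v: "M ^ 3 = 2 * v + 1" by (rule oddE)
  have D4: "D = 3 + 4 * (3 * v)" unfolding D_def v by simp
  have "[4 - 6 * M ^ 3 = 4 - 6 * (- 1) ^ 3] (mod 5)" by (intro cong_diff cong_mult cong_pow cong_refl M5)
  hence "5 dvd 4 - 6 * M ^ 3" unfolding cong_iff_dvd_diff by simp presburger
  then obtain u where u: "4 - 6 * M ^ 3 = 5 * u" by blast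
  \<comment> \<open>The element 1 + sqrt D has trace 2 and norm 1 - D = 4 - 6 M^3, a multiple of 5
    because M is -1 modulo 5.\<close>
  define \<pi> where "\<pi> = el 1 1"
  have nm5: "1\<^sup>2 - of_int D * 1\<^sup>2 = (of_int (5 * u) :: rat)"
    unfolding D_def u[symmetric] by simp
  have "3 dvd class_number K"
  proof (rule three_dvd_class_number[of 5 \<pi> 2 u])
    show "\<pi> \<in> R" unfolding \<pi>_def R_el_iff nm5 by simp
    show "\<pi> + gconj \<pi> = of_int 2" unfolding \<pi>_def trace_el by simp
    show "\<pi> * gconj \<pi> = of_int (5 * u)" unfolding \<pi>_def norm_el nm5 by (simp only: of_rat_of_int_eq)
    fix \<gamma> n assume \<gamma>: "\<gamma> \<in> R" and n: "n \<ge> 1"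
      and or: "\<gamma> * gconj \<gamma> = of_int (5 ^ n) \<or> \<gamma> * gconj \<gamma> = of_int (- (5 ^ n))"
      and nd: "\<gamma> / of_int 5 \<notin> R"
    obtain \<eta> :: int where \<eta>: "\<eta> = 1 \<or> \<eta> = - 1" and nk: "\<gamma> * gconj \<gamma> = of_int (\<eta> * 5 ^ n)"
    proof -
      from or show thesis
      proof
        assume "\<gamma> * gconj \<gamma> = of_int (5 ^ n)" thus thesis using that[of 1] by simp
      next
        assume "\<gamma> * gconj \<gamma> = of_int (- (5 ^ n))" thus thesis using that[of "- 1"] by simp
      qed
    qed
    obtain x Y f D' where co: "\<gamma> + gconj \<gamma> = of_int x" "coprime Y f" "D = f\<^sup>2 * D'" "x\<^sup>2 - D' * Y\<^sup>2 = 4 * (\<eta> * 5 ^ n)"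
      by (rule R_coordinates[OF \<gamma> nk])
    have "odd D" unfolding D4 by simp
    hence odds: "odd f" unfolding co(3) by simp
    obtain f1 where f1: "f = 2 * f1 + 1" using odds(1) by (auto elim: oddE)
    have "f\<^sup>2 = 1 + 4 * (f1\<^sup>2 + f1)" unfolding f1 by (simp add: power2_eq_square algebra_simps)
    hence "D = D' + 4 * ((f1\<^sup>2 + f1) * D')" unfolding co(3) by (simp add: algebra_simps)
    hence "D' = 3 + 4 * (3 * v - (f1\<^sup>2 + f1) * D')" unfolding D4 by (simp add: algebra_simps)
    then obtain j where j: "D' = 3 + 4 * j" by blast
    \<comment> \<open>D' is 3 modulo 4, so x^2 - D' Y^2 is divisible by 4 only if x and Y are
      even.\<close>
    have ev: "even x \<and> even Y"
    proof -
      obtain i1 where i1: "(even x \<and> x\<^sup>2 = 4 * i1) \<or> (odd x \<and> x\<^sup>2 = 1 + 4 * i1)" using square_mod_4 by blast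
      obtain i2 where i2: "(even Y \<and> Y\<^sup>2 = 4 * i2) \<or> (odd Y \<and> Y\<^sup>2 = 1 + 4 * i2)" using square_mod_4 by blast
      define J where "J = j * Y\<^sup>2 + \<eta> * 5 ^ n"
      have "x\<^sup>2 - 3 * Y\<^sup>2 = 4 * J" using co(4) unfolding j J_def by (simp add: algebra_simps)
      thus ?thesis using i1 i2 by presburger
    qed
    then obtain x1 Y1 where x1: "x = 2 * x1" "Y = 2 * Y1" by blast
    have eq1: "x1\<^sup>2 - D' * Y1\<^sup>2 = \<eta> * 5 ^ n" using co(4) unfolding x1 by (simp add: power2_eq_square)
    have "\<not> (5 dvd x1 \<and> 5 dvd Y1)"
    proof
      assume *: "5 dvd x1 \<and> 5 dvd Y1"
      then obtain x2 Y2 where x2: "x1 = 5 * x2" "Y1 = 5 * Y2" by blast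
      have "\<eta> * 5 ^ n = 5\<^sup>2 * (x2\<^sup>2 - D' * Y2\<^sup>2)"
        unfolding eq1[symmetric] x2 by (simp add: power2_eq_square algebra_simps)
      hence "5\<^sup>2 dvd \<eta> * 5 ^ n" by simp
      moreover have "5 dvd x" unfolding x1 x2 by simp
      ultimately have "\<gamma> / of_int 5 \<in> R" by (intro R_div_intI[OF R_K[OF \<gamma>] co(1) nk]) auto
      thus False using nd by simp
    qed
    moreover have "coprime Y1 f" using co(2) unfolding x1 by simp
    moreover have "f\<^sup>2 * D' = 3 * (2 * M ^ 3 - 1)" using co(3) by (simp add: D_def)
    ultimately show "3 dvd n"
      using exponent_of_five_dvd_3[OF M(2,1) _ _ eq1 \<eta> _ n] by blast
  qed auto
  thus ?thesis by (simp add: D_def)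
qed

theorem theorem3p1:
  fixes m :: int
  assumes "odd m" and "m > 0"
  shows "([m = 0] (mod 3) \<longrightarrow>
            3 dvd class_number (quadratic_field (- 3 * (4 * m ^ 3 + 1)))) \<and>
         ([m = 4] (mod 15) \<longrightarrow>
            (\<forall>n::nat. odd n \<and> n \<ge> 3 \<longrightarrow>
               3 dvd class_number (quadratic_field (3 * (2 * m ^ (3 * n) - 1)))))"
proof (intro conjI impI allI)
  assume "[m = 0] (mod 3)"
  hence "3 dvd m" by (simp add: cong_0_iff)
  thus "3 dvd class_number (quadratic_field (- 3 * (4 * m ^ 3 + 1)))"
    by (rule class_number_case_two[OF assms])
next
  fix n :: nat
  assume m: "[m = 4] (mod 15)" and n: "odd n \<and> 3 \<le> n"
  \<comment> \<open>As 4^2 is 1 modulo 15, an odd power of m is again 4 modulo 15. The claim is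
    thereby reduced to the cube of M = m^n.\<close>
  obtain h where h: "n = 2 * h + 1" using n by (auto elim: oddE)
  have "[m ^ n = 4 ^ n] (mod 15)" by (intro cong_pow m)
  also have "(4::int) ^ n = 16 ^ h * 4" unfolding h by (simp add: power_mult)
  also have "[16 ^ h * 4 = 1 ^ h * 4] (mod (15::int))" by (intro cong_mult cong_pow cong_refl) (simp add: cong_def)
  finally have "[m ^ n = 4] (mod 15)" by simp
  hence "3 dvd class_number (quadratic_field (3 * (2 * (m ^ n) ^ 3 - 1)))"
    by (intro class_number_case_five) (use assms in auto)
  thus "3 dvd class_number (quadratic_field (3 * (2 * m ^ (3 * n) - 1)))"
    by (simp add: power_mult[symmetric] mult.commute)
qed

end
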